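(* Let $\mathbb{X}$ and $\mathbb{Y}$ be $\varepsilon$-geometric crystals of type $A_n$ with underlying ind-varieties $X,Y$ and epsilon systems $E_{\mathbb X}=\{\varepsilon^X_J,\varepsilon^{*X}_J\}_{J\in\mathcal J}$ and $E_{\mathbb Y}=\{\varepsilon^Y_J,\varepsilon^{*Y}_J\}_{J\in\mathcal J}$, such that the functions $\varepsilon^X_i,\varepsilon^Y_i,\gamma^X_i,\gamma^Y_i$ ($i\in I$) are not identically zero (on any component). Suppose that the product $\mathbb X\times\mathbb Y$ has a geometric crystal structure (with the product formulas recalled in the context). For $1\le s\le t\le n$ define rational functions on $X\times Y$ by $$\varepsilon_{[s,t]}(x,y):=\sum_{k=s-1}^{t}\frac{\varepsilon^Y_{[s,k]}(y)\,\varepsilon^X_{[k+1,t]}(x)}{\prod_{j=s}^{k}\gamma^X_j(x)},\qquad \varepsilon^*_{[s,t]}(x,y):=\sum_{k=s-1}^{t}\frac{\varepsilon^{*X}_{[s,k]}(x)\,\varepsilon^{*Y}_{[k+1,t]}(y)}{\prod_{j=k+1}^{t}\gamma^X_j(x)}.$$ Then $E_{\mathbb X\times\mathbb Y}:=\{\varepsilon_{[s,t]}(x,y),\varepsilon^*_{[s,t]}(x,y)\}_{1\le s\le t\le n}$ is an epsilon system of the geometric crystal $\mathbb X\times\mathbb Y$; in particular $\mathbb X\times \mathbb Y$ is an $\varepsilon$-geometric crystal.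
   Context: Let $n\ge1$, $I=\{1,\dots,n\}$, and let $(a_{ij})_{i,j\in I}$ be the Cartan matrix of type $A_n$ ($a_{ii}=2$, $a_{ij}=-1$ if $|i-j|=1$, $a_{ij}=0$ otherwise). Identities between rational maps or rational functions mean equality on a dense open subset. A geometric crystal of type $A_n$ is a quadruple $(X,\{e_i\}_{i\in I},\{\gamma_i\}_{i\in I},\{\varepsilon_i\}_{i\in I})$ with $X$ an ind-variety over $\mathbb C$, $\gamma_i,\varepsilon_i$ rational functions on $X$, and $e_i:\mathbb C^\times\times X\to X$, $(c,x)\mapsto e_i^c(x)$, rational $\mathbb C^\times$-actions such that: (i) $(\{1\}\times X)\cap \mathrm{dom}(e_i)$ is open dense in $\{1\}\times X$; (ii) $\gamma_j(e_i^c(x))=c^{a_{ij}}\gamma_j(x)$; (iii) $e_i^{c_1}e_j^{c_2}=e_j^{c_2}e_i^{c_1}$ if $a_{ij}=0$, and $e_i^{c_1}e_j^{c_1c_2}e_i^{c_2}=e_j^{c_2}e_i^{c_1c_2}e_j^{c_1}$ if $a_{ij}=-1$; (iv) $\varepsilon_i(e_i^c(x))=c^{-1}\varepsilon_i(x)$, and $\varepsilon_i(e_j^c(x))=\varepsilon_i(x)$ if $a_{ij}=0$. Intervals: $[s,t]=\{s,s+1,\dots,t\}$ for $s\le t$, and $[s,t]=\varnothing$ if $s>t$. $\mathcal J$ is the set of (nonempty) intervals contained in $I$. A partition of an interval $J$ is a set $P=\{I_1,\dots,I_k\}$ of disjoint (nonempty) intervals with $I_1\sqcup\cdots\sqcup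 I_k=J$ and $\max(I_j)<\min(I_{j+1})$; $l(P)=k$; $\mathcal P_J$ is the set of partitions of $J$. Put $\varepsilon_P:=\varepsilon_{I_1}\cdots\varepsilon_{I_k}$. An epsilon system of such a geometric crystal is a set of rational functions $\{\varepsilon_J,\varepsilon^*_J\mid J\in\mathcal J\}$ on $X$ with $\varepsilon_{\{i\}}=\varepsilon_i$ (the given function) such that, for every $J=[s,t]\in\mathcal J$ and $i\in I$: (a) $\varepsilon_J(e_i^cx)=c^{-1}\varepsilon_J(x)$ if $i=s$, and $\varepsilon_J(e_i^cx)=\varepsilon_J(x)$ if $i\ne s-1,s,t+1$; (b) $\varepsilon^*_J(e_i^cx)=c^{-1}\varepsilon^*_J(x)$ if $i=t$, and $\varepsilon^*_J(e_i^cx)=\varepsilon^*_J(x)$ if $i\neq s-1,t,t+1$; (c) $\varepsilon^*_J=\sum_{P\in\mathcal P_J}(-1)^{|J|-l(P)}\varepsilon_P$. Convention: $\varepsilon_\varnothing=\varepsilon^*_\varnothing=1$. A geometric crystal with an epsilon system is called an $\varepsilon$-geometric crystal. Product structure on $X\times Y$: $\gamma_i(x,y)=\gamma^X_i(x)\gamma^Y_i(y)$, $\varepsilon_i(x,y)=\varepsilon^X_i(x)+\varepsilon^Y_i(y)/\gamma^X_i(x)$, and $e_i^c(x,y)=(e_i^{c_1}(x),e_i^{c_2}(y))$ with $$c_1=\frac{c\,\gamma^X_i(x)\varepsilon^X_i(x)+\varepsilon^Y_i(y)}{\gamma^X_i(x)\varepsilon^X_i(x)+\varepsilon^Y_i(y)},\qquad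 c_2=\frac{c}{c_1}.$$ "The product has a geometric crystal structure" means that these formulas are well defined and make $X\times Y$ a geometric crystal of type $A_n$. *)

theory Defs
  imports
    "HOL-Analysis.Analysis"
    "HOL-Computational_Algebra.Polynomial"
    "HOL-Library.Disjoint_Sets"
    "HOL-Library.Monad_Syntax"
begin

section \<open>Spaces with functions and varieties over the complex numbers\<close>

text \<open>
  Varieties are treated in the classical language of spaces with functions: a topological
  space together with, for every open set \<open>U\<close>, the algebra of regular functions on \<open>U\<close>.
  A regular function is a total function of which only the values on \<open>U\<close> matter, and
  \<open>reg X U\<close> is meaningful only for open \<open>U\<close>.
\<close>

record 'a fspace =
  ztop :: "'a topology"
  reg :: "'a set \<Rightarrow> ('a \<Rightarrow> complex) set"

abbreviation pts :: "'a fspace \<Rightarrow> 'a set"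
  where "pts X \<equiv> topspace (ztop X)"

definition space_with_functions :: "'a fspace \<Rightarrow> bool" where
  "space_with_functions X \<longleftrightarrow>
     (\<forall>U f g. openin (ztop X) U \<and> f \<in> reg X U \<and> (\<forall>x\<in>U. f x = g x) \<longrightarrow> g \<in> reg X U) \<and>
     (\<forall>U c. openin (ztop X) U \<longrightarrow> (\<lambda>_. c) \<in> reg X U) \<and>
     (\<forall>U f g. openin (ztop X) U \<and> f \<in> reg X U \<and> g \<in> reg X U \<longrightarrow>
        (\<lambda>x. f x + g x) \<in> reg X U \<and> (\<lambda>x. f x * g x) \<in> reg X U) \<and>
     (\<forall>U V f. openin (ztop X) U \<and> openin (ztop X) V \<and> V \<subseteq> U \<and> f \<in> reg X U \<longrightarrow> f \<in> reg X V) \<and>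
     (\<forall>\<U> f. (\<forall>U\<in>\<U>. openin (ztop X) U \<and> f \<in> reg X U) \<longrightarrow> f \<in> reg X (\<Union>\<U>)) \<and>
     (\<forall>U f. openin (ztop X) U \<and> f \<in> reg X U \<longrightarrow>
        openin (ztop X) {x\<in>U. f x \<noteq> 0} \<and> (\<lambda>x. 1 / f x) \<in> reg X {x\<in>U. f x \<noteq> 0})"

definition morphism :: "'a fspace \<Rightarrow> 'b fspace \<Rightarrow> ('a \<Rightarrow> 'b) \<Rightarrow> bool" where
  "morphism X Y \<phi> \<longleftrightarrow>
     \<phi> ` pts X \<subseteq> pts Y \<and>
     (\<forall>V. openin (ztop Y) V \<longrightarrow>
        openin (ztop X) {x \<in> pts X. \<phi> x \<in> V} \<and>
        (\<forall>g\<in>reg Y V. g \<circ> \<phi> \<in> reg X {x \<in> pts X. \<phi> x \<in> V}))"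

definition fs_isomorphism :: "'a fspace \<Rightarrow> 'b fspace \<Rightarrow> ('a \<Rightarrow> 'b) \<Rightarrow> bool" where
  "fs_isomorphism X Y \<phi> \<longleftrightarrow>
     morphism X Y \<phi> \<and>
     (\<exists>\<psi>. morphism Y X \<psi> \<and> (\<forall>x\<in>pts X. \<psi> (\<phi> x) = x) \<and> (\<forall>y\<in>pts Y. \<phi> (\<psi> y) = y))"

text \<open>
  The induced structure on a subset (used for open and for closed subsets): regular functions
  are those that locally extend to regular functions of the ambient space.
\<close>

definition sub_fspace :: "'a fspace \<Rightarrow> 'a set \<Rightarrow> 'a fspace" where
  "sub_fspace X S =
     \<lparr> ztop = subtopology (ztop X) S,
       reg = (\<lambda>V. {f. \<forall>x\<in>V. \<exists>U g. openin (ztop X) U \<and> x \<in> U \<and> g \<in> reg X U \<and>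
                             (\<forall>y\<in>U \<inter> V. f y = g y)}) \<rparr>"

text \<open>
  Affine \<open>m\<close>-space is the set of sequences vanishing from index \<open>m\<close> on; its coordinate ring is
  generated by the first \<open>m\<close> coordinates.
\<close>

inductive_set polyfuns :: "nat \<Rightarrow> ((nat \<Rightarrow> complex) \<Rightarrow> complex) set" for m :: nat where
  const: "(\<lambda>_. c) \<in> polyfuns m"
| coord: "i < m \<Longrightarrow> (\<lambda>z. z i) \<in> polyfuns m"
| add: "p \<in> polyfuns m \<Longrightarrow> q \<in> polyfuns m \<Longrightarrow> (\<lambda>z. p z + q z) \<in> polyfuns m"
| mult: "p \<in> polyfuns m \<Longrightarrow> q \<in> polyfuns m \<Longrightarrow> (\<lambda>z. p z * q z) \<in> polyfuns m"

definition affine_algebraic_set :: "nat \<Rightarrow> (nat \<Rightarrow> complex) set \<Rightarrow> bool" where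
  "affine_algebraic_set m Z \<longleftrightarrow>
     (\<exists>S\<subseteq>polyfuns m. Z = {z. (\<forall>i\<ge>m. z i = 0) \<and> (\<forall>p\<in>S. p z = 0)})"

text \<open>
  The Zariski topology has the principal open sets as a basis, and regular functions are locally
  quotients of polynomials. The neighbourhood on which \<open>f = p / q\<close> may be taken to be the locus
  \<open>q \<noteq> 0\<close>, by multiplying \<open>p\<close> and \<open>q\<close> with a common polynomial. The same remark applies to
  the definitions of the punctured line and of the product below.
\<close>

definition affine_fspace :: "nat \<Rightarrow> (nat \<Rightarrow> complex) set \<Rightarrow> (nat \<Rightarrow> complex) fspace" where
  "affine_fspace m Z =
     \<lparr> ztop = topology_generated_by {{z\<in>Z. p z \<noteq> 0} | p. p \<in> polyfuns m},
       reg = (\<lambda>V. {f. \<forall>z\<in>V. \<exists>p\<in>polyfuns m. \<exists>q\<in>polyfuns m. q z \<noteq> 0 \<and>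
                             (\<forall>w\<in>V. q w \<noteq> 0 \<longrightarrow> f w = p w / q w)}) \<rparr>"

definition affine_variety :: "'a fspace \<Rightarrow> bool" where
  "affine_variety X \<longleftrightarrow>
     (\<exists>m Z \<phi>. affine_algebraic_set m Z \<and> fs_isomorphism X (affine_fspace m Z) \<phi>)"

text \<open>
  The product of spaces with functions, built from the functions \<open>\<Sum>i. f\<^sub>i(x) g\<^sub>i(y)\<close> on boxes
  \<open>U \<times> V\<close>. For varieties this is the product variety (it is finer than the product topology).
\<close>

definition tensor_funs :: "'a fspace \<Rightarrow> 'b fspace \<Rightarrow> 'a set \<Rightarrow> 'b set \<Rightarrow> ('a \<times> 'b \<Rightarrow> complex) set" where
  "tensor_funs X Y U V =
     {\<lambda>(x, y). \<Sum>i<m. f i x * g i y | (m :: nat) f g.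
        (\<forall>i<m. f i \<in> reg X U \<and> g i \<in> reg Y V)}"

definition prod_fspace :: "'a fspace \<Rightarrow> 'b fspace \<Rightarrow> ('a \<times> 'b) fspace" where
  "prod_fspace X Y =
     \<lparr> ztop = topology_generated_by
         {{z \<in> U \<times> V. h z \<noteq> 0} | U V h.
            openin (ztop X) U \<and> openin (ztop Y) V \<and> h \<in> tensor_funs X Y U V},
       reg = (\<lambda>W. {f. \<forall>z\<in>W. \<exists>U V. \<exists>h\<in>tensor_funs X Y U V. \<exists>k\<in>tensor_funs X Y U V.
                openin (ztop X) U \<and> openin (ztop Y) V \<and> z \<in> U \<times> V \<and> k z \<noteq> 0 \<and>
                (\<forall>w \<in> W \<inter> U \<times> V. k w \<noteq> 0 \<longrightarrow> f w = h w / k w)}) \<rparr>"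

definition variety :: "'a fspace \<Rightarrow> bool" where
  "variety X \<longleftrightarrow>
     space_with_functions X \<and>
     (\<exists>\<U>. finite \<U> \<and> \<Union>\<U> = pts X \<and>
        (\<forall>U\<in>\<U>. openin (ztop X) U \<and> affine_variety (sub_fspace X U))) \<and>
     closedin (ztop (prod_fspace X X)) {(x, x) | x. x \<in> pts X}"

text \<open>The punctured affine line \<open>\<complex>\<^sup>\<times>\<close>.\<close>

definition Gm :: "complex fspace" where
  "Gm =
     \<lparr> ztop = topology_generated_by {{z. z \<noteq> 0 \<and> poly p z \<noteq> 0} | p. True},
       reg = (\<lambda>V. {f. \<forall>z\<in>V. \<exists>p q. poly q z \<noteq> 0 \<and>
                             (\<forall>w\<in>V. poly q w \<noteq> 0 \<longrightarrow> f w = poly p w / poly q w)}) \<rparr>"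


section \<open>Ind-varieties\<close>

text \<open>
  An ind-variety is given by its filtration; its points are the union of the filtration, and a
  set is open iff its trace on every member of the filtration is open.
\<close>

type_synonym 'a indspace = "nat \<Rightarrow> 'a fspace"

definition closed_embedded :: "'a fspace \<Rightarrow> 'a fspace \<Rightarrow> bool" where
  "closed_embedded X Y \<longleftrightarrow>
     closedin (ztop Y) (pts X) \<and>
     ztop X = ztop (sub_fspace Y (pts X)) \<and>
     (\<forall>U. openin (ztop X) U \<longrightarrow> reg X U = reg (sub_fspace Y (pts X)) U)"

definition ind_variety :: "'a indspace \<Rightarrow> bool" where
  "ind_variety X \<longleftrightarrow> (\<forall>n. variety (X n) \<and> closed_embedded (X n) (X (Suc n)))"

definition ipts :: "'a indspace \<Rightarrow> 'a set" where
  "ipts X = (\<Union>n. pts (X n))"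

definition itop :: "'a indspace \<Rightarrow> 'a topology" where
  "itop X = topology (\<lambda>U. U \<subseteq> ipts X \<and> (\<forall>n. openin (ztop (X n)) (U \<inter> pts (X n))))"

lemma openin_itop:
  "openin (itop X) U \<longleftrightarrow> U \<subseteq> ipts X \<and> (\<forall>n. openin (ztop (X n)) (U \<inter> pts (X n)))"
proof -
  let ?P = "\<lambda>U. U \<subseteq> ipts X \<and> (\<forall>n. openin (ztop (X n)) (U \<inter> pts (X n)))"
  have "?P (S \<inter> T)" if S: "?P S" and T: "?P T" for S T
  proof (intro conjI allI)
    show "S \<inter> T \<subseteq> ipts X"
      using S by (simp add: le_infI1)
    fix n
    have "openin (ztop (X n)) ((S \<inter> pts (X n)) \<inter> (T \<inter> pts (X n)))"
      by (rule openin_Int) (use S T in simp_all)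
    moreover have "(S \<inter> pts (X n)) \<inter> (T \<inter> pts (X n)) = S \<inter> T \<inter> pts (X n)"
      by (simp add: Int_ac)
    ultimately show "openin (ztop (X n)) (S \<inter> T \<inter> pts (X n))"
      by (simp only:)
  qed
  moreover have "?P (\<Union>\<K>)" if K: "\<forall>K\<in>\<K>. ?P K" for \<K>
  proof (intro conjI allI)
    show "\<Union>\<K> \<subseteq> ipts X"
      by (rule Union_least) (use K in simp)
    fix n
    have "openin (ztop (X n)) (\<Union>((\<lambda>K. K \<inter> pts (X n)) ` \<K>))"
      by (rule openin_Union) (use K in auto)
    moreover have "\<Union>((\<lambda>K. K \<inter> pts (X n)) ` \<K>) = \<Union>\<K> \<inter> pts (X n)"
      by (simp only: Int_Union2)
    ultimately show "openin (ztop (X n)) (\<Union>\<K> \<inter> pts (X n))"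
      by (simp only:)
  qed
  ultimately have "istopology ?P"
    unfolding istopology_def by simp
  then show ?thesis
    by (simp only: itop_def topology_inverse')
qed

definition iprod :: "'a indspace \<Rightarrow> 'b indspace \<Rightarrow> ('a \<times> 'b) indspace" (infixr "\<times>\<^sub>I" 80) where
  "X \<times>\<^sub>I Y = (\<lambda>n. prod_fspace (X n) (Y n))"

definition Gm_ind :: "complex indspace" ("\<G>") where
  "\<G> = (\<lambda>_. Gm)"

definition dense_open :: "'a topology \<Rightarrow> 'a set \<Rightarrow> bool" where
  "dense_open T U \<longleftrightarrow> openin T U \<and> T closure_of U = topspace T"

definition irreducible_subset :: "'a topology \<Rightarrow> 'a set \<Rightarrow> bool" where
  "irreducible_subset T S \<longleftrightarrow>
     S \<subseteq> topspace T \<and> S \<noteq> {} \<and>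
     (\<forall>U V. openin T U \<and> openin T V \<and> U \<inter> S \<noteq> {} \<and> V \<inter> S \<noteq> {} \<longrightarrow> U \<inter> V \<inter> S \<noteq> {})"

definition irreducible_component :: "'a topology \<Rightarrow> 'a set \<Rightarrow> bool" where
  "irreducible_component T Z \<longleftrightarrow>
     irreducible_subset T Z \<and> (\<forall>S. irreducible_subset T S \<and> Z \<subseteq> S \<longrightarrow> S = Z)"


section \<open>Rational functions and rational maps\<close>

text \<open>
  A rational function or map is represented by a partial function with dense open domain on which
  it is regular, respectively a morphism. Equality of rational functions or maps is
  \<open>f \<approx>\<^bsub>X\<^esub> g\<close>: both sides are defined and agree on a common dense open subset of \<open>X\<close>.
\<close>

definition rational_function :: "'a indspace \<Rightarrow> ('a \<rightharpoonup> complex) \<Rightarrow> bool" where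
  "rational_function X f \<longleftrightarrow>
     dense_open (itop X) (dom f) \<and>
     (\<forall>n. (\<lambda>x. the (f x)) \<in> reg (X n) (dom f \<inter> pts (X n)))"

definition rational_map :: "'a indspace \<Rightarrow> 'b indspace \<Rightarrow> ('a \<rightharpoonup> 'b) \<Rightarrow> bool" where
  "rational_map X Y f \<longleftrightarrow>
     dense_open (itop X) (dom f) \<and>
     (\<forall>n. \<exists>m. morphism (sub_fspace (X n) (dom f \<inter> pts (X n))) (Y m) (\<lambda>x. the (f x)))"

definition rat_eq :: "('a \<rightharpoonup> 'b) \<Rightarrow> 'a indspace \<Rightarrow> ('a \<rightharpoonup> 'b) \<Rightarrow> bool"
    ("(_ \<approx>\<^bsub>_\<^esub>/ _)" [51, 0, 51] 50) where
  "f \<approx>\<^bsub>X\<^esub> g \<longleftrightarrow> (\<exists>W. dense_open (itop X) W \<and> W \<subseteq> dom f \<inter> dom g \<and> (\<forall>x\<in>W. f x = g x))"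

text \<open>
  The extension of a rational map to its domain of definition, i.e. to the union of the domains
  of all of its representatives (on which these agree, ind-varieties being separated).
\<close>

definition max_ext :: "'a indspace \<Rightarrow> 'b indspace \<Rightarrow> ('a \<rightharpoonup> 'b) \<Rightarrow> ('a \<rightharpoonup> 'b)" where
  "max_ext X Y f z =
     (if \<exists>g. rational_map X Y g \<and> g \<approx>\<^bsub>X\<^esub> f \<and> z \<in> dom g
      then (SOME g. rational_map X Y g \<and> g \<approx>\<^bsub>X\<^esub> f \<and> z \<in> dom g) z
      else None)"

definition nonzero_on_components :: "'a indspace \<Rightarrow> ('a \<rightharpoonup> complex) \<Rightarrow> bool" where
  "nonzero_on_components X f \<longleftrightarrow>
     (\<forall>Z. irreducible_component (itop X) Z \<longrightarrow>
        (\<exists>g x. rational_function X g \<and> g \<approx>\<^bsub>X\<^esub> f \<and> x \<in> Z \<inter> dom g \<and> g x \<noteq> Some 0))"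

text \<open>Arithmetic of partial functions; a quotient is undefined where its denominator vanishes.\<close>

definition pdiv :: "complex \<Rightarrow> complex \<Rightarrow> complex option" where
  "pdiv a b = (if b = 0 then None else Some (a / b))"

definition radd :: "('a \<rightharpoonup> complex) \<Rightarrow> ('a \<rightharpoonup> complex) \<Rightarrow> ('a \<rightharpoonup> complex)" (infixl "+\<^sub>r" 65) where
  "f +\<^sub>r g = (\<lambda>x. do { a \<leftarrow> f x; b \<leftarrow> g x; Some (a + b) })"

definition rmul :: "('a \<rightharpoonup> complex) \<Rightarrow> ('a \<rightharpoonup> complex) \<Rightarrow> ('a \<rightharpoonup> complex)" (infixl "*\<^sub>r" 70) where
  "f *\<^sub>r g = (\<lambda>x. do { a \<leftarrow> f x; b \<leftarrow> g x; Some (a * b) })"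

definition rdiv :: "('a \<rightharpoonup> complex) \<Rightarrow> ('a \<rightharpoonup> complex) \<Rightarrow> ('a \<rightharpoonup> complex)" (infixl "'/\<^sub>r" 70) where
  "f /\<^sub>r g = (\<lambda>x. do { a \<leftarrow> f x; b \<leftarrow> g x; pdiv a b })"

definition rsum :: "('k \<Rightarrow> 'a \<rightharpoonup> complex) \<Rightarrow> 'k set \<Rightarrow> ('a \<rightharpoonup> complex)" where
  "rsum F K = (\<lambda>x. if \<forall>k\<in>K. x \<in> dom (F k) then Some (\<Sum>k\<in>K. the (F k x)) else None)"

definition rprod :: "('k \<Rightarrow> 'a \<rightharpoonup> complex) \<Rightarrow> 'k set \<Rightarrow> ('a \<rightharpoonup> complex)" where
  "rprod F K = (\<lambda>x. if \<forall>k\<in>K. x \<in> dom (F k) then Some (\<Prod>k\<in>K. the (F k x)) else None)"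


section \<open>Geometric crystals of type A\<close>

definition cartan :: "nat \<Rightarrow> nat \<Rightarrow> int" where
  "cartan i j = (if i = j then 2 else if i = Suc j \<or> j = Suc i then -1 else 0)"

record 'a crystal =
  space_of :: "'a indspace"
  act :: "nat \<Rightarrow> complex \<times> 'a \<rightharpoonup> 'a"
  gam :: "nat \<Rightarrow> 'a \<rightharpoonup> complex"
  eps :: "nat \<Rightarrow> 'a \<rightharpoonup> complex"

definition rational_action :: "'a indspace \<Rightarrow> (complex \<times> 'a \<rightharpoonup> 'a) \<Rightarrow> bool" where
  "rational_action X e \<longleftrightarrow>
     rational_map (\<G> \<times>\<^sub>I X) X e \<and>
     (\<lambda>x. max_ext (\<G> \<times>\<^sub>I X) X e (1, x)) \<approx>\<^bsub>X\<^esub> Some \<and>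
     (\<lambda>(c, d, x). do { y \<leftarrow> e (d, x); e (c, y) }) \<approx>\<^bsub>\<G> \<times>\<^sub>I \<G> \<times>\<^sub>I X\<^esub> (\<lambda>(c, d, x). e (c * d, x))"

definition geometric_crystal :: "nat \<Rightarrow> 'a crystal \<Rightarrow> bool" where
  "geometric_crystal n C \<longleftrightarrow>
     (let X = space_of C; e = act C; I = {1..n} in
        ind_variety X \<and>
        (\<forall>i\<in>I. rational_function X (gam C i) \<and> rational_function X (eps C i) \<and>
           rational_action X (e i)) \<and>
        (\<forall>i\<in>I. dense_open (subtopology (itop (\<G> \<times>\<^sub>I X)) ({1} \<times> ipts X))
           (({1} \<times> ipts X) \<inter> dom (max_ext (\<G> \<times>\<^sub>I X) X (e i)))) \<and>
        (\<forall>i\<in>I. \<forall>j\<in>I. gam C j \<circ>\<^sub>m e i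
           \<approx>\<^bsub>\<G> \<times>\<^sub>I X\<^esub> (\<lambda>(c, x). do { v \<leftarrow> gam C j x; Some (c powi cartan i j * v) })) \<and>
        (\<forall>i\<in>I. \<forall>j\<in>I. cartan i j = 0 \<longrightarrow>
           (\<lambda>(c\<^sub>1, c\<^sub>2, x). do { y \<leftarrow> e j (c\<^sub>2, x); e i (c\<^sub>1, y) })
           \<approx>\<^bsub>\<G> \<times>\<^sub>I \<G> \<times>\<^sub>I X\<^esub> (\<lambda>(c\<^sub>1, c\<^sub>2, x). do { y \<leftarrow> e i (c\<^sub>1, x); e j (c\<^sub>2, y) })) \<and>
        (\<forall>i\<in>I. \<forall>j\<in>I. cartan i j = -1 \<longrightarrow>
           (\<lambda>(c\<^sub>1, c\<^sub>2, x). do { y \<leftarrow> e i (c\<^sub>2, x); z \<leftarrow> e j (c\<^sub>1 * c\<^sub>2, y); e i (c\<^sub>1, z) })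
           \<approx>\<^bsub>\<G> \<times>\<^sub>I \<G> \<times>\<^sub>I X\<^esub>
           (\<lambda>(c\<^sub>1, c\<^sub>2, x). do { y \<leftarrow> e j (c\<^sub>1, x); z \<leftarrow> e i (c\<^sub>1 * c\<^sub>2, y); e j (c\<^sub>2, z) })) \<and>
        (\<forall>i\<in>I. eps C i \<circ>\<^sub>m e i
           \<approx>\<^bsub>\<G> \<times>\<^sub>I X\<^esub> (\<lambda>(c, x). do { v \<leftarrow> eps C i x; Some (inverse c * v) })) \<and>
        (\<forall>i\<in>I. \<forall>j\<in>I. cartan i j = 0 \<longrightarrow>
           eps C i \<circ>\<^sub>m e j \<approx>\<^bsub>\<G> \<times>\<^sub>I X\<^esub> (\<lambda>(c, x). eps C i x)))"


section \<open>Epsilon systems\<close>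

record 'a eps_system =
  epsJ :: "nat set \<Rightarrow> 'a \<rightharpoonup> complex"
  epsJ_star :: "nat set \<Rightarrow> 'a \<rightharpoonup> complex"

definition intervals :: "nat \<Rightarrow> nat set set" where
  "intervals n = {{s..t} | s t. 1 \<le> s \<and> s \<le> t \<and> t \<le> n}"

text \<open>
  Disjoint intervals of integers are linearly ordered, so that a partition of an interval into
  intervals is just a set-theoretic partition all of whose blocks are intervals.
\<close>

definition interval_partitions :: "nat set \<Rightarrow> nat set set set" where
  "interval_partitions J = {P. partition_on J P \<and> (\<forall>K\<in>P. \<exists>s t. s \<le> t \<and> K = {s..t})}"

definition is_eps_system :: "nat \<Rightarrow> 'a crystal \<Rightarrow> 'a eps_system \<Rightarrow> bool" where
  "is_eps_system n C E \<longleftrightarrow>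
     (let X = space_of C; e = act C; I = {1..n} in
        (\<forall>J\<in>intervals n. rational_function X (epsJ E J) \<and> rational_function X (epsJ_star E J)) \<and>
        (\<forall>i\<in>I. epsJ E {i} \<approx>\<^bsub>X\<^esub> eps C i) \<and>
        (\<forall>s t. 1 \<le> s \<and> s \<le> t \<and> t \<le> n \<longrightarrow> (let J = {s..t} in
           (\<forall>i\<in>I.
              (i = s \<longrightarrow> epsJ E J \<circ>\<^sub>m e i
                 \<approx>\<^bsub>\<G> \<times>\<^sub>I X\<^esub> (\<lambda>(c, x). do { v \<leftarrow> epsJ E J x; Some (inverse c * v) })) \<and>
              (i + 1 \<noteq> s \<and> i \<noteq> s \<and> i \<noteq> t + 1 \<longrightarrow>
                 epsJ E J \<circ>\<^sub>m e i \<approx>\<^bsub>\<G> \<times>\<^sub>I X\<^esub> (\<lambda>(c, x). epsJ E J x)) \<and>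
              (i = t \<longrightarrow> epsJ_star E J \<circ>\<^sub>m e i
                 \<approx>\<^bsub>\<G> \<times>\<^sub>I X\<^esub> (\<lambda>(c, x). do { v \<leftarrow> epsJ_star E J x; Some (inverse c * v) })) \<and>
              (i + 1 \<noteq> s \<and> i \<noteq> t \<and> i \<noteq> t + 1 \<longrightarrow>
                 epsJ_star E J \<circ>\<^sub>m e i \<approx>\<^bsub>\<G> \<times>\<^sub>I X\<^esub> (\<lambda>(c, x). epsJ_star E J x))) \<and>
           epsJ_star E J
             \<approx>\<^bsub>X\<^esub> rsum (\<lambda>P. (\<lambda>_. Some ((-1) ^ (card J - card P))) *\<^sub>r rprod (epsJ E) P)
                      (interval_partitions J))))"

definition eps_geometric_crystal :: "nat \<Rightarrow> 'a crystal \<Rightarrow> 'a eps_system \<Rightarrow> bool" where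
  "eps_geometric_crystal n C E \<longleftrightarrow> geometric_crystal n C \<and> is_eps_system n C E"


section \<open>Products\<close>

definition prod_crystal :: "'a crystal \<Rightarrow> 'b crystal \<Rightarrow> ('a \<times> 'b) crystal" where
  "prod_crystal A B =
     \<lparr> space_of = space_of A \<times>\<^sub>I space_of B,
       act = (\<lambda>i (c, x, y). do {
                g \<leftarrow> gam A i x; a \<leftarrow> eps A i x; b \<leftarrow> eps B i y;
                c\<^sub>1 \<leftarrow> pdiv (c * g * a + b) (g * a + b);
                c\<^sub>2 \<leftarrow> pdiv c c\<^sub>1;
                x' \<leftarrow> act A i (c\<^sub>1, x);
                y' \<leftarrow> act B i (c\<^sub>2, y);
                Some (x', y') }),
       gam = (\<lambda>i. (gam A i \<circ> fst) *\<^sub>r (gam B i \<circ> snd)),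
       eps = (\<lambda>i. (eps A i \<circ> fst) +\<^sub>r (eps B i \<circ> snd) /\<^sub>r (gam A i \<circ> fst)) \<rparr>"

text \<open>The convention that the functions attached to the empty interval are 1.\<close>

definition with_empty :: "(nat set \<Rightarrow> 'a \<rightharpoonup> complex) \<Rightarrow> (nat set \<Rightarrow> 'a \<rightharpoonup> complex)" where
  "with_empty F J = (if J = {} then (\<lambda>_. Some 1) else F J)"

text \<open>
  The formulas for \<open>J = {s..t}\<close>, where \<open>s = Min J\<close> and \<open>t = Max J\<close>. As \<open>1 \<le> s\<close> for every \<open>J\<close> of
  interest, the truncated subtraction \<open>s - 1\<close> is the true one.
\<close>

definition prod_eps_system ::
    "'a crystal \<Rightarrow> 'a eps_system \<Rightarrow> 'b eps_system \<Rightarrow> ('a \<times> 'b) eps_system" where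
  "prod_eps_system A EA EB =
     \<lparr> epsJ = (\<lambda>J. let s = Min J; t = Max J in
         rsum (\<lambda>k. (with_empty (epsJ EB) {s..k} \<circ> snd) *\<^sub>r (with_empty (epsJ EA) {k+1..t} \<circ> fst)
                     /\<^sub>r rprod (\<lambda>j. gam A j \<circ> fst) {s..k}) {s-1..t}),
       epsJ_star = (\<lambda>J. let s = Min J; t = Max J in
         rsum (\<lambda>k. (with_empty (epsJ_star EA) {s..k} \<circ> fst) *\<^sub>r (with_empty (epsJ_star EB) {k+1..t} \<circ> snd)
                     /\<^sub>r rprod (\<lambda>j. gam A j \<circ> fst) {k+1..t}) {s-1..t}) \<rparr>"

end

theory Submission
  imports Defs
begin

text \<open>
  At a point of a crystal, write the values of an epsilon system as an upper unitriangular matrix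
  \<open>M\<close> with entries \<open>M a b = \<epsilon>\<^sub>J\<close> for \<open>J = [a, b - 1]\<close>, and let \<open>N\<close> be the matrix formed in the
  same way from the \<open>\<epsilon>\<^sup>*\<^sub>J\<close>. The alternating sum over partitions in the definition of an epsilon
  system says that \<open>N\<close>, with signs \<open>(-1)\<^sup>a\<^sup>+\<^sup>b\<close>, is the inverse of \<open>M\<close>
  (\<open>signed_inverse_iff_partition_sum\<close>). The transformation axioms say nothing about row \<open>i + 1\<close> and
  column \<open>i\<close> under \<open>e\<^sub>i\<close>, but \<open>M N = 1\<close> and \<open>N M = 1\<close> before and after the action determine these
  entries (locale \<open>eps_change\<close>). The outcome is that \<open>M\<close> becomes \<open>L M R\<close>, where \<open>L\<close> and \<open>R\<close> differ from
  the identity in rows and columns \<open>i\<close>, \<open>i + 1\<close> only.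

  Let \<open>D\<close> be a diagonal matrix with \<open>d\<^sub>j\<^sub>+\<^sub>1 / d\<^sub>j = \<gamma>\<^sub>j\<close> on the first factor. The formulas of the
  theorem define \<open>D M\<^sub>Y D\<^sup>-\<^sup>1 M\<^sub>X\<close> and \<open>N\<^sub>X D N\<^sub>Y D\<^sup>-\<^sup>1\<close>, which are again inverse to each other
  (\<open>signed_inverse_product\<close>). Under \<open>e\<^sub>i\<close> the factors \<open>R\<close> of \<open>M\<^sub>Y\<close> and \<open>L\<close> of \<open>M\<^sub>X\<close> meet the transformed
  \<open>D\<^sup>-\<^sup>1\<close>, and the three of them multiply to the old \<open>D\<^sup>-\<^sup>1\<close> exactly because of the choice of \<open>c\<^sub>1\<close> and
  \<open>c\<^sub>2\<close> (\<open>two_terms\<close>). Only the outer factors remain, and these act as the axioms demand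
  (\<open>prod_eps_matrix_change\<close>, \<open>prod_star_matrix_change\<close>).

  It remains to pass from generic points to identities of rational maps. Actions are dominant
  (\<open>action_preimage_dense_open\<close>), so that a generic point is moved to a generic point. For
  generic \<open>(x, y)\<close> the parameters \<open>c\<^sub>1\<close> and \<open>c\<^sub>2\<close> are injective functions of \<open>c\<close>, and so the computation
  applies to all but finitely many \<open>c\<close> (\<open>generic_pair_transforms\<close>). The triples \<open>(c, x, y)\<close> found in
  this way form a dense set that is not obviously open. But both sides of each identity are
  regular on dense open sets, and the locus where they differ is open; missing a dense set, it is
  empty (\<open>action_rat_eq\<close>).
\<close>

section \<open>Alternating sums over interval partitions\<close>

definition signed_partition_sum :: "(nat set \<Rightarrow> complex) \<Rightarrow> nat set \<Rightarrow> complex" where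
  "signed_partition_sum w J =
     (\<Sum>P\<in>interval_partitions J. (-1) ^ (card J - card P) * (\<Prod>K\<in>P. w K))"

text \<open>
  Makes the truncated subtraction in the sign \<open>(-1) ^ (card J - card P)\<close> a true one.
\<close>

lemma card_partition_le:
  assumes "finite A" "partition_on A P"
  shows "card P \<le> card A"
proof -
  have fin: "finite P" using finite_elements assms by blast
  have "card p \<ge> 1" if "p \<in> P" for p
  proof -
    have "finite p" "p \<noteq> {}"
      using that assms partition_onD1[OF assms(2)] partition_onD3[OF assms(2)]
      by (auto intro: finite_subset)
    then show ?thesis by (simp add: Suc_le_eq card_gt_0_iff)
  qed
  then have "(\<Sum>p\<in>P. 1) \<le> (\<Sum>p\<in>P. card p)"
    by (intro sum_mono) auto
  also have "\<dots> = card A"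
    using product_partition[OF assms(2)] assms
    by (metis (no_types, lifting) Union_upper finite_subset partition_onD1)
  finally show ?thesis by simp
qed

lemma finite_interval_partitions: "finite J \<Longrightarrow> finite (interval_partitions J)"
  unfolding interval_partitions_def
  by (rule finite_subset[OF _ finitely_many_partition_on]) auto

lemma interval_partitions_empty: "interval_partitions {} = {{}}"
  by (auto simp: interval_partitions_def partition_on_empty)

text \<open>
  The block that contains the smallest point is an initial segment \<open>{s..<k}\<close>; what remains is an
  arbitrary partition of \<open>{k..<b}\<close>. This is the recursion behind the alternating sum.
\<close>

lemma interval_partitions_first_block:
  assumes "s < b"
  shows "interval_partitions {s..<b} =
           (\<Union>k\<in>{Suc s..b}. insert {s..<k} ` interval_partitions {k..<b})"
proof (intro equalityI subsetI)
  fix P assume P: "P \<in> interval_partitions {s..<b}"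
  then have part: "partition_on {s..<b} P" and ints: "\<forall>K\<in>P. \<exists>s t. s \<le> t \<and> K = {s..t}"
    by (auto simp: interval_partitions_def)
  have U: "\<Union>P = {s..<b}" using partition_onD1[OF part] by simp
  have "s \<in> \<Union>P" using U assms by auto
  then obtain K where K: "K \<in> P" "s \<in> K" by blast
  then obtain u t where ut: "u \<le> t" "K = {u..t}" using ints by blast
  have "K \<subseteq> {s..<b}" using K U by blast
  moreover have "u \<in> K" "t \<in> K" "u \<le> s" using ut K by auto
  ultimately have "u \<in> {s..<b}" "t \<in> {s..<b}" "u \<le> s" by blast+
  then have us: "u = s" and tb: "t < b" by auto
  let ?k = "Suc t"
  have Kk: "K = {s..<?k}" using ut us by auto
  have dis: "disjnt K (\<Union>(P - {K}))"
    using partition_onD2[OF part] K(1) by (auto simp: disjoint_def disjnt_def)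
  have "partition_on {s..<b} (insert K (P - {K}))"
    using part K(1) by (simp add: insert_absorb)
  then have "partition_on ({s..<b} - K) (P - {K})"
    using partition_on_insert[OF dis] by blast
  moreover have "{s..<b} - K = {?k..<b}" using Kk ut us by auto
  ultimately have "P - {K} \<in> interval_partitions {?k..<b}"
    using ints by (auto simp: interval_partitions_def)
  moreover have "P = insert {s..<?k} (P - {K})" using K(1) Kk by blast
  moreover have "?k \<in> {Suc s..b}" using ut us tb by auto
  ultimately show "P \<in> (\<Union>k\<in>{Suc s..b}. insert {s..<k} ` interval_partitions {k..<b})"
    by blast
next
  fix P assume "P \<in> (\<Union>k\<in>{Suc s..b}. insert {s..<k} ` interval_partitions {k..<b})"
  then obtain k R where k: "k \<in> {Suc s..b}" and R: "R \<in> interval_partitions {k..<b}"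
    and P: "P = insert {s..<k} R" by blast
  have part: "partition_on {k..<b} R" using R by (simp add: interval_partitions_def)
  have dis: "disjnt {s..<k} (\<Union>R)"
    unfolding partition_onD1[OF part, symmetric] by (auto simp: disjnt_def)
  have "{s..<b} - {s..<k} = {k..<b}" using k by auto
  then have "partition_on {s..<b} P"
    using partition_on_insert[OF dis, of "{s..<b}"] part k P by auto
  moreover have "{s..<k} = {s..k-1}" "s \<le> k - 1" using k by auto
  ultimately show "P \<in> interval_partitions {s..<b}"
    using R P unfolding interval_partitions_def by blast
qed

lemma signed_partition_sum_first_block:
  assumes "s < b"
  shows "signed_partition_sum w {s..<b} =
           (\<Sum>k\<in>{Suc s..b}. (-1) ^ (k - Suc s) * w {s..<k} * signed_partition_sum w {k..<b})"
proof -
  let ?f = "\<lambda>P. (-1) ^ (card {s..<b} - card P) * (\<Prod>K\<in>P. w K)"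
  have notin: "{s..<k} \<notin> R" if "k \<in> {Suc s..b}" "R \<in> interval_partitions {k..<b}" for k R
  proof
    assume "{s..<k} \<in> R"
    then have "{s..<k} \<subseteq> {k..<b}"
      using that partition_onD1[of "{k..<b}" R] by (auto simp: interval_partitions_def)
    then show False using that by auto
  qed
  have "signed_partition_sum w {s..<b} =
      (\<Sum>k\<in>{Suc s..b}. \<Sum>P\<in>insert {s..<k} ` interval_partitions {k..<b}. ?f P)"
    unfolding signed_partition_sum_def interval_partitions_first_block[OF assms]
  proof (rule sum.UNION_disjoint)
    show "\<forall>k\<in>{Suc s..b}. \<forall>l\<in>{Suc s..b}. k \<noteq> l \<longrightarrow>
        insert {s..<k} ` interval_partitions {k..<b} \<inter> insert {s..<l} ` interval_partitions {l..<b} = {}"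
    proof (intro ballI impI)
      fix k l assume kl: "k \<in> {Suc s..b}" "l \<in> {Suc s..b}" "k \<noteq> l"
      have False if "insert {s..<k} R = insert {s..<l} T" "R \<in> interval_partitions {k..<b}"
        "T \<in> interval_partitions {l..<b}" for R T
      proof -
        have "{s..<k} \<noteq> {s..<l}" 
          using kl by (auto dest!: arg_cong[where f = card])
        then have "{s..<k} \<in> T" using that by blast
        moreover have "{l..<b} = \<Union>T"
          using that(3) by (intro partition_onD1) (simp add: interval_partitions_def)
        moreover have "s \<in> {s..<k}" using kl by simp
        ultimately have "s \<in> {l..<b}" by blast
        then show False using kl by auto
      qed
      then show "insert {s..<k} ` interval_partitions {k..<b} \<inter>
          insert {s..<l} ` interval_partitions {l..<b} = {}" by blast
    qed
  qed (auto intro: finite_interval_partitions)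
  also have "\<dots> = (\<Sum>k\<in>{Suc s..b}. (-1) ^ (k - Suc s) * w {s..<k} * signed_partition_sum w {k..<b})"
  proof (rule sum.cong[OF refl])
    fix k assume k: "k \<in> {Suc s..b}"
    have inj: "inj_on (insert {s..<k}) (interval_partitions {k..<b})"
      using insert_ident[OF notin[OF k] notin[OF k]] by (auto intro!: inj_onI)
    have "?f (insert {s..<k} R) = (-1) ^ (k - Suc s) * w {s..<k} *
        ((-1) ^ (card {k..<b} - card R) * (\<Prod>K\<in>R. w K))"
      if R: "R \<in> interval_partitions {k..<b}" for R
    proof -
      have part: "partition_on {k..<b} R" using R by (simp add: interval_partitions_def)
      have fin: "finite R" using finite_elements[OF _ part] by simp
      have "card R \<le> b - k" using card_partition_le[OF _ part] by simp
      then have "b - s - Suc (card R) = (k - Suc s) + (b - k - card R)" using k by auto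
      then show ?thesis using fin notin[OF k R] by (simp add: power_add)
    qed
    then show "(\<Sum>P\<in>insert {s..<k} ` interval_partitions {k..<b}. ?f P) =
        (-1) ^ (k - Suc s) * w {s..<k} * signed_partition_sum w {k..<b}"
      by (simp add: sum.reindex[OF inj] signed_partition_sum_def sum_distrib_left mult.assoc)
  qed
  finally show ?thesis .
qed

text \<open>
  The two matrices are upper unitriangular with indices in \<open>{lo..hi}\<close>, and the relation says that
  \<open>(-1)\<^sup>a\<^sup>+\<^sup>b N a b\<close> are the entries of the inverse of \<open>M\<close>. Only entries with \<open>a \<le> b\<close> are
  ever looked at, so that no convention for the lower triangle is imposed.
\<close>

definition signed_inverse :: "nat \<Rightarrow> nat \<Rightarrow> (nat \<Rightarrow> nat \<Rightarrow> complex) \<Rightarrow> (nat \<Rightarrow> nat \<Rightarrow> complex) \<Rightarrow> bool"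
  where "signed_inverse lo hi M N \<longleftrightarrow>
    (\<forall>a. M a a = 1 \<and> N a a = 1) \<and>
    (\<forall>a b. lo \<le> a \<and> a < b \<and> b \<le> hi \<longrightarrow> (\<Sum>k=a..b. (-1) ^ k * M a k * N k b) = 0)"

lemma minus_one_power_diff_sign:
  "s < k \<Longrightarrow> (-1::complex) ^ k = - ((-1) ^ s * (-1) ^ (k - Suc s))"
  by (metis add_Suc_shift le_add_diff_inverse Suc_leI mult_minus1 power_Suc power_add mult.commute add.commute add_Suc)

text \<open>
  Peeling off the first block turns the alternating sum over partitions into the recursion that
  expresses the inverse of a unitriangular matrix row by row. A unitriangular system has only
  one solution, whence the equivalence: the axiom on \<open>\<epsilon>\<^sup>*\<^sub>J\<close> says that the matrix of the
  \<open>\<epsilon>\<^sup>*\<^sub>J\<close> is, up to signs, inverse to the matrix of the \<open>\<epsilon>\<^sub>J\<close>.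
\<close>

lemma signed_inverse_iff_partition_sum:
  assumes diag: "\<And>a. M a a = 1" "\<And>a. N a a = 1"
    and w: "\<And>a b. lo \<le> a \<Longrightarrow> a < b \<Longrightarrow> b \<le> hi \<Longrightarrow> w {a..<b} = M a b"
  shows "signed_inverse lo hi M N \<longleftrightarrow>
     (\<forall>a b. lo \<le> a \<and> a < b \<and> b \<le> hi \<longrightarrow> N a b = signed_partition_sum w {a..<b})"
proof -
  let ?Q = "\<lambda>a b. signed_partition_sum w {a..<b}"
  have Qdiag: "?Q b b = 1" for b
    by (simp add: signed_partition_sum_def interval_partitions_empty)
  have sgn: "(\<Sum>k=a..b. (-1) ^ k * M a k * N k b) =
       (-1) ^ a * (N a b - (\<Sum>k\<in>{Suc a..b}. (-1) ^ (k - Suc a) * M a k * N k b))"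
    if "a < b" for a b
  proof -
    have "(\<Sum>k\<in>{Suc a..b}. (-1) ^ k * M a k * N k b) =
        - ((-1) ^ a * (\<Sum>k\<in>{Suc a..b}. (-1) ^ (k - Suc a) * M a k * N k b))"
      unfolding sum_distrib_left sum_negf[symmetric]
      by (intro sum.cong refl) (auto simp: minus_one_power_diff_sign Suc_le_eq)
    then show ?thesis
      using that by (simp add: sum.atLeast_Suc_atMost diag algebra_simps)
  qed
  have Qrec: "?Q a b = (\<Sum>k\<in>{Suc a..b}. (-1) ^ (k - Suc a) * M a k * ?Q k b)"
    if "lo \<le> a" "a < b" "b \<le> hi" for a b
    unfolding signed_partition_sum_first_block[OF that(2)]
    using that by (intro sum.cong refl) (auto simp: w)
  show ?thesis
  proof
    assume inv: "signed_inverse lo hi M N"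
    have "a \<le> b \<Longrightarrow> lo \<le> a \<Longrightarrow> b \<le> hi \<Longrightarrow> N a b = ?Q a b" for a b
    proof (induction "b - a" arbitrary: a rule: less_induct)
      case less
      show ?case
      proof (cases "a = b")
        case True then show ?thesis using Qdiag[of b] by (simp add: diag)
      next
        case False
        then have ab: "a < b" using less by simp
        have "N a b = (\<Sum>k\<in>{Suc a..b}. (-1) ^ (k - Suc a) * M a k * N k b)"
          using inv ab less.prems sgn[OF ab] unfolding signed_inverse_def by auto
        also have "\<dots> = (\<Sum>k\<in>{Suc a..b}. (-1) ^ (k - Suc a) * M a k * ?Q k b)"
          using less ab by (intro sum.cong refl) auto
        finally show ?thesis using Qrec[of a b] less.prems ab by simp
      qed
    qed
    then show "\<forall>a b. lo \<le> a \<and> a < b \<and> b \<le> hi \<longrightarrow> N a b = ?Q a b" by simp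
  next
    assume N: "\<forall>a b. lo \<le> a \<and> a < b \<and> b \<le> hi \<longrightarrow> N a b = ?Q a b"
    have N': "N a b = ?Q a b" if "lo \<le> a" "a \<le> b" "b \<le> hi" for a b
      using that N by (cases "a = b") (use Qdiag[of b] in \<open>auto simp: diag\<close>)
    have "(\<Sum>k=a..b. (-1) ^ k * M a k * N k b) = 0" if ab: "lo \<le> a" "a < b" "b \<le> hi" for a b
    proof -
      have "N a b = (\<Sum>k\<in>{Suc a..b}. (-1) ^ (k - Suc a) * M a k * ?Q k b)"
        using Qrec ab N' by simp
      also have "\<dots> = (\<Sum>k\<in>{Suc a..b}. (-1) ^ (k - Suc a) * M a k * N k b)"
        using ab by (intro sum.cong refl) (auto simp: N')
      finally show ?thesis using sgn ab by simp
    qed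
    then show "signed_inverse lo hi M N" by (simp add: signed_inverse_def diag)
  qed
qed

lemma triangular_sum_swap:
  fixes f :: "nat \<Rightarrow> nat \<Rightarrow> 'z::comm_monoid_add"
  shows "(\<Sum>k=a..b. \<Sum>l=k..b. f k l) = (\<Sum>l=a..b. \<Sum>k=a..l. f k l)"
proof -
  have "(\<Sum>k=a..b. \<Sum>l=k..b. f k l) = (\<Sum>k=a..b. \<Sum>l=a..b. if k \<le> l then f k l else 0)"
    by (intro sum.cong refl sum.mono_neutral_cong_left) auto
  also have "\<dots> = (\<Sum>l=a..b. \<Sum>k=a..b. if k \<le> l then f k l else 0)"
    by (rule sum.swap)
  also have "\<dots> = (\<Sum>l=a..b. \<Sum>k=a..l. f k l)"
    by (intro sum.cong refl sum.mono_neutral_cong_right) auto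
  finally show ?thesis .
qed

lemma minus_one_power_square: "(-1::complex) ^ k * (-1) ^ k = 1"
  by (simp add: power_mult_distrib[symmetric])

text \<open>
  A right inverse is a left inverse: for \<open>C = N M\<close> (with signs) one has \<open>M C = M\<close>, and \<open>M\<close> can be
  cancelled from the bottom row upwards because its diagonal entries are 1.
\<close>

lemma signed_inverse_commute:
  assumes "signed_inverse lo hi M N"
  shows "signed_inverse lo hi N M"
proof -
  have diag: "M a a = 1" "N a a = 1" for a using assms by (auto simp: signed_inverse_def)
  define C where "C a b = (\<Sum>k=a..b. (-1) ^ k * N a k * M k b)" for a b
  have MN: "(\<Sum>k=a..b. (-1) ^ k * M a k * N k b) = (if a = b then (-1) ^ a else 0)"
    if "lo \<le> a" "a \<le> b" "b \<le> hi" for a b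
    using assms that by (auto simp: signed_inverse_def)
  have Cdiag: "C a a = (-1) ^ a" for a by (simp add: C_def diag)
  have MC: "(\<Sum>k=a..b. (-1) ^ k * M a k * C k b) = M a b"
    if ab: "lo \<le> a" "a \<le> b" "b \<le> hi" for a b
  proof -
    have "(\<Sum>k=a..b. (-1) ^ k * M a k * C k b) =
        (\<Sum>k=a..b. \<Sum>l=k..b. (-1) ^ k * M a k * ((-1) ^ l * N k l * M l b))"
      by (simp add: C_def sum_distrib_left)
    also have "\<dots> = (\<Sum>l=a..b. \<Sum>k=a..l. (-1) ^ k * M a k * ((-1) ^ l * N k l * M l b))"
      by (rule triangular_sum_swap)
    also have "\<dots> = (\<Sum>l=a..b. (-1) ^ l * M l b * (\<Sum>k=a..l. (-1) ^ k * M a k * N k l))"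
      unfolding sum_distrib_left by (intro sum.cong refl) (simp only: mult_ac)
    also have "\<dots> = (\<Sum>l=a..b. if l = a then M a b else 0)"
    proof (intro sum.cong refl)
      fix l assume l: "l \<in> {a..b}"
      have "(-1) ^ a * M a b * (-1) ^ a = M a b * ((-1) ^ a * (-1) ^ a)" by (simp only: mult_ac)
      then show "(-1) ^ l * M l b * (\<Sum>k=a..l. (-1) ^ k * M a k * N k l) = (if l = a then M a b else 0)"
        using l ab by (simp add: MN minus_one_power_square)
    qed
    also have "\<dots> = M a b" using ab by simp
    finally show ?thesis .
  qed
  have "a < b \<Longrightarrow> lo \<le> a \<Longrightarrow> b \<le> hi \<Longrightarrow> C a b = 0" for a b
  proof (induction "b - a" arbitrary: a rule: less_induct)
    case less
    have "M a b = (-1) ^ a * C a b + (\<Sum>k=Suc a..b. (-1) ^ k * M a k * C k b)"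
      using MC[of a b] less.prems by (simp add: sum.atLeast_Suc_atMost diag)
    also have "(\<Sum>k=Suc a..b. (-1) ^ k * M a k * C k b) = (\<Sum>k=Suc a..b. if k = b then M a b else 0)"
    proof (intro sum.cong refl)
      fix k assume k: "k \<in> {Suc a..b}"
      show "(-1) ^ k * M a k * C k b = (if k = b then M a b else 0)"
      proof (cases "k = b")
        case True
        have "(-1) ^ b * M a b * (-1) ^ b = M a b * ((-1) ^ b * (-1) ^ b)" by (simp only: mult_ac)
        then show ?thesis using True by (simp add: Cdiag minus_one_power_square)
      next
        case False
        then have "C k b = 0" using less k by auto
        then show ?thesis using False by simp
      qed
    qed
    also have "\<dots> = M a b" using less.prems by simp
    finally show ?case by simp
  qed
  then show ?thesis by (simp add: signed_inverse_def diag C_def)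
qed

text \<open>
  The tool that finds the entries on which the axioms are silent: in the difference of an inverse
  relation before and after the action, all terms but those for \<open>i\<close> and \<open>i + 1\<close> cancel.
\<close>

lemma alternating_sum_two_terms:
  fixes h :: "nat \<Rightarrow> complex"
  assumes "(\<Sum>k=a..b. (-1) ^ k * h k) = 0" "a \<le> i" "Suc i \<le> b"
    and "\<And>k. a \<le> k \<Longrightarrow> k \<le> b \<Longrightarrow> k \<noteq> i \<Longrightarrow> k \<noteq> Suc i \<Longrightarrow> h k = 0"
  shows "h i = h (Suc i)"
proof -
  have "(\<Sum>k=a..b. (-1) ^ k * h k) = (\<Sum>k\<in>{i, Suc i}. (-1) ^ k * h k)"
    using assms by (intro sum.mono_neutral_right) auto
  then have "(-1) ^ i * (h i - h (Suc i)) = 0" using assms(1) by (simp add: algebra_simps)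
  then show ?thesis by simp
qed

section \<open>The effect of one crystal operator\<close>

text \<open>
  The axioms on \<open>\<epsilon>\<^sub>J\<close>, with \<open>J = [a, b - 1]\<close> stored as the entry \<open>(a, b)\<close>. They are silent on
  row \<open>i + 1\<close> and on column \<open>i\<close>.
\<close>

definition eps_transform ::
  "nat \<Rightarrow> nat \<Rightarrow> complex \<Rightarrow> (nat \<Rightarrow> nat \<Rightarrow> complex) \<Rightarrow> (nat \<Rightarrow> nat \<Rightarrow> complex) \<Rightarrow> bool" where
  "eps_transform n i c M M' \<longleftrightarrow>
     (\<forall>a b. 1 \<le> a \<and> a < b \<and> b \<le> Suc n \<longrightarrow>
        (a = i \<longrightarrow> M' a b = M a b / c) \<and>
        (a \<noteq> i \<and> a \<noteq> Suc i \<and> b \<noteq> i \<longrightarrow> M' a b = M a b))"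

definition eps_star_transform ::
  "nat \<Rightarrow> nat \<Rightarrow> complex \<Rightarrow> (nat \<Rightarrow> nat \<Rightarrow> complex) \<Rightarrow> (nat \<Rightarrow> nat \<Rightarrow> complex) \<Rightarrow> bool" where
  "eps_star_transform n i c N N' \<longleftrightarrow>
     (\<forall>a b. 1 \<le> a \<and> a < b \<and> b \<le> Suc n \<longrightarrow>
        (b = Suc i \<longrightarrow> N' a b = N a b / c) \<and>
        (b \<noteq> Suc i \<and> a \<noteq> Suc i \<and> b \<noteq> i \<longrightarrow> N' a b = N a b))"

lemma eps_transform_diag:
  assumes "eps_transform n i c M M'" "\<And>a. M a a = 1" "\<And>a. M' a a = 1"
    "1 \<le> a" "a \<le> b" "b \<le> Suc n" "a \<noteq> i" "a \<noteq> Suc i" "b \<noteq> i"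
  shows "M' a b = M a b"
  using assms by (cases "a = b") (auto simp: eps_transform_def)

lemma eps_star_transform_diag:
  assumes "eps_star_transform n i c N N'" "\<And>a. N a a = 1" "\<And>a. N' a a = 1"
    "1 \<le> a" "a \<le> b" "b \<le> Suc n" "b \<noteq> Suc i" "a \<noteq> Suc i" "b \<noteq> i"
  shows "N' a b = N a b"
  using assms by (cases "a = b") (auto simp: eps_star_transform_def)

lemma signed_inverse_diff:
  assumes "signed_inverse 1 (Suc n) M N" "signed_inverse 1 (Suc n) M' N'" "1 \<le> a" "a < b" "b \<le> Suc n"
  shows "(\<Sum>k=a..b. (-1) ^ k * (c * (M' a k * N' k b) - M a k * N k b)) = 0"
proof -
  have "(\<Sum>k=a..b. (-1) ^ k * (c * (M' a k * N' k b) - M a k * N k b)) =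
     c * (\<Sum>k=a..b. (-1) ^ k * M' a k * N' k b) - (\<Sum>k=a..b. (-1) ^ k * M a k * N k b)"
    unfolding sum_distrib_left sum_subtractf[symmetric]
    by (intro sum.cong refl) (simp add: algebra_simps)
  then show ?thesis using assms by (simp add: signed_inverse_def)
qed

text \<open>
  Two points related by \<open>e\<^sub>i\<close> with parameter \<open>c\<close>: the matrices of \<open>\<epsilon>\<close> and \<open>\<epsilon>\<^sup>*\<close> at the first point are
  \<open>M\<close>, \<open>N\<close> and those at the second are \<open>M'\<close>, \<open>N'\<close>. The inverse relation at both points forces
  the change of row \<open>i + 1\<close> and of column \<open>i\<close>.
\<close>

locale eps_change =
  fixes n i :: nat and c :: complex and M N M' N' :: "nat \<Rightarrow> nat \<Rightarrow> complex"
  assumes c: "c \<noteq> 0" and i: "1 \<le> i" "i \<le> n"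
    and inv: "signed_inverse 1 (Suc n) M N" "signed_inverse 1 (Suc n) M' N'"
    and M: "eps_transform n i c M M'" and N: "eps_star_transform n i c N N'"
    and nz: "M i (Suc i) \<noteq> 0"
begin

abbreviation "e \<equiv> M i (Suc i)"

lemma diag: "M a a = 1" "N a a = 1" "M' a a = 1" "N' a a = 1"
  using inv by (auto simp: signed_inverse_def)

lemma M_row: "i < b \<Longrightarrow> b \<le> Suc n \<Longrightarrow> M' i b = M i b / c"
  using M i by (auto simp: eps_transform_def)

lemma N_col: "1 \<le> a \<Longrightarrow> a \<le> i \<Longrightarrow> N' a (Suc i) = N a (Suc i) / c"
  using N[unfolded eps_star_transform_def, rule_format, of a "Suc i"] i by simp

lemmas M_same = eps_transform_diag[OF M diag(1) diag(3)]
lemmas N_same = eps_star_transform_diag[OF N diag(2) diag(4)]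

text \<open>
  The partition sum of a one-point interval has a single term.
\<close>

lemma star_e: "N i (Suc i) = e"
proof -
  have "(\<Sum>k=i..Suc i. (-1) ^ k * M i k * N k (Suc i)) = 0"
    using inv(1)[unfolded signed_inverse_def, THEN conjunct2, rule_format, of i "Suc i"] i by simp
  then have "(-1) ^ i * (N i (Suc i) - e) = 0"
    by (simp add: diag algebra_simps)
  then show ?thesis by simp
qed

text \<open>
  In \<open>\<Sum>\<^sub>k (-1)\<^sup>k M a k N k (i + 1) = 0\<close> the only unknown after the action is \<open>M' a i\<close>. The other
  three entries below are found in the same way, each from the relation in which it is the only
  unknown: \<open>N (i + 1) b\<close> from the product \<open>M N\<close>, and \<open>N a i\<close> and \<open>M (i + 1) b\<close> from the product
  \<open>N M\<close>.
\<close>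

lemma M_col_i:
  assumes "1 \<le> a" "a < i"
  shows "M' a i = M a i + (c - 1) * M a (Suc i) / e"
proof -
  have "c * (M' a i * N' i (Suc i)) - M a i * N i (Suc i) =
        c * (M' a (Suc i) * N' (Suc i) (Suc i)) - M a (Suc i) * N (Suc i) (Suc i)"
    by (rule alternating_sum_two_terms[OF signed_inverse_diff[OF inv, of a "Suc i" c]])
      (use assms i c in \<open>auto simp: N_col M_same\<close>)
  then show ?thesis using assms i c nz by (simp add: diag N_col M_same star_e field_simps)
qed

lemma N_row_i:
  assumes "Suc i < b" "b \<le> Suc n"
  shows "N' (Suc i) b = N (Suc i) b + (c - 1) * N i b / e"
proof -
  have "c * (M' i i * N' i b) - M i i * N i b =
        c * (M' i (Suc i) * N' (Suc i) b) - M i (Suc i) * N (Suc i) b"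
    by (rule alternating_sum_two_terms[OF signed_inverse_diff[OF inv, of i b c]])
      (use assms i c in \<open>auto simp: N_same M_row\<close>)
  then show ?thesis using assms i c nz by (simp add: diag N_same M_row field_simps)
qed

lemma N_col_i:
  assumes "1 \<le> a" "a < i"
  shows "N' a i = c * N a i + (1 - c) * N a (Suc i) / e"
proof -
  note inv' = inv[THEN signed_inverse_commute]
  have "1 * (N' a i * M' i (Suc i)) - N a i * M i (Suc i) =
        1 * (N' a (Suc i) * M' (Suc i) (Suc i)) - N a (Suc i) * M (Suc i) (Suc i)"
    by (rule alternating_sum_two_terms[OF signed_inverse_diff[OF inv', of a "Suc i" 1]])
      (use assms i c in \<open>auto simp: N_same M_same\<close>)
  then show ?thesis using assms i c nz by (simp add: diag N_col M_row field_simps)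
qed

lemma M_row_Suc_i:
  assumes "Suc i < b" "b \<le> Suc n"
  shows "M' (Suc i) b = c * M (Suc i) b + (1 - c) * M i b / e"
proof -
  note inv' = inv[THEN signed_inverse_commute]
  have "1 * (N' i i * M' i b) - N i i * M i b =
        1 * (N' i (Suc i) * M' (Suc i) b) - N i (Suc i) * M (Suc i) b"
    by (rule alternating_sum_two_terms[OF signed_inverse_diff[OF inv', of i b 1]])
      (use assms i c in \<open>auto simp: N_same M_same\<close>)
  then show ?thesis using assms i c nz by (simp add: diag N_col M_row star_e field_simps)
qed


text \<open>
  Versions that include the diagonal entry, so that the product computation needs no case
  distinction at the ends of the summation range.
\<close>

lemma M_col_i':
  assumes "1 \<le> a" "a \<le> i"
  shows "M' a i = (if a = i then 1 / c else 1) * (M a i + (c - 1) * M a (Suc i) / e)"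
  using assms M_col_i[of a] c nz by (cases "a = i") (auto simp: diag)

lemma M_row_Suc_i':
  assumes "Suc i \<le> b" "b \<le> Suc n"
  shows "M' (Suc i) b = c * M (Suc i) b + (1 - c) * M i b / e"
  using assms M_row_Suc_i[of b] c nz by (cases "b = Suc i") (auto simp: diag)

lemma N_col_i':
  assumes "1 \<le> a" "a \<le> i"
  shows "N' a i = c * N a i + (1 - c) * N a (Suc i) / e"
  using assms N_col_i[of a] c nz by (cases "a = i") (auto simp: diag star_e)

lemma N_row_i':
  assumes "Suc i \<le> b" "b \<le> Suc n"
  shows "N' (Suc i) b = (if b = Suc i then 1 / c else 1) * (N (Suc i) b + (c - 1) * N i b / e)"
  using assms N_row_i[of b] c nz by (cases "b = Suc i") (auto simp: diag star_e)

lemma M_col_Suc_i: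
  assumes "1 \<le> a" "a \<le> i"
  shows "M' a (Suc i) = (if a = i then 1 / c else 1) * M a (Suc i)"
  using assms i by (auto simp: M_row M_same)

lemma N_row:
  assumes "Suc i \<le> b" "b \<le> Suc n"
  shows "N' i b = (if b = Suc i then 1 / c else 1) * N i b"
  using assms i by (auto simp: N_col N_same)

end

section \<open>Twisted products of triangular matrices\<close>

text \<open>
  With \<open>D\<close> diagonal such that \<open>d\<^sub>j\<^sub>+\<^sub>1 / d\<^sub>j = g j\<close>, this is the matrix product \<open>D MY D\<^sup>-\<^sup>1 MX\<close>; the next
  definition is \<open>NX D NY D\<^sup>-\<^sup>1\<close>, its inverse up to signs if \<open>NX\<close> and \<open>NY\<close> are those of \<open>MX\<close> and \<open>MY\<close>. The summation index is one more than in the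
  formula for the product system, and empty intervals contribute the diagonal entries 1.
\<close>

definition prod_eps_matrix ::
  "(nat \<Rightarrow> complex) \<Rightarrow> (nat \<Rightarrow> nat \<Rightarrow> complex) \<Rightarrow> (nat \<Rightarrow> nat \<Rightarrow> complex) \<Rightarrow> nat \<Rightarrow> nat \<Rightarrow> complex" where
  "prod_eps_matrix g MX MY a b = (\<Sum>k=a..b. MY a k * MX k b / (\<Prod>j\<in>{a..<k}. g j))"

definition prod_star_matrix ::
  "(nat \<Rightarrow> complex) \<Rightarrow> (nat \<Rightarrow> nat \<Rightarrow> complex) \<Rightarrow> (nat \<Rightarrow> nat \<Rightarrow> complex) \<Rightarrow> nat \<Rightarrow> nat \<Rightarrow> complex" where
  "prod_star_matrix g NX NY a b = (\<Sum>k=a..b. NX a k * NY k b / (\<Prod>j\<in>{k..<b}. g j))"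

text \<open>
  In \<open>(D MY D\<^sup>-\<^sup>1 MX) (NX D NY D\<^sup>-\<^sup>1)\<close>, with the signs inserted, the inner pair cancels first, then the outer one.
\<close>

lemma signed_inverse_product:
  assumes X: "signed_inverse lo hi MX NX" and Y: "signed_inverse lo hi MY NY"
  shows "signed_inverse lo hi (prod_eps_matrix g MX MY) (prod_star_matrix g NX NY)"
  unfolding signed_inverse_def
proof (intro conjI allI impI)
  have diag: "MX a a = 1" "NX a a = 1" "MY a a = 1" "NY a a = 1" for a
    using X Y by (auto simp: signed_inverse_def)
  show "prod_eps_matrix g MX MY a a = 1" "prod_star_matrix g NX NY a a = 1" for a
    by (simp_all add: prod_eps_matrix_def prod_star_matrix_def diag)
  fix a b assume ab: "lo \<le> a \<and> a < b \<and> b \<le> hi"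
  define G where "G p q = (\<Prod>j\<in>{p..<q}. g j)" for p q
  define A where "A p = MY a p / G a p" for p
  define B where "B q = NY q b / G q b" for q
  have XI: "(\<Sum>k=p..q. (-1) ^ k * MX p k * NX k q) = (if p = q then (-1) ^ p else 0)"
    if "a \<le> p" "p \<le> q" "q \<le> b" for p q
    using X that ab by (auto simp: signed_inverse_def diag)
  have "(\<Sum>k=a..b. (-1) ^ k * prod_eps_matrix g MX MY a k * prod_star_matrix g NX NY k b) =
      (\<Sum>k=a..b. \<Sum>q=k..b. \<Sum>p=a..k. A p * B q * ((-1) ^ k * MX p k * NX k q))"
    unfolding prod_eps_matrix_def prod_star_matrix_def
  proof (intro sum.cong refl)
    fix k
    have "(\<Sum>q=k..b. \<Sum>p=a..k. A p * B q * ((-1) ^ k * MX p k * NX k q)) =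
      (\<Sum>p=a..k. \<Sum>q=k..b. (-1) ^ k * ((A p * MX p k) * (B q * NX k q)))"
      by (subst sum.swap) (intro sum.cong refl, simp only: mult_ac)
    also have "\<dots> = (-1) ^ k * ((\<Sum>p=a..k. A p * MX p k) * (\<Sum>q=k..b. B q * NX k q))"
      unfolding sum_product by (simp only: sum_distrib_left)
    also have "(\<Sum>p=a..k. A p * MX p k) = (\<Sum>p = a..k. MY a p * MX p k / prod g {a..<p})"
      by (simp add: A_def G_def)
    also have "(\<Sum>q=k..b. B q * NX k q) = (\<Sum>q = k..b. NX k q * NY q b / prod g {q..<b})"
      by (simp add: B_def G_def mult.commute)
    finally show "(-1) ^ k * (\<Sum>p = a..k. MY a p * MX p k / prod g {a..<p}) *
         (\<Sum>q = k..b. NX k q * NY q b / prod g {q..<b}) =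
         (\<Sum>q=k..b. \<Sum>p=a..k. A p * B q * ((-1) ^ k * MX p k * NX k q))"
      by (simp add: mult.assoc)
  qed
  also have "\<dots> = (\<Sum>q=a..b. \<Sum>k=a..q. \<Sum>p=a..k. A p * B q * ((-1) ^ k * MX p k * NX k q))"
    by (rule triangular_sum_swap)
  also have "\<dots> = (\<Sum>q=a..b. \<Sum>p=a..q. \<Sum>k=p..q. A p * B q * ((-1) ^ k * MX p k * NX k q))"
    by (intro sum.cong refl triangular_sum_swap[symmetric])
  also have "\<dots> = (\<Sum>q=a..b. \<Sum>p=a..q. if p = q then A p * B q * (-1) ^ p else 0)"
    unfolding sum_distrib_left[symmetric] by (intro sum.cong refl) (auto simp: XI)
  also have "\<dots> = (\<Sum>q=a..b. A q * B q * (-1) ^ q)"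
    by (intro sum.cong refl) auto
  also have "\<dots> = (\<Sum>q=a..b. (-1) ^ q * MY a q * NY q b) / G a b"
    unfolding sum_divide_distrib
  proof (intro sum.cong refl)
    fix q assume "q \<in> {a..b}"
    then have "G a b = G a q * G q b"
      unfolding G_def by (intro prod.atLeastLessThan_concat[symmetric]) auto
    then show "A q * B q * (-1) ^ q = (-1) ^ q * MY a q * NY q b / G a b"
      by (simp add: A_def B_def mult_ac)
  qed
  also have "\<dots> = 0" using Y ab by (simp add: signed_inverse_def)
  finally show "(\<Sum>k=a..b. (-1) ^ k * prod_eps_matrix g MX MY a k * prod_star_matrix g NX NY k b) = 0" .
qed

lemma sum_scaled_two_terms:
  fixes f f' :: "nat \<Rightarrow> complex"
  assumes "\<And>k. a \<le> k \<Longrightarrow> k \<le> b \<Longrightarrow> k \<noteq> i \<Longrightarrow> k \<noteq> Suc i \<Longrightarrow> f' k = r * f k"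
    and "a \<noteq> Suc i" "b \<noteq> i"
    and two: "a \<le> i \<Longrightarrow> Suc i \<le> b \<Longrightarrow> f' i + f' (Suc i) = r * (f i + f (Suc i))"
  shows "(\<Sum>k=a..b. f' k) = r * (\<Sum>k=a..b. f k)"
proof (cases "a \<le> i \<and> Suc i \<le> b")
  case True
  have split: "(\<Sum>k=a..b. h k) = (h i + h (Suc i)) + (\<Sum>k\<in>{a..b} - {i, Suc i}. h k)"
    for h :: "nat \<Rightarrow> complex"
    using True sum.subset_diff[of "{i, Suc i}" "{a..b}" h] by (simp add: add.commute)
  have "(\<Sum>k\<in>{a..b} - {i, Suc i}. f' k) = r * (\<Sum>k\<in>{a..b} - {i, Suc i}. f k)"
    unfolding sum_distrib_left using assms(1) by (intro sum.cong refl) auto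
  then show ?thesis
    unfolding split[of f] split[of f'] using two True by (simp add: distrib_left)
next
  case False
  then have "k \<noteq> i \<and> k \<noteq> Suc i" if "k \<in> {a..b}" for k using that assms(2,3) by auto
  then show ?thesis
    unfolding sum_distrib_left using assms(1) by (intro sum.cong refl) auto
qed

definition gam_transform :: "nat \<Rightarrow> nat \<Rightarrow> complex \<Rightarrow> (nat \<Rightarrow> complex) \<Rightarrow> (nat \<Rightarrow> complex) \<Rightarrow> bool" where
  "gam_transform n i c g g' \<longleftrightarrow> (\<forall>j\<in>{1..n}. g' j = c powi cartan i j * g j)"

text \<open>
  Acting by \<open>e\<^sub>i\<close> replaces \<open>D\<close> by \<open>D diag(\<dots>, 1/c, c, \<dots>)\<close> with the two entries at \<open>i\<close> and \<open>i + 1\<close>;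
  the powers prescribed by the Cartan matrix are the quotients of neighbouring diagonal entries.
\<close>

lemma gam_transform_prod:
  assumes "gam_transform n i c g g'" "c \<noteq> 0" "1 \<le> a" "a \<le> k" "k \<le> Suc n"
  defines "d \<equiv> \<lambda>k. if k = i then 1 / c else if k = Suc i then c else 1"
  shows "(\<Prod>j\<in>{a..<k}. g' j) = (\<Prod>j\<in>{a..<k}. g j) * d k / d a"
  using assms(4,5)
proof (induction k rule: dec_induct)
  case base
  have "d a \<noteq> 0" using assms by (auto simp: d_def)
  then show ?case by simp
next
  case (step k)
  have "g' k = c powi cartan i k * g k"
    using assms(1,3) step by (auto simp: gam_transform_def)
  moreover have "d (Suc k) = c powi cartan i k * d k"
    using \<open>c \<noteq> 0\<close> by (auto simp: d_def cartan_def power_int_def power2_eq_square inverse_eq_divide)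
  ultimately show ?case using step by simp
qed

text \<open>
  The operator \<open>e\<^sub>i\<close> acts on the two factors with parameters \<open>c\<^sub>1\<close> and \<open>c\<^sub>2\<close>. The relation \<open>balance\<close> is what
  the defining formulas of \<open>c\<^sub>1\<close> and \<open>c\<^sub>2\<close> amount to.
\<close>

locale product_change =
  X: eps_change n i c\<^sub>1 MX NX MX' NX' + Y: eps_change n i c\<^sub>2 MY NY MY' NY'
  for n i c\<^sub>1 MX NX MX' NX' c\<^sub>2 MY NY MY' NY' +
  fixes g g' :: "nat \<Rightarrow> complex"
  assumes gam: "gam_transform n i c\<^sub>1 g g'" and g_nz: "\<And>j. 1 \<le> j \<Longrightarrow> j \<le> n \<Longrightarrow> g j \<noteq> 0"
    and balance: "(c\<^sub>1 - 1) * MY i (Suc i) = (c\<^sub>2 - 1) * c\<^sub>1 * (g i * MX i (Suc i))"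
begin

abbreviation "G \<equiv> \<lambda>a k. \<Prod>j\<in>{a..<k}. g j"
abbreviation "G' \<equiv> \<lambda>a k. \<Prod>j\<in>{a..<k}. g' j"

lemma balance': "(c\<^sub>2 - 1) / MY i (Suc i) + (1 - c\<^sub>1) / (c\<^sub>1 * MX i (Suc i) * g i) = 0"
  using balance X.c X.nz Y.nz g_nz[of i] X.i by (simp add: field_simps)

text \<open>
  The heart of the computation. Only the summands for \<open>i\<close> and \<open>i + 1\<close> interact; each acquires a
  multiple of \<open>Q R\<close>, and \<open>balance\<close> makes the two multiples cancel.
\<close>

lemma two_terms:
  fixes P Q R S :: complex
  shows "(P + (c\<^sub>2 - 1) * Q / MY i (Suc i)) * R +
         Q * (S + (1 - c\<^sub>1) * R / (c\<^sub>1 * MX i (Suc i))) / g i = P * R + Q * S / g i"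
proof -
  have "(P + (c\<^sub>2 - 1) * Q / MY i (Suc i)) * R +
         Q * (S + (1 - c\<^sub>1) * R / (c\<^sub>1 * MX i (Suc i))) / g i = P * R + Q * S / g i +
         Q * R * ((c\<^sub>2 - 1) / MY i (Suc i) + (1 - c\<^sub>1) / (c\<^sub>1 * MX i (Suc i) * g i))"
    by (simp add: algebra_simps add_divide_distrib diff_divide_distrib)
  then show ?thesis by (simp only: balance' mult_zero_right add_0_right)
qed

text \<open>
  The summands other than those for \<open>i\<close> and \<open>i + 1\<close> are multiplied by one common factor. It is \<open>1\<close> unless \<open>a = i\<close>, when
  \<open>MY a k\<close> contributes \<open>1 / c\<^sub>2\<close> and the product of the \<open>g j\<close> contributes \<open>1 / c\<^sub>1\<close>. The remaining two are
  governed by \<open>two_terms\<close>.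
\<close>

lemma prod_eps_matrix_change:
  assumes ab: "1 \<le> a" "a < b" "b \<le> Suc n" "a \<noteq> Suc i" "b \<noteq> i"
  shows "prod_eps_matrix g' MX' MY' a b =
           (if a = i then 1 / (c\<^sub>1 * c\<^sub>2) else 1) * prod_eps_matrix g MX MY a b"
  unfolding prod_eps_matrix_def
proof (rule sum_scaled_two_terms[where i = i])
  fix k assume k: "a \<le> k" "k \<le> b" "k \<noteq> i" "k \<noteq> Suc i"
  have "MX' k b = MX k b" using k ab by (intro X.M_same) auto
  moreover have "MY' a k = (if a = i then 1 / c\<^sub>2 else 1) * MY a k"
    using k ab by (auto simp: Y.M_row Y.M_same)
  moreover have "G' a k = G a k * (if a = i then c\<^sub>1 else 1)"
    using gam_transform_prod[OF gam X.c, of a k] k ab by auto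
  ultimately show "MY' a k * MX' k b / G' a k =
      (if a = i then 1 / (c\<^sub>1 * c\<^sub>2) else 1) * (MY a k * MX k b / G a k)"
    by simp
next
  assume i: "a \<le> i" "Suc i \<le> b"
  define r where "r = (if a = i then 1 / (c\<^sub>1 * c\<^sub>2) else 1)"
  define r\<^sub>1 where "r\<^sub>1 = (if a = i then 1 / c\<^sub>1 else 1)"
  define r\<^sub>2 where "r\<^sub>2 = (if a = i then 1 / c\<^sub>2 else 1)"
  have r: "r = r\<^sub>1 * r\<^sub>2" "r\<^sub>1 \<noteq> 0" using X.c by (auto simp: r_def r\<^sub>1_def r\<^sub>2_def)
  define P where "P = MY a i"
  define Q where "Q = MY a (Suc i)"
  define R where "R = MX i b"
  define S where "S = MX (Suc i) b"
  have G1: "G a (Suc i) = G a i * g i" using i by simp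
  have eq1: "G' a i = G a i * (1 / c\<^sub>1) / r\<^sub>1"
    using gam_transform_prod[OF gam X.c, of a i] i ab by (auto simp: r\<^sub>1_def)
  have eq2: "G' a (Suc i) = G a i * g i * c\<^sub>1 / r\<^sub>1"
    using gam_transform_prod[OF gam X.c, of a "Suc i"] i ab unfolding G1 by (auto simp: r\<^sub>1_def)
  have eq3: "MY' a i = r\<^sub>2 * (P + (c\<^sub>2 - 1) * Q / MY i (Suc i))" "MY' a (Suc i) = r\<^sub>2 * Q"
    using i ab by (auto simp: Y.M_col_i' Y.M_col_Suc_i r\<^sub>2_def P_def Q_def)
  have eq4: "MX' i b = R / c\<^sub>1" "MX' (Suc i) b = c\<^sub>1 * S + (1 - c\<^sub>1) * R / MX i (Suc i)"
    using i ab by (auto simp: X.M_row X.M_row_Suc_i' R_def S_def)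
  have nz: "G a i \<noteq> 0" "g i \<noteq> 0" using g_nz ab i X.i by auto
  have "MY' a i * MX' i b / G' a i + MY' a (Suc i) * MX' (Suc i) b / G' a (Suc i) =
      r / G a i * ((P + (c\<^sub>2 - 1) * Q / MY i (Suc i)) * R +
         Q * (S + (1 - c\<^sub>1) * R / (c\<^sub>1 * MX i (Suc i))) / g i)"
    unfolding eq1 eq2 eq3 eq4 r(1) using X.c r(2) X.nz Y.nz nz by (simp add: field_simps)
  also have "\<dots> = r / G a i * (P * R + Q * S / g i)" by (simp only: two_terms)
  also have "\<dots> = r * (MY a i * MX i b / G a i + MY a (Suc i) * MX (Suc i) b / G a (Suc i))"
    unfolding G1 P_def Q_def R_def S_def by (simp add: distrib_left mult_ac)
  finally show "MY' a i * MX' i b / G' a i + MY' a (Suc i) * MX' (Suc i) b / G' a (Suc i) =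
    (if a = i then 1 / (c\<^sub>1 * c\<^sub>2) else 1) *
      (MY a i * MX i b / G a i + MY a (Suc i) * MX (Suc i) b / G a (Suc i))"
    unfolding r_def .
qed (use ab in auto)

text \<open>
  The mirror image of the previous lemma, with the roles of \<open>i\<close> and \<open>i + 1\<close> exchanged.
\<close>

lemma prod_star_matrix_change:
  assumes ab: "1 \<le> a" "a < b" "b \<le> Suc n" "a \<noteq> Suc i" "b \<noteq> i"
  shows "prod_star_matrix g' NX' NY' a b =
           (if b = Suc i then 1 / (c\<^sub>1 * c\<^sub>2) else 1) * prod_star_matrix g NX NY a b"
  unfolding prod_star_matrix_def
proof (rule sum_scaled_two_terms[where i = i])
  fix k assume k: "a \<le> k" "k \<le> b" "k \<noteq> i" "k \<noteq> Suc i"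
  have "NX' a k = NX a k" using k ab by (intro X.N_same) auto
  moreover have "NY' k b = (if b = Suc i then 1 / c\<^sub>2 else 1) * NY k b"
    using k ab by (auto simp: Y.N_col Y.N_same)
  moreover have "G' k b = G k b * (if b = Suc i then c\<^sub>1 else 1)"
    using gam_transform_prod[OF gam X.c, of k b] k ab by auto
  ultimately show "NX' a k * NY' k b / G' k b =
      (if b = Suc i then 1 / (c\<^sub>1 * c\<^sub>2) else 1) * (NX a k * NY k b / G k b)"
    by simp
next
  assume i: "a \<le> i" "Suc i \<le> b"
  define r where "r = (if b = Suc i then 1 / (c\<^sub>1 * c\<^sub>2) else 1)"
  define r\<^sub>1 where "r\<^sub>1 = (if b = Suc i then c\<^sub>1 else 1)"
  define r\<^sub>2 where "r\<^sub>2 = (if b = Suc i then 1 / c\<^sub>2 else 1)"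
  have r: "r = r\<^sub>2 / r\<^sub>1" "r\<^sub>1 \<noteq> 0" using X.c by (auto simp: r_def r\<^sub>1_def r\<^sub>2_def)
  define P where "P = NY (Suc i) b"
  define Q where "Q = NY i b"
  define R where "R = NX a (Suc i)"
  define S where "S = NX a i"
  have G1: "G i b = g i * G (Suc i) b"
    using i by (simp add: prod.atLeast_Suc_lessThan)
  have eq1: "G' (Suc i) b = G (Suc i) b * r\<^sub>1 / c\<^sub>1"
    using gam_transform_prod[OF gam X.c, of "Suc i" b] i ab by (auto simp: r\<^sub>1_def)
  have eq2: "G' i b = g i * G (Suc i) b * r\<^sub>1 * c\<^sub>1"
    using gam_transform_prod[OF gam X.c, of i b] i ab unfolding G1 by (auto simp: r\<^sub>1_def)
  have eq3: "NY' (Suc i) b = r\<^sub>2 * (P + (c\<^sub>2 - 1) * Q / MY i (Suc i))" "NY' i b = r\<^sub>2 * Q"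
    using i ab by (auto simp: Y.N_row_i' Y.N_row r\<^sub>2_def P_def Q_def)
  have eq4: "NX' a (Suc i) = R / c\<^sub>1" "NX' a i = c\<^sub>1 * S + (1 - c\<^sub>1) * R / MX i (Suc i)"
    using i ab by (auto simp: X.N_col X.N_col_i' R_def S_def)
  have nz: "G (Suc i) b \<noteq> 0" "g i \<noteq> 0" using g_nz ab i X.i by auto
  have "NX' a i * NY' i b / G' i b + NX' a (Suc i) * NY' (Suc i) b / G' (Suc i) b =
      r / G (Suc i) b * ((P + (c\<^sub>2 - 1) * Q / MY i (Suc i)) * R +
         Q * (S + (1 - c\<^sub>1) * R / (c\<^sub>1 * MX i (Suc i))) / g i)"
    unfolding eq1 eq2 eq3 eq4 r(1) using X.c r(2) X.nz Y.nz nz by (simp add: field_simps)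
  also have "\<dots> = r / G (Suc i) b * (P * R + Q * S / g i)" by (simp only: two_terms)
  also have "\<dots> = r * (NX a i * NY i b / G i b + NX a (Suc i) * NY (Suc i) b / G (Suc i) b)"
    unfolding G1 P_def Q_def R_def S_def by (simp add: distrib_left mult_ac add_ac)
  finally show "NX' a i * NY' i b / G' i b + NX' a (Suc i) * NY' (Suc i) b / G' (Suc i) b =
    (if b = Suc i then 1 / (c\<^sub>1 * c\<^sub>2) else 1) *
      (NX a i * NY i b / G i b + NX a (Suc i) * NY (Suc i) b / G (Suc i) b)"
    unfolding r_def .
qed (use ab in auto)

end

section \<open>Regular functions\<close>

text \<open>
  The closure properties of regular functions that are shared by the punctured line and by all
  levels of an ind-variety, and from which slices of open sets in products are controlled.
\<close>

definition function_algebras :: "'a fspace \<Rightarrow> bool" where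
  "function_algebras X \<longleftrightarrow>
     (\<forall>U c. openin (ztop X) U \<longrightarrow> (\<lambda>_. c) \<in> reg X U) \<and>
     (\<forall>U f g. openin (ztop X) U \<and> f \<in> reg X U \<and> g \<in> reg X U \<longrightarrow>
        (\<lambda>x. f x + g x) \<in> reg X U \<and> (\<lambda>x. f x * g x) \<in> reg X U) \<and>
     (\<forall>U V f. openin (ztop X) U \<and> openin (ztop X) V \<and> V \<subseteq> U \<and> f \<in> reg X U \<longrightarrow> f \<in> reg X V) \<and>
     (\<forall>U f. openin (ztop X) U \<and> f \<in> reg X U \<longrightarrow> openin (ztop X) {x\<in>U. f x \<noteq> 0})"

lemma function_algebras_space_with_functions:
  assumes "space_with_functions X" shows "function_algebras X"
proof -
  note * = assms[unfolded space_with_functions_def, THEN conjunct2]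
  note const = *[THEN conjunct1]
  note ring = *[THEN conjunct2, THEN conjunct1]
  note mono = *[THEN conjunct2, THEN conjunct2, THEN conjunct1]
  note nonvan = *[THEN conjunct2, THEN conjunct2, THEN conjunct2, THEN conjunct2]
  have "\<forall>U f. openin (ztop X) U \<and> f \<in> reg X U \<longrightarrow> openin (ztop X) {x\<in>U. f x \<noteq> 0}"
    using nonvan by simp
  with const ring mono show ?thesis
    unfolding function_algebras_def by (intro conjI)
qed

lemma
  assumes "function_algebras X" "openin (ztop X) U"
  shows reg_const: "(\<lambda>_. c) \<in> reg X U"
    and reg_add: "f \<in> reg X U \<Longrightarrow> g \<in> reg X U \<Longrightarrow> (\<lambda>x. f x + g x) \<in> reg X U"
    and reg_mult: "f \<in> reg X U \<Longrightarrow> g \<in> reg X U \<Longrightarrow> (\<lambda>x. f x * g x) \<in> reg X U"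
    and reg_mono: "openin (ztop X) V \<Longrightarrow> V \<subseteq> U \<Longrightarrow> f \<in> reg X U \<Longrightarrow> f \<in> reg X V"
    and reg_nonvanishing_open: "f \<in> reg X U \<Longrightarrow> openin (ztop X) {x\<in>U. f x \<noteq> 0}"
proof -
  note * = assms(1)[unfolded function_algebras_def]
  show "(\<lambda>_. c) \<in> reg X U"
    using *[THEN conjunct1] assms(2) by simp
  show "f \<in> reg X U \<Longrightarrow> g \<in> reg X U \<Longrightarrow> (\<lambda>x. f x + g x) \<in> reg X U"
    "f \<in> reg X U \<Longrightarrow> g \<in> reg X U \<Longrightarrow> (\<lambda>x. f x * g x) \<in> reg X U"
    using *[THEN conjunct2, THEN conjunct1] assms(2) by simp_all
  show "openin (ztop X) V \<Longrightarrow> V \<subseteq> U \<Longrightarrow> f \<in> reg X U \<Longrightarrow> f \<in> reg X V"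
    using *[THEN conjunct2, THEN conjunct2, THEN conjunct1, rule_format, of U V f] assms(2) by simp
  show "f \<in> reg X U \<Longrightarrow> openin (ztop X) {x\<in>U. f x \<noteq> 0}"
    using *[THEN conjunct2, THEN conjunct2, THEN conjunct2] assms(2) by simp
qed

lemma reg_minus:
  assumes "function_algebras X" "openin (ztop X) U" "f \<in> reg X U"
  shows "(\<lambda>x. - f x) \<in> reg X U"
  using reg_mult[OF assms(1,2) reg_const[OF assms(1,2), of "-1"] assms(3)] by simp

lemma reg_sum:
  assumes "function_algebras X" "openin (ztop X) U" "finite I" "\<And>i. i \<in> I \<Longrightarrow> f i \<in> reg X U"
  shows "(\<lambda>x. \<Sum>i\<in>I. f i x) \<in> reg X U"
  using assms(3,4) by (induction I) (auto intro: reg_const reg_add assms)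

lemma openin_generated_by_induct:
  assumes "openin (topology_generated_by \<S>) S"
    and "P {}" "\<And>a b. P a \<Longrightarrow> P b \<Longrightarrow> P (a \<inter> b)"
    and "\<And>K. (\<And>k. k \<in> K \<Longrightarrow> P k) \<Longrightarrow> P (\<Union>K)" "\<And>s. s \<in> \<S> \<Longrightarrow> P s"
  shows "P S"
  using openin_topology_generated_by[OF assms(1)] by (induction) (use assms in auto)

section \<open>Products of spaces with functions\<close>

lemma tensor_funsI:
  assumes "finite I" "\<And>i. i \<in> I \<Longrightarrow> f i \<in> reg X U" "\<And>i. i \<in> I \<Longrightarrow> g i \<in> reg Y V"
    and "\<And>x y. h (x, y) = (\<Sum>i\<in>I. f i x * g i y)"
  shows "h \<in> tensor_funs X Y U V"
proof -
  obtain b where b: "bij_betw b {0..<card I} I"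
    using ex_bij_betw_nat_finite[OF assms(1)] by blast
  have "h (x, y) = (\<Sum>i<card I. f (b i) x * g (b i) y)" for x y
    using sum.reindex_bij_betw[OF b, of "\<lambda>i. f i x * g i y"] by (simp add: assms(4) atLeast0LessThan)
  then have "h = (\<lambda>(x, y). \<Sum>i<card I. f (b i) x * g (b i) y)" by (simp add: fun_eq_iff)
  moreover have "\<forall>i<card I. f (b i) \<in> reg X U \<and> g (b i) \<in> reg Y V"
    using bij_betwE[OF b] assms(2,3) by simp
  ultimately show ?thesis unfolding tensor_funs_def
    by (intro CollectI exI[of _ "card I"] exI[of _ "\<lambda>i. f (b i)"] exI[of _ "\<lambda>i. g (b i)"]) auto
qed

lemma tensor_funsE:
  assumes "h \<in> tensor_funs X Y U V"
  obtains m :: nat and f g where "\<And>i. i < m \<Longrightarrow> f i \<in> reg X U" "\<And>i. i < m \<Longrightarrow> g i \<in> reg Y V"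
    "\<And>x y. h (x, y) = (\<Sum>i<m. f i x * g i y)"
proof -
  obtain m f g where "h = (\<lambda>(x, y). \<Sum>i<(m::nat). f i x * g i y)"
    "\<forall>i<m. f i \<in> reg X U \<and> g i \<in> reg Y V"
    using assms unfolding tensor_funs_def by blast
  then show thesis by (intro that[of m f g]) auto
qed

lemma tensor_funs_single:
  assumes "f \<in> reg X U" "g \<in> reg Y V"
  shows "(\<lambda>(x, y). f x * g y) \<in> tensor_funs X Y U V"
  by (rule tensor_funsI[where I = "{0::nat}" and f = "\<lambda>_. f" and g = "\<lambda>_. g"]) (use assms in auto)

text \<open>
  The numerator of the difference of two fractions \<open>h / k\<close> and \<open>h' / k'\<close> of functions of this kind.
\<close>

lemma tensor_funs_cross_difference:
  assumes X: "function_algebras X" and Y: "function_algebras Y"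
    and U: "openin (ztop X) U" "openin (ztop X) U'" and V: "openin (ztop Y) V" "openin (ztop Y) V'"
    and hk: "h \<in> tensor_funs X Y U V" "k \<in> tensor_funs X Y U V"
    and hk': "h' \<in> tensor_funs X Y U' V'" "k' \<in> tensor_funs X Y U' V'"
  shows "(\<lambda>z. h z * k' z - h' z * k z) \<in> tensor_funs X Y (U \<inter> U') (V \<inter> V')"
proof -
  obtain m f g where h: "\<And>i. i < m \<Longrightarrow> f i \<in> reg X U" "\<And>i. i < m \<Longrightarrow> g i \<in> reg Y V"
    "\<And>x y. h (x, y) = (\<Sum>i<(m::nat). f i x * g i y)" using tensor_funsE[OF hk(1)] by blast
  obtain p a b where k: "\<And>i. i < p \<Longrightarrow> a i \<in> reg X U" "\<And>i. i < p \<Longrightarrow> b i \<in> reg Y V"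
    "\<And>x y. k (x, y) = (\<Sum>i<(p::nat). a i x * b i y)" using tensor_funsE[OF hk(2)] by blast
  obtain m' f' g' where h': "\<And>i. i < m' \<Longrightarrow> f' i \<in> reg X U'" "\<And>i. i < m' \<Longrightarrow> g' i \<in> reg Y V'"
    "\<And>x y. h' (x, y) = (\<Sum>i<(m'::nat). f' i x * g' i y)" using tensor_funsE[OF hk'(1)] by blast
  obtain p' a' b' where k': "\<And>i. i < p' \<Longrightarrow> a' i \<in> reg X U'" "\<And>i. i < p' \<Longrightarrow> b' i \<in> reg Y V'"
    "\<And>x y. k' (x, y) = (\<Sum>i<(p'::nat). a' i x * b' i y)" using tensor_funsE[OF hk'(2)] by blast
  have UU: "openin (ztop X) (U \<inter> U')" and VV: "openin (ztop Y) (V \<inter> V')" using U V by auto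
  note rU = reg_mono[OF X U(1) UU Int_lower1] reg_mono[OF X U(2) UU Int_lower2]
  note rV = reg_mono[OF Y V(1) VV Int_lower1] reg_mono[OF Y V(2) VV Int_lower2]
  note R = rU(1)[OF h(1)] rV(1)[OF h(2)] rU(1)[OF k(1)] rV(1)[OF k(2)]
    rU(2)[OF h'(1)] rV(2)[OF h'(2)] rU(2)[OF k'(1)] rV(2)[OF k'(2)]
  let ?I = "({..<m} \<times> {..<p'}) <+> ({..<m'} \<times> {..<p})"
  let ?F = "case_sum (\<lambda>(i, j) x. f i x * a' j x) (\<lambda>(i, j) x. - (f' i x * a j x))"
  let ?G = "case_sum (\<lambda>(i, j) y. g i y * b' j y) (\<lambda>(i, j) y. g' i y * b j y)"
  show ?thesis
  proof (rule tensor_funsI[where I = ?I and f = ?F and g = ?G])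
    fix i assume "i \<in> ?I"
    then show "?F i \<in> reg X (U \<inter> U')"
      by (auto intro!: reg_mult[OF X UU] reg_minus[OF X UU] R)
  next
    fix i assume "i \<in> ?I"
    then show "?G i \<in> reg Y (V \<inter> V')"
      by (auto intro!: reg_mult[OF Y VV] R)
  next
    fix x y
    have "(\<Sum>i\<in>?I. ?F i x * ?G i y) =
       (\<Sum>(i, j)\<in>{..<m} \<times> {..<p'}. (f i x * g i y) * (a' j x * b' j y)) -
       (\<Sum>(i, j)\<in>{..<m'} \<times> {..<p}. (f' i x * g' i y) * (a j x * b j y))"
      by (simp add: sum.Plus case_prod_unfold sum_negf mult_ac)
    also have "\<dots> = h (x, y) * k' (x, y) - h' (x, y) * k (x, y)"
      unfolding h k h' k' sum_product sum.cartesian_product ..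
    finally show "h (x, y) * k' (x, y) - h' (x, y) * k (x, y) = (\<Sum>i\<in>?I. ?F i x * ?G i y)" ..
  qed simp
qed

lemma openin_prod_fspace_basic:
  assumes "openin (ztop X) U" "openin (ztop Y) V" "h \<in> tensor_funs X Y U V"
  shows "openin (ztop (prod_fspace X Y)) {z \<in> U \<times> V. h z \<noteq> 0}"
  unfolding prod_fspace_def fspace.select_convs
  by (rule topology_generated_by_Basis) (intro CollectI exI[of _ U] exI[of _ V] exI[of _ h] conjI refl assms)

lemma openin_prod_fspace_Times:
  assumes "function_algebras X" "function_algebras Y" "openin (ztop X) U" "openin (ztop Y) V"
  shows "openin (ztop (prod_fspace X Y)) (U \<times> V)"
proof -
  have "(\<lambda>(x, y). 1 * 1) \<in> tensor_funs X Y U V"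
    by (rule tensor_funs_single[OF reg_const[OF assms(1,3)] reg_const[OF assms(2,4)]])
  from openin_prod_fspace_basic[OF assms(3,4) this]
  have "openin (ztop (prod_fspace X Y)) {z \<in> U \<times> V. (case z of (x, y) \<Rightarrow> 1 * 1) \<noteq> (0::complex)}" .
  moreover have "{z \<in> U \<times> V. (case z of (x, y) \<Rightarrow> 1 * 1) \<noteq> (0::complex)} = U \<times> V" by auto
  ultimately show ?thesis by (simp only:)
qed

lemma openin_prod_fspace_induct [consumes 1, case_names empty inter union basis]:
  assumes "openin (ztop (prod_fspace X Y)) W"
    and "P {}" "\<And>a b. P a \<Longrightarrow> P b \<Longrightarrow> P (a \<inter> b)" "\<And>K. (\<And>k. k \<in> K \<Longrightarrow> P k) \<Longrightarrow> P (\<Union>K)"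
    and "\<And>U V h. openin (ztop X) U \<Longrightarrow> openin (ztop Y) V \<Longrightarrow> h \<in> tensor_funs X Y U V \<Longrightarrow>
           P {z \<in> U \<times> V. h z \<noteq> 0}"
  shows "P W"
  using assms(1) unfolding prod_fspace_def fspace.select_convs
proof (rule openin_generated_by_induct[where P = P])
  fix s assume "s \<in> {{z \<in> U \<times> V. h z \<noteq> 0} | U V h.
            openin (ztop X) U \<and> openin (ztop Y) V \<and> h \<in> tensor_funs X Y U V}"
  then obtain U V h where s: "s = {z \<in> U \<times> V. h z \<noteq> 0}" and "openin (ztop X) U"
    "openin (ztop Y) V" "h \<in> tensor_funs X Y U V" by (elim CollectE exE conjE)
  then show "P s" unfolding s by (intro assms(5))
next
  show "P {}" by (rule assms(2))
next
  fix a b assume "P a" "P b"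
  then show "P (a \<inter> b)" by (rule assms(3))
next
  fix K :: "('a \<times> 'b) set set" assume "\<And>k. k \<in> K \<Longrightarrow> P k"
  then show "P (\<Union>K)" by (rule assms(4))
qed

lemma pts_prod_fspace:
  assumes "function_algebras X" "function_algebras Y"
  shows "pts (prod_fspace X Y) = pts X \<times> pts Y"
proof
  show "pts (prod_fspace X Y) \<subseteq> pts X \<times> pts Y"
  proof (rule openin_prod_fspace_induct[where P = "\<lambda>W. W \<subseteq> pts X \<times> pts Y"])
    show "openin (ztop (prod_fspace X Y)) (pts (prod_fspace X Y))" by simp
  next
    fix U V and h :: "'a \<times> 'b \<Rightarrow> complex" assume "openin (ztop X) U" "openin (ztop Y) V"
    then have "U \<subseteq> pts X" "V \<subseteq> pts Y" by (auto dest: openin_subset)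
    then show "{z \<in> U \<times> V. h z \<noteq> 0} \<subseteq> pts X \<times> pts Y" by blast
  qed blast+
  show "pts X \<times> pts Y \<subseteq> pts (prod_fspace X Y)"
    by (rule openin_subset[OF openin_prod_fspace_Times[OF assms openin_topspace openin_topspace]])
qed

text \<open>
  Fixing \<open>y\<close> in \<open>\<Sum>\<^sub>i f\<^sub>i(x) g\<^sub>i(y)\<close> leaves a linear combination of regular functions of \<open>x\<close>. Slices
  replace continuity of maps into the product, whose topology is finer than the product topology.
\<close>

lemma openin_slice_fst:
  assumes X: "function_algebras X" and "openin (ztop (prod_fspace X Y)) W"
  shows "openin (ztop X) {x \<in> pts X. (x, y) \<in> W}"
  using assms(2)
proof (induction rule: openin_prod_fspace_induct)
  case empty then show ?case by simp
next
  case (inter a b)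
  have "{x \<in> pts X. (x, y) \<in> a \<inter> b} = {x \<in> pts X. (x, y) \<in> a} \<inter> {x \<in> pts X. (x, y) \<in> b}" by blast
  then show ?case using inter by auto
next
  case (union K)
  have "{x \<in> pts X. (x, y) \<in> \<Union>K} = \<Union>((\<lambda>k. {x \<in> pts X. (x, y) \<in> k}) ` K)" by blast
  then show ?case using union by (auto intro!: openin_Union)
next
  case (basis U V h)
  then have U: "openin (ztop X) U" and h: "h \<in> tensor_funs X Y U V" by auto
  define s where "s = {z \<in> U \<times> V. h z \<noteq> 0}"
  obtain m f g where fg: "\<And>i. i < m \<Longrightarrow> f i \<in> reg X U"
    "\<And>x y. h (x, y) = (\<Sum>i<(m::nat). f i x * g i y)" using tensor_funsE[OF h] by metis
  show ?case
  proof (cases "y \<in> V")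
    case True
    have "(\<lambda>x. h (x, y)) \<in> reg X U"
      unfolding fg(2) using fg(1) by (intro reg_sum[OF X U] reg_mult[OF X U] reg_const[OF X U]) auto
    from reg_nonvanishing_open[OF X U this] have "openin (ztop X) {x \<in> U. h (x, y) \<noteq> 0}" .
    moreover have "{x \<in> pts X. (x, y) \<in> s} = {x \<in> U. h (x, y) \<noteq> 0}"
      using True openin_subset[OF U] by (auto simp: s_def)
    ultimately show ?thesis unfolding s_def by (simp only:)
  next
    case False
    then have "{x \<in> pts X. (x, y) \<in> s} = {}" by (auto simp: s_def)
    then show ?thesis unfolding s_def by (simp only: openin_empty)
  qed
qed

lemma openin_slice_snd:
  assumes Y: "function_algebras Y" and "openin (ztop (prod_fspace X Y)) W"
  shows "openin (ztop Y) {y \<in> pts Y. (x, y) \<in> W}"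
  using assms(2)
proof (induction rule: openin_prod_fspace_induct)
  case empty then show ?case by simp
next
  case (inter a b)
  have "{y \<in> pts Y. (x, y) \<in> a \<inter> b} = {y \<in> pts Y. (x, y) \<in> a} \<inter> {y \<in> pts Y. (x, y) \<in> b}" by blast
  then show ?case using inter by auto
next
  case (union K)
  have "{y \<in> pts Y. (x, y) \<in> \<Union>K} = \<Union>((\<lambda>k. {y \<in> pts Y. (x, y) \<in> k}) ` K)" by blast
  then show ?case using union by (auto intro!: openin_Union)
next
  case (basis U V h)
  then have V: "openin (ztop Y) V" and h: "h \<in> tensor_funs X Y U V" by auto
  define s where "s = {z \<in> U \<times> V. h z \<noteq> 0}"
  obtain m f g where fg: "\<And>i. i < m \<Longrightarrow> g i \<in> reg Y V"
    "\<And>x y. h (x, y) = (\<Sum>i<(m::nat). f i x * g i y)" using tensor_funsE[OF h] by metis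
  show ?case
  proof (cases "x \<in> U")
    case True
    have "(\<lambda>y. h (x, y)) \<in> reg Y V"
      unfolding fg(2) using fg(1) by (intro reg_sum[OF Y V] reg_mult[OF Y V] reg_const[OF Y V]) auto
    from reg_nonvanishing_open[OF Y V this] have "openin (ztop Y) {y \<in> V. h (x, y) \<noteq> 0}" .
    moreover have "{y \<in> pts Y. (x, y) \<in> s} = {y \<in> V. h (x, y) \<noteq> 0}"
      using True openin_subset[OF V] by (auto simp: s_def)
    ultimately show ?thesis unfolding s_def by (simp only:)
  next
    case False
    then have "{y \<in> pts Y. (x, y) \<in> s} = {}" by (auto simp: s_def)
    then show ?thesis unfolding s_def by (simp only: openin_empty)
  qed
qed

text \<open>
  Regularity on a product in a form with open neighbourhoods \<open>N\<close> on which the denominator has no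
  zeros. It is local, so that pulling back along a morphism preserves it.
\<close>

definition locally_fraction ::
  "'a fspace \<Rightarrow> 'b fspace \<Rightarrow> ('a \<times> 'b) set \<Rightarrow> ('a \<times> 'b \<Rightarrow> complex) \<Rightarrow> bool" where
  "locally_fraction X Y W F \<longleftrightarrow>
     (\<forall>z\<in>W. \<exists>N U V. \<exists>h\<in>tensor_funs X Y U V. \<exists>k\<in>tensor_funs X Y U V.
        openin (ztop (prod_fspace X Y)) N \<and> z \<in> N \<and> N \<subseteq> W \<and>
        openin (ztop X) U \<and> openin (ztop Y) V \<and> N \<subseteq> U \<times> V \<and> (\<forall>w\<in>N. k w \<noteq> 0 \<and> F w = h w / k w))"

lemma locally_fractionE:
  assumes "locally_fraction X Y W F" "z \<in> W"
  obtains N U V h k where "h \<in> tensor_funs X Y U V" "k \<in> tensor_funs X Y U V"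
    "openin (ztop (prod_fspace X Y)) N" "z \<in> N" "N \<subseteq> W" "openin (ztop X) U" "openin (ztop Y) V"
    "N \<subseteq> U \<times> V" "\<forall>w\<in>N. k w \<noteq> 0 \<and> F w = h w / k w"
  using bspec[OF assms(1)[unfolded locally_fraction_def] assms(2)]
  by (elim exE bexE conjE) (rule that)

text \<open>
  This is what makes an identity that holds on a merely dense set hold everywhere.
\<close>

lemma locally_fraction_neq_open:
  assumes X: "function_algebras X" and Y: "function_algebras Y"
    and F: "locally_fraction X Y W F" and G: "locally_fraction X Y W' G"
  shows "openin (ztop (prod_fspace X Y)) {z \<in> W \<inter> W'. F z \<noteq> G z}"
  unfolding openin_subopen[of _ "{z \<in> W \<inter> W'. F z \<noteq> G z}"]
proof
  fix z assume z: "z \<in> {z \<in> W \<inter> W'. F z \<noteq> G z}"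
  then have zF: "z \<in> W" and zG: "z \<in> W'" by auto
  obtain N U V h k where 1: "h \<in> tensor_funs X Y U V" "k \<in> tensor_funs X Y U V"
    "openin (ztop (prod_fspace X Y)) N" "z \<in> N" "N \<subseteq> W" "openin (ztop X) U" "openin (ztop Y) V"
    "N \<subseteq> U \<times> V" "\<forall>w\<in>N. k w \<noteq> 0 \<and> F w = h w / k w"
    using locally_fractionE[OF F zF] .
  obtain N' U' V' h' k' where 2: "h' \<in> tensor_funs X Y U' V'" "k' \<in> tensor_funs X Y U' V'"
    "openin (ztop (prod_fspace X Y)) N'" "z \<in> N'" "N' \<subseteq> W'" "openin (ztop X) U'" "openin (ztop Y) V'"
    "N' \<subseteq> U' \<times> V'" "\<forall>w\<in>N'. k' w \<noteq> 0 \<and> G w = h' w / k' w"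
    using locally_fractionE[OF G zG] .
  let ?D = "{w \<in> (U \<inter> U') \<times> (V \<inter> V'). h w * k' w - h' w * k w \<noteq> 0}"
  have "openin (ztop (prod_fspace X Y)) ?D"
    using 1 2 by (intro openin_prod_fspace_basic tensor_funs_cross_difference[OF X Y]) auto
  then have "openin (ztop (prod_fspace X Y)) (N \<inter> N' \<inter> ?D)" using 1 2 by auto
  moreover have neq: "h w * k' w - h' w * k w \<noteq> 0 \<longleftrightarrow> F w \<noteq> G w" if "w \<in> N" "w \<in> N'" for w
    using bspec[OF 1(9) that(1)] bspec[OF 2(9) that(2)] by (auto simp: field_simps)
  then have "z \<in> N \<inter> N' \<inter> ?D" using z 1 2 by auto
  moreover have "N \<inter> N' \<inter> ?D \<subseteq> {z \<in> W \<inter> W'. F z \<noteq> G z}" using neq 1 2 by auto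
  ultimately show "\<exists>T. openin (ztop (prod_fspace X Y)) T \<and> z \<in> T \<and> T \<subseteq> {z \<in> W \<inter> W'. F z \<noteq> G z}"
    by blast
qed

lemma locally_fraction_tensor:
  assumes X: "function_algebras X" and Y: "function_algebras Y"
    and "openin (ztop X) U" "openin (ztop Y) V" "u \<in> reg X U" "v \<in> reg Y V"
    and F: "\<And>x y. x \<in> U \<Longrightarrow> y \<in> V \<Longrightarrow> F (x, y) = u x * v y"
  shows "locally_fraction X Y (U \<times> V) F"
proof -
  have "(\<lambda>(x, y). u x * v y) \<in> tensor_funs X Y U V"
    by (rule tensor_funs_single[OF assms(5,6)])
  moreover have "(\<lambda>(x, y). 1 * 1) \<in> tensor_funs X Y U V"
    by (rule tensor_funs_single[OF reg_const[OF assms(1,3)] reg_const[OF assms(2,4)]])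
  moreover have "openin (ztop (prod_fspace X Y)) (U \<times> V)"
    using assms by (intro openin_prod_fspace_Times)
  ultimately show ?thesis
    unfolding locally_fraction_def using assms
    by (intro ballI exI[of _ "U \<times> V"] exI[of _ U] exI[of _ V] bexI[of _ "\<lambda>(x, y). u x * v y"]
        bexI[of _ "\<lambda>(x, y). 1 * 1"]) auto
qed

section \<open>Filtered spaces and their products\<close>

text \<open>
  The part of being an ind-variety that also holds for the constant filtration of the punctured
  line.
\<close>

definition ind_system :: "'a indspace \<Rightarrow> bool" where
  "ind_system X \<longleftrightarrow> (\<forall>n. function_algebras (X n) \<and> pts (X n) \<subseteq> pts (X (Suc n)) \<and>
     (\<forall>U. openin (ztop (X (Suc n))) U \<longrightarrow> openin (ztop (X n)) (U \<inter> pts (X n))))"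

lemma ind_variety_ind_system:
  assumes "ind_variety X" shows "ind_system X"
  unfolding ind_system_def
proof (intro allI conjI impI)
  fix n
  show "function_algebras (X n)"
    using assms by (auto simp: ind_variety_def variety_def intro: function_algebras_space_with_functions)
  have cl: "closed_embedded (X n) (X (Suc n))" using assms by (auto simp: ind_variety_def)
  show "pts (X n) \<subseteq> pts (X (Suc n))"
    using cl closedin_subset by (auto simp: closed_embedded_def)
  fix U assume "openin (ztop (X (Suc n))) U"
  then have "openin (ztop (sub_fspace (X (Suc n)) (pts (X n)))) (U \<inter> pts (X n))"
    by (auto simp: sub_fspace_def openin_subtopology)
  then show "openin (ztop (X n)) (U \<inter> pts (X n))" using cl unfolding closed_embedded_def by metis
qed

lemma ind_system_function_algebras: "ind_system X \<Longrightarrow> function_algebras (X n)"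
  by (simp add: ind_system_def)

lemma ind_system_mono:
  assumes X: "ind_system X" and "n \<le> m"
  shows "pts (X n) \<subseteq> pts (X m)" "openin (ztop (X m)) U \<Longrightarrow> openin (ztop (X n)) (U \<inter> pts (X n))"
proof -
  have "pts (X n) \<subseteq> pts (X m) \<and> (\<forall>U. openin (ztop (X m)) U \<longrightarrow> openin (ztop (X n)) (U \<inter> pts (X n)))"
    using assms(2)
  proof (induction m rule: dec_induct)
    case base then show ?case by (auto intro: openin_Int)
  next
    case (step m)
    have S: "pts (X m) \<subseteq> pts (X (Suc m))"
      "\<And>U. openin (ztop (X (Suc m))) U \<Longrightarrow> openin (ztop (X m)) (U \<inter> pts (X m))"
      using X by (auto simp: ind_system_def)
    have "openin (ztop (X n)) (U \<inter> pts (X n))" if "openin (ztop (X (Suc m))) U" for U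
    proof -
      have "openin (ztop (X n)) ((U \<inter> pts (X m)) \<inter> pts (X n))" using S(2)[OF that] step by blast
      moreover have "(U \<inter> pts (X m)) \<inter> pts (X n) = U \<inter> pts (X n)" using step by blast
      ultimately show ?thesis by simp
    qed
    then show ?case using S step by blast
  qed
  then show "pts (X n) \<subseteq> pts (X m)" "openin (ztop (X m)) U \<Longrightarrow> openin (ztop (X n)) (U \<inter> pts (X n))"
    by auto
qed

lemma topspace_itop: "topspace (itop X) = ipts X"
proof
  show "topspace (itop X) \<subseteq> ipts X"
    using openin_topspace[of "itop X"] unfolding openin_itop by blast
  have "ipts X \<inter> pts (X n) = pts (X n)" for n by (auto simp: ipts_def)
  then have "openin (itop X) (ipts X)" unfolding openin_itop by simp
  then show "ipts X \<subseteq> topspace (itop X)" by (rule openin_subset)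
qed

lemma pts_iprod:
  assumes "ind_system X" "ind_system Y"
  shows "pts ((X \<times>\<^sub>I Y) n) = pts (X n) \<times> pts (Y n)"
  using assms by (simp add: iprod_def pts_prod_fspace ind_system_function_algebras)

lemma ipts_iprod:
  assumes X: "ind_system X" and Y: "ind_system Y"
  shows "ipts (X \<times>\<^sub>I Y) = ipts X \<times> ipts Y"
proof -
  have "(x, y) \<in> (\<Union>n. pts (X n) \<times> pts (Y n))" if "x \<in> pts (X n)" "y \<in> pts (Y m)" for x y n m
    using that ind_system_mono(1)[OF X, of n "max n m"] ind_system_mono(1)[OF Y, of m "max n m"] by auto
  then show ?thesis unfolding ipts_def pts_iprod[OF X Y] by auto
qed

lemma openin_iprod_Times:
  assumes X: "ind_system X" and Y: "ind_system Y" and U: "openin (itop X) U" and V: "openin (itop Y) V"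
  shows "openin (itop (X \<times>\<^sub>I Y)) (U \<times> V)"
  unfolding openin_itop
proof (intro conjI allI)
  show "U \<times> V \<subseteq> ipts (X \<times>\<^sub>I Y)" using U V by (auto simp: ipts_iprod[OF X Y] openin_itop)
  fix n
  have "openin (ztop (prod_fspace (X n) (Y n))) ((U \<inter> pts (X n)) \<times> (V \<inter> pts (Y n)))"
    using U V X Y by (intro openin_prod_fspace_Times) (auto simp: openin_itop ind_system_function_algebras)
  moreover have "(U \<inter> pts (X n)) \<times> (V \<inter> pts (Y n)) = U \<times> V \<inter> pts ((X \<times>\<^sub>I Y) n)"
    unfolding pts_iprod[OF X Y] by blast
  ultimately show "openin (ztop ((X \<times>\<^sub>I Y) n)) (U \<times> V \<inter> pts ((X \<times>\<^sub>I Y) n))" by (simp add: iprod_def)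
qed

text \<open>
  The point \<open>y\<close> need not lie in level \<open>n\<close>, so the slice is formed at a level \<open>m \<ge> n\<close> that contains \<open>y\<close> and is
  then cut down to level \<open>n\<close>.
\<close>

lemma openin_iprod_slice_fst:
  assumes X: "ind_system X" and Y: "ind_system Y" and W: "openin (itop (X \<times>\<^sub>I Y)) W"
  shows "openin (itop X) {x. (x, y) \<in> W}"
  unfolding openin_itop
proof (intro conjI allI)
  have sub: "W \<subseteq> ipts X \<times> ipts Y" using W by (simp add: openin_itop ipts_iprod[OF X Y])
  then show "{x. (x, y) \<in> W} \<subseteq> ipts X" by auto
  fix n
  show "openin (ztop (X n)) ({x. (x, y) \<in> W} \<inter> pts (X n))"
  proof (cases "y \<in> ipts Y")
    case True
    then obtain l where l: "y \<in> pts (Y l)" by (auto simp: ipts_def)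
    define m where "m = max n l"
    have ym: "y \<in> pts (Y m)" using l ind_system_mono(1)[OF Y, of l m] by (auto simp: m_def)
    have "openin (ztop (prod_fspace (X m) (Y m))) (W \<inter> pts ((X \<times>\<^sub>I Y) m))"
      using W by (simp add: openin_itop iprod_def)
    from openin_slice_fst[OF ind_system_function_algebras[OF X] this, of y]
    have "openin (ztop (X m)) {x \<in> pts (X m). (x, y) \<in> W}"
      using ym unfolding pts_iprod[OF X Y] by (simp add: conj_commute cong: conj_cong)
    then have "openin (ztop (X n)) ({x \<in> pts (X m). (x, y) \<in> W} \<inter> pts (X n))"
      by (rule ind_system_mono(2)[OF X, rotated]) (simp add: m_def)
    moreover have "{x \<in> pts (X m). (x, y) \<in> W} \<inter> pts (X n) = {x. (x, y) \<in> W} \<inter> pts (X n)"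
      using ind_system_mono(1)[OF X, of n m] by (auto simp: m_def)
    ultimately show ?thesis by simp
  next
    case False
    then have "{x. (x, y) \<in> W} = {}" using sub by auto
    then show ?thesis by simp
  qed
qed

lemma openin_iprod_slice_snd:
  assumes X: "ind_system X" and Y: "ind_system Y" and W: "openin (itop (X \<times>\<^sub>I Y)) W"
  shows "openin (itop Y) {y. (x, y) \<in> W}"
  unfolding openin_itop
proof (intro conjI allI)
  have sub: "W \<subseteq> ipts X \<times> ipts Y" using W by (simp add: openin_itop ipts_iprod[OF X Y])
  then show "{y. (x, y) \<in> W} \<subseteq> ipts Y" by auto
  fix n
  show "openin (ztop (Y n)) ({y. (x, y) \<in> W} \<inter> pts (Y n))"
  proof (cases "x \<in> ipts X")
    case True
    then obtain l where l: "x \<in> pts (X l)" by (auto simp: ipts_def)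
    define m where "m = max n l"
    have xm: "x \<in> pts (X m)" using l ind_system_mono(1)[OF X, of l m] by (auto simp: m_def)
    have "openin (ztop (prod_fspace (X m) (Y m))) (W \<inter> pts ((X \<times>\<^sub>I Y) m))"
      using W by (simp add: openin_itop iprod_def)
    from openin_slice_snd[OF ind_system_function_algebras[OF Y] this, of x]
    have "openin (ztop (Y m)) {y \<in> pts (Y m). (x, y) \<in> W}"
      using xm unfolding pts_iprod[OF X Y] by (simp add: conj_commute cong: conj_cong)
    then have "openin (ztop (Y n)) ({y \<in> pts (Y m). (x, y) \<in> W} \<inter> pts (Y n))"
      by (rule ind_system_mono(2)[OF Y, rotated]) (simp add: m_def)
    moreover have "{y \<in> pts (Y m). (x, y) \<in> W} \<inter> pts (Y n) = {y. (x, y) \<in> W} \<inter> pts (Y n)"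
      using ind_system_mono(1)[OF Y, of n m] by (auto simp: m_def)
    ultimately show ?thesis by simp
  next
    case False
    then have "{y. (x, y) \<in> W} = {}" using sub by auto
    then show ?thesis by simp
  qed
qed

section \<open>Dense open sets\<close>

lemma dense_open_iff:
  "dense_open T U \<longleftrightarrow> openin T U \<and> (\<forall>V. openin T V \<and> V \<noteq> {} \<longrightarrow> V \<inter> U \<noteq> {})"
  unfolding dense_open_def dense_intersects_open by (simp add: Int_commute)

lemma dense_openD:
  assumes "dense_open T U"
  shows "openin T U" "openin T V \<Longrightarrow> V \<noteq> {} \<Longrightarrow> V \<inter> U \<noteq> {}"
  using assms unfolding dense_open_iff by blast+

lemma dense_open_topspace: "dense_open T (topspace T)"
  unfolding dense_open_def by simp

lemma dense_open_Int:
  assumes "dense_open T U" "dense_open T V"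
  shows "dense_open T (U \<inter> V)"
  unfolding dense_open_iff
proof (intro conjI allI impI)
  show "openin T (U \<inter> V)" using assms by (simp add: dense_openD openin_Int)
  fix W assume W: "openin T W \<and> W \<noteq> {}"
  then have "openin T (W \<inter> U)" "W \<inter> U \<noteq> {}" using dense_openD[OF assms(1)] by (simp_all add: openin_Int)
  from dense_openD(2)[OF assms(2) this] show "W \<inter> (U \<inter> V) \<noteq> {}" by blast
qed

lemma dense_open_superset:
  assumes "dense_open T U" "U \<subseteq> V" "openin T V"
  shows "dense_open T V"
  using assms unfolding dense_open_iff by blast

text \<open>
  Move the first coordinate into \<open>U\<close> along a slice, then the second one into \<open>V\<close>.
\<close>

lemma dense_open_iprod_Times:
  assumes X: "ind_system X" and Y: "ind_system Y"
    and U: "dense_open (itop X) U" and V: "dense_open (itop Y) V"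
  shows "dense_open (itop (X \<times>\<^sub>I Y)) (U \<times> V)"
  unfolding dense_open_iff
proof (intro conjI allI impI)
  show "openin (itop (X \<times>\<^sub>I Y)) (U \<times> V)"
    using U V by (intro openin_iprod_Times[OF X Y]) (auto simp: dense_open_iff)
  fix W assume W: "openin (itop (X \<times>\<^sub>I Y)) W \<and> W \<noteq> {}"
  then obtain x y where "(x, y) \<in> W" by auto
  then have "{x. (x, y) \<in> W} \<noteq> {}" by blast
  from dense_openD(2)[OF U openin_iprod_slice_fst[OF X Y] this] W
  obtain x' where x': "x' \<in> U" "(x', y) \<in> W" by blast
  then have "{y. (x', y) \<in> W} \<noteq> {}" by blast
  from dense_openD(2)[OF V openin_iprod_slice_snd[OF X Y] this] W
  obtain y' where "y' \<in> V" "(x', y') \<in> W" by blast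
  then show "W \<inter> U \<times> V \<noteq> {}" using x' by blast
qed

lemma dense_open_projection:
  assumes X: "ind_system X" and Y: "ind_system Y" and W: "dense_open (itop (X \<times>\<^sub>I Y)) W"
    and ne: "ipts X \<noteq> {}"
  shows "dense_open (itop Y) {y. \<exists>x. (x, y) \<in> W}"
  unfolding dense_open_iff
proof (intro conjI allI impI)
  have "{y. \<exists>x. (x, y) \<in> W} = (\<Union>x. {y. (x, y) \<in> W})" by blast
  then show "openin (itop Y) {y. \<exists>x. (x, y) \<in> W}"
    using openin_iprod_slice_snd[OF X Y dense_openD(1)[OF W]] by auto
  fix V assume V: "openin (itop Y) V \<and> V \<noteq> {}"
  have "openin (itop (X \<times>\<^sub>I Y)) (ipts X \<times> V)"
    using V openin_topspace[of "itop X"] by (intro openin_iprod_Times[OF X Y]) (auto simp: topspace_itop)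
  moreover have "ipts X \<times> V \<noteq> {}" using V ne by auto
  ultimately show "V \<inter> {y. \<exists>x. (x, y) \<in> W} \<noteq> {}" using dense_openD(2)[OF W] by blast
qed

section \<open>The punctured line\<close>

lemma pts_Gm: "pts Gm = {z. z \<noteq> 0}"
proof -
  have "{z. z \<noteq> 0 \<and> poly (1::complex poly) z \<noteq> 0} = {z. z \<noteq> 0}" by simp
  then show ?thesis unfolding Gm_def by (auto intro!: exI[of _ "{z. z \<noteq> 0 \<and> poly (1::complex poly) z \<noteq> 0}"])
qed

lemma openin_Gm_basic: "openin (ztop Gm) {z. z \<noteq> 0 \<and> poly p z \<noteq> 0}"
  unfolding Gm_def fspace.select_convs by (rule topology_generated_by_Basis) blast

text \<open>
  Nonzero polynomials have finitely many roots. Any two nonempty open subsets of the punctured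
  line therefore meet, which is used again and again below.
\<close>

lemma openin_Gm_cofinite:
  assumes "openin (ztop Gm) U"
  shows "U = {} \<or> finite (- U)"
  using assms unfolding Gm_def fspace.select_convs
proof (rule openin_generated_by_induct[where P = "\<lambda>U. U = {} \<or> finite (- U)"])
  fix s :: "complex set" assume "s \<in> {{z. z \<noteq> 0 \<and> poly p z \<noteq> 0} | p. True}"
  then obtain p where s: "s = {z. z \<noteq> 0 \<and> poly p z \<noteq> 0}" by blast
  show "s = {} \<or> finite (- s)"
  proof (cases "p = 0")
    case False
    have "- s \<subseteq> insert 0 {z. poly p z = 0}" using s by auto
    then show ?thesis using poly_roots_finite[OF False] finite_subset by blast
  qed (use s in auto)
next
  fix K :: "complex set set" assume K: "\<And>k. k \<in> K \<Longrightarrow> k = {} \<or> finite (- k)"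
  show "\<Union>K = {} \<or> finite (- \<Union>K)"
  proof (cases "\<exists>k\<in>K. k \<noteq> {}")
    case True
    then obtain k where "k \<in> K" "k \<noteq> {}" by blast
    then have "finite (- k)" "- \<Union>K \<subseteq> - k" using K by blast+
    then show ?thesis using finite_subset by blast
  qed blast
qed (auto simp: Compl_Int)

lemma reg_Gm_iff: "f \<in> reg Gm V \<longleftrightarrow>
   (\<forall>z\<in>V. \<exists>p q. poly q z \<noteq> 0 \<and> (\<forall>w\<in>V. poly q w \<noteq> 0 \<longrightarrow> f w = poly p w / poly q w))"
  by (simp add: Gm_def)

lemma function_algebras_Gm: "function_algebras Gm"
  unfolding function_algebras_def
proof (intro conjI allI impI; (elim conjE)?)
  show "(\<lambda>_. c) \<in> reg Gm U" for U c
    unfolding reg_Gm_iff by (intro ballI exI[of _ "[:c:]"] exI[of _ 1]) simp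
next
  fix U f g assume fg: "f \<in> reg Gm U" "g \<in> reg Gm U"
  show "(\<lambda>x. f x + g x) \<in> reg Gm U" unfolding reg_Gm_iff
  proof
    fix z assume "z \<in> U"
    then obtain p q p' q' where "poly q z \<noteq> 0" "\<forall>w\<in>U. poly q w \<noteq> 0 \<longrightarrow> f w = poly p w / poly q w"
      "poly q' z \<noteq> 0" "\<forall>w\<in>U. poly q' w \<noteq> 0 \<longrightarrow> g w = poly p' w / poly q' w"
      using fg unfolding reg_Gm_iff by meson
    then show "\<exists>p q. poly q z \<noteq> 0 \<and> (\<forall>w\<in>U. poly q w \<noteq> 0 \<longrightarrow> f w + g w = poly p w / poly q w)"
      by (intro exI[of _ "p * q' + p' * q"] exI[of _ "q * q'"]) (auto simp: field_simps)
  qed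
  show "(\<lambda>x. f x * g x) \<in> reg Gm U" unfolding reg_Gm_iff
  proof
    fix z assume "z \<in> U"
    then obtain p q p' q' where "poly q z \<noteq> 0" "\<forall>w\<in>U. poly q w \<noteq> 0 \<longrightarrow> f w = poly p w / poly q w"
      "poly q' z \<noteq> 0" "\<forall>w\<in>U. poly q' w \<noteq> 0 \<longrightarrow> g w = poly p' w / poly q' w"
      using fg unfolding reg_Gm_iff by meson
    then show "\<exists>p q. poly q z \<noteq> 0 \<and> (\<forall>w\<in>U. poly q w \<noteq> 0 \<longrightarrow> f w * g w = poly p w / poly q w)"
      by (intro exI[of _ "p * p'"] exI[of _ "q * q'"]) auto
  qed
next
  fix U V f assume "V \<subseteq> U" "f \<in> reg Gm U"
  then show "f \<in> reg Gm V" unfolding reg_Gm_iff by (meson subsetD)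
next
  fix U f assume U: "openin (ztop Gm) U" and f: "f \<in> reg Gm U"
  show "openin (ztop Gm) {x \<in> U. f x \<noteq> 0}"
    unfolding openin_subopen[of _ "{x \<in> U. f x \<noteq> 0}"]
  proof
    fix z assume z: "z \<in> {x \<in> U. f x \<noteq> 0}"
    then obtain p q where pq: "poly q z \<noteq> 0" "\<forall>w\<in>U. poly q w \<noteq> 0 \<longrightarrow> f w = poly p w / poly q w"
      using f unfolding reg_Gm_iff by blast
    let ?T = "U \<inter> {w. w \<noteq> 0 \<and> poly (p * q) w \<noteq> 0}"
    have "openin (ztop Gm) ?T" using U openin_Gm_basic by blast
    moreover have "z \<in> ?T" using z pq openin_subset[OF U] by (auto simp: pts_Gm)
    moreover have "?T \<subseteq> {x \<in> U. f x \<noteq> 0}" using pq by auto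
    ultimately show "\<exists>T. openin (ztop Gm) T \<and> z \<in> T \<and> T \<subseteq> {x \<in> U. f x \<noteq> 0}" by blast
  qed
qed

lemma inverse_reg_Gm: "inverse \<in> reg Gm (pts Gm)"
  unfolding reg_Gm_iff
  by (intro ballI exI[of _ 1] exI[of _ "[:0, 1:]"]) (auto simp: pts_Gm inverse_eq_divide)

lemma ind_system_Gm: "ind_system \<G>"
  unfolding ind_system_def Gm_ind_def using function_algebras_Gm by (auto intro: openin_Int)

lemma ipts_Gm: "ipts \<G> = {z. z \<noteq> 0}"
  by (simp add: ipts_def Gm_ind_def pts_Gm)

lemma openin_itop_Gm_cofinite:
  assumes "openin (itop \<G>) U" shows "U = {} \<or> finite (- U)"
proof -
  have "U \<inter> pts Gm = U" using assms by (auto simp: openin_itop Gm_ind_def ipts_def)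
  then have "openin (ztop Gm) U" using assms by (auto simp: openin_itop Gm_ind_def)
  then show ?thesis by (rule openin_Gm_cofinite)
qed

lemma openin_itop_Gm_meet:
  assumes "openin (itop \<G>) U" "U \<noteq> {}" "finite (- V)"
  shows "U \<inter> V \<noteq> {}"
proof
  assume "U \<inter> V = {}"
  then have "UNIV = - U \<union> - V" by blast
  moreover have "finite (- U)" using openin_itop_Gm_cofinite assms by blast
  ultimately have "finite (UNIV :: complex set)" using assms(3) by (metis finite_UnI)
  then show False by (simp add: infinite_UNIV_char_0)
qed

text \<open>
  Density of a set that is cofinite in the fibre over every point of a dense open set. The set
  itself is not supposed to be open.
\<close>

lemma meets_fibrewise_cofinite:
  assumes Z: "ind_system Z" and W: "openin (itop (\<G> \<times>\<^sub>I Z)) W" "W \<noteq> {}"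
    and B: "dense_open (itop Z) B" and fin: "\<And>z. z \<in> B \<Longrightarrow> finite {c. c \<noteq> 0 \<and> \<not> P c z}"
  obtains c z where "(c, z) \<in> W" "z \<in> B" "P c z"
proof -
  note G = ind_system_Gm
  obtain c z where "(c, z) \<in> W" using W(2) by auto
  then have "{z. (c, z) \<in> W} \<noteq> {}" by blast
  from dense_openD(2)[OF B openin_iprod_slice_snd[OF G Z W(1)] this]
  obtain z where z: "z \<in> B" "(c, z) \<in> W" by blast
  have "- {c. c \<noteq> 0 \<and> P c z} \<subseteq> insert 0 {c. c \<noteq> 0 \<and> \<not> P c z}" by blast
  then have "finite (- {c. c \<noteq> 0 \<and> P c z})" using fin[OF z(1)] finite_subset by blast
  moreover have "{c. (c, z) \<in> W} \<noteq> {}" using z by blast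
  ultimately have "{c. (c, z) \<in> W} \<inter> {c. c \<noteq> 0 \<and> P c z} \<noteq> {}"
    using openin_itop_Gm_meet[OF openin_iprod_slice_fst[OF G Z W(1)]] by blast
  then show thesis using that z by blast
qed

section \<open>Arithmetic of rational functions\<close>

text \<open>
  Rational functions without the density of the domain. Regularity is easily seen to survive the
  partial operations, whereas density is settled once, at the end, by exhibiting a dense open set
  inside the domain. The domain is intersected with the space because functions such as \<open>f \<circ> fst\<close>
  are defined outside the product.
\<close>

definition regular_partial :: "'a indspace \<Rightarrow> ('a \<rightharpoonup> complex) \<Rightarrow> bool" where
  "regular_partial X f \<longleftrightarrow>
     openin (itop X) (dom f \<inter> ipts X) \<and> (\<forall>n. (\<lambda>x. the (f x)) \<in> reg (X n) (dom f \<inter> pts (X n)))"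

definition space_system :: "'a indspace \<Rightarrow> bool" where
  "space_system X \<longleftrightarrow> ind_system X \<and> (\<forall>n. space_with_functions (X n))"

lemma ind_variety_space_system: "ind_variety X \<Longrightarrow> space_system X"
  by (auto simp: space_system_def ind_variety_def variety_def intro!: ind_variety_ind_system[unfolded ind_variety_def variety_def])

lemma reg_cong:
  assumes "space_with_functions X" "openin (ztop X) U" "f \<in> reg X U" "\<And>x. x \<in> U \<Longrightarrow> f x = g x"
  shows "g \<in> reg X U"
  using assms(1)[unfolded space_with_functions_def, THEN conjunct1, rule_format, of U f g] assms by simp

lemma regular_partial_open:
  assumes "regular_partial X f"
  shows "openin (ztop (X n)) (dom f \<inter> pts (X n))"
proof -
  have "dom f \<inter> ipts X \<inter> pts (X n) = dom f \<inter> pts (X n)" by (auto simp: ipts_def)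
  then show ?thesis using assms by (metis regular_partial_def openin_itop)
qed

lemma rational_function_regular_partial:
  assumes "rational_function X f" shows "regular_partial X f"
proof -
  have "dom f \<subseteq> ipts X"
    using assms by (auto simp: rational_function_def dense_open_def openin_itop)
  then have "dom f \<inter> ipts X = dom f" by blast
  then show ?thesis using assms by (simp add: regular_partial_def rational_function_def dense_open_def)
qed

lemma rational_functionI:
  assumes "regular_partial X f" "dom f \<subseteq> ipts X" "dense_open (itop X) B" "B \<subseteq> dom f"
  shows "rational_function X f"
proof -
  have "dom f \<inter> ipts X = dom f" using assms(2) by blast
  then show ?thesis
    using assms unfolding rational_function_def regular_partial_def
    by (auto intro: dense_open_superset)
qed

lemma regular_partial_const:
  assumes "space_system X" shows "regular_partial X (\<lambda>_. Some c)"
proof -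
  have "openin (itop X) (ipts X)" using openin_topspace[of "itop X"] by (simp add: topspace_itop)
  moreover have "dom (\<lambda>_. Some c) = UNIV" by auto
  ultimately show ?thesis
    using assms by (auto simp: regular_partial_def space_system_def ind_system_def intro: reg_const)
qed

text \<open>
  The common pattern of sums and products: restrict both arguments to the intersection of their
  domains, and combine there.
\<close>

lemma regular_partial_combine:
  assumes X: "space_system X" and f: "regular_partial X f" and g: "regular_partial X g"
    and dom: "dom h = dom f \<inter> dom g"
    and reg: "\<And>n U. openin (ztop (X n)) U \<Longrightarrow> (\<lambda>x. the (f x)) \<in> reg (X n) U \<Longrightarrow>
        (\<lambda>x. the (g x)) \<in> reg (X n) U \<Longrightarrow> k \<in> reg (X n) U"
    and val: "\<And>x. x \<in> dom h \<Longrightarrow> the (h x) = k x"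
  shows "regular_partial X h"
  unfolding regular_partial_def
proof (intro conjI allI)
  have "dom h \<inter> ipts X = (dom f \<inter> ipts X) \<inter> (dom g \<inter> ipts X)" using dom by blast
  then show "openin (itop X) (dom h \<inter> ipts X)"
    using f g by (simp add: regular_partial_def openin_Int)
  fix n
  have F: "function_algebras (X n)" and S: "space_with_functions (X n)"
    using X by (auto simp: space_system_def ind_system_def)
  have eq: "dom h \<inter> pts (X n) = (dom f \<inter> pts (X n)) \<inter> (dom g \<inter> pts (X n))" using dom by blast
  then have O: "openin (ztop (X n)) (dom h \<inter> pts (X n))"
    using regular_partial_open[OF f] regular_partial_open[OF g] by (simp add: openin_Int)
  have "k \<in> reg (X n) (dom h \<inter> pts (X n))"
  proof (rule reg[OF O])
    show "(\<lambda>x. the (f x)) \<in> reg (X n) (dom h \<inter> pts (X n))"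
      using f by (intro reg_mono[OF F regular_partial_open[OF f] O]) (auto simp: dom regular_partial_def)
    show "(\<lambda>x. the (g x)) \<in> reg (X n) (dom h \<inter> pts (X n))"
      using g by (intro reg_mono[OF F regular_partial_open[OF g] O]) (auto simp: dom regular_partial_def)
  qed
  then show "(\<lambda>x. the (h x)) \<in> reg (X n) (dom h \<inter> pts (X n))"
    by (rule reg_cong[OF S O]) (simp add: val)
qed

lemma dom_rmul: "dom (f *\<^sub>r g) = dom f \<inter> dom g"
  by (auto simp: rmul_def bind_eq_Some_conv)

lemma the_rmul: "x \<in> dom (f *\<^sub>r g) \<Longrightarrow> the ((f *\<^sub>r g) x) = the (f x) * the (g x)"
  by (auto simp: rmul_def bind_eq_Some_conv)

lemma dom_rdiv: "dom (f /\<^sub>r g) = {x \<in> dom f \<inter> dom g. the (g x) \<noteq> 0}"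
  by (auto simp: rdiv_def pdiv_def bind_eq_Some_conv split: if_splits)

lemma the_rdiv: "x \<in> dom (f /\<^sub>r g) \<Longrightarrow> the ((f /\<^sub>r g) x) = the (f x) / the (g x)"
  by (auto simp: rdiv_def pdiv_def bind_eq_Some_conv split: if_splits)

lemma regular_partial_rmul:
  assumes "space_system X" "regular_partial X f" "regular_partial X g"
  shows "regular_partial X (f *\<^sub>r g)"
  using assms
  by (rule regular_partial_combine[where k = "\<lambda>x. the (f x) * the (g x)"])
    (use assms in \<open>auto simp: dom_rmul the_rmul space_system_def ind_system_def intro: reg_mult\<close>)

lemma regular_partial_reciprocal:
  assumes X: "space_system X" and g: "regular_partial X g"
  shows "regular_partial X ((\<lambda>_. Some 1) /\<^sub>r g)"
  unfolding regular_partial_def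
proof (intro conjI allI)
  let ?h = "(\<lambda>_. Some 1) /\<^sub>r g"
  have dom: "dom ?h = {x \<in> dom g. the (g x) \<noteq> 0}" by (auto simp: dom_rdiv)
  have S: "space_with_functions (X n)" for n using X by (auto simp: space_system_def)
  have D: "dom ?h \<inter> pts (X n) = {x \<in> dom g \<inter> pts (X n). the (g x) \<noteq> 0}" for n
    unfolding dom by blast
  have R: "openin (ztop (X n)) (dom ?h \<inter> pts (X n)) \<and>
      (\<lambda>x. 1 / the (g x)) \<in> reg (X n) (dom ?h \<inter> pts (X n))" for n
    unfolding D using S[of n, unfolded space_with_functions_def, THEN conjunct2, THEN conjunct2,
      THEN conjunct2, THEN conjunct2, THEN conjunct2, rule_format, of "dom g \<inter> pts (X n)" "\<lambda>x. the (g x)"]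
      g regular_partial_open[OF g] by (simp add: regular_partial_def)
  have "dom ?h \<inter> ipts X \<inter> pts (X n) = dom ?h \<inter> pts (X n)" for n by (auto simp: ipts_def)
  then show "openin (itop X) (dom ?h \<inter> ipts X)" using R unfolding openin_itop by simp
  fix n
  show "(\<lambda>x. the (?h x)) \<in> reg (X n) (dom ?h \<inter> pts (X n))"
    by (rule reg_cong[OF S]) (use R[of n] in \<open>auto simp: the_rdiv\<close>)
qed

lemma regular_partial_rdiv:
  assumes X: "space_system X" and f: "regular_partial X f" and g: "regular_partial X g"
  shows "regular_partial X (f /\<^sub>r g)"
proof -
  have "f /\<^sub>r g = f *\<^sub>r ((\<lambda>_. Some 1) /\<^sub>r g)"
    by (auto simp: fun_eq_iff rdiv_def rmul_def pdiv_def split: option.splits bind_splits if_splits)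
  then show ?thesis
    using regular_partial_rmul[OF X f regular_partial_reciprocal[OF X g]] by simp
qed

lemma dom_rsum: "dom (rsum F K) = (\<Inter>k\<in>K. dom (F k))"
  by (auto simp: rsum_def split: if_splits)

lemma dom_rprod: "dom (rprod F K) = (\<Inter>k\<in>K. dom (F k))"
  by (auto simp: rprod_def split: if_splits)

lemma the_rsum: "x \<in> dom (rsum F K) \<Longrightarrow> the (rsum F K x) = (\<Sum>k\<in>K. the (F k x))"
  by (auto simp: rsum_def split: if_splits)

lemma the_rprod: "x \<in> dom (rprod F K) \<Longrightarrow> the (rprod F K x) = (\<Prod>k\<in>K. the (F k x))"
  by (auto simp: rprod_def split: if_splits)

lemma regular_partial_rsum:
  assumes X: "space_system X" and "finite K" "\<And>k. k \<in> K \<Longrightarrow> regular_partial X (F k)"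
  shows "regular_partial X (rsum F K)"
  using assms(2,3)
proof (induction K)
  case empty
  then show ?case using regular_partial_const[OF X, of 0] by (simp add: rsum_def)
next
  case (insert a K)
  show ?case
  proof (rule regular_partial_combine[OF X, where f = "F a" and g = "rsum F K" and
        k = "\<lambda>x. the (F a x) + the (rsum F K x)"])
    show "(\<lambda>x. the (F a x) + the (rsum F K x)) \<in> reg (X n) U"
      if "openin (ztop (X n)) U" "(\<lambda>x. the (F a x)) \<in> reg (X n) U" "(\<lambda>x. the (rsum F K x)) \<in> reg (X n) U"
      for n U using that X by (intro reg_add) (auto simp: space_system_def ind_system_def)
  qed (use insert in \<open>simp_all add: dom_rsum the_rsum\<close>)
qed

lemma regular_partial_rprod:
  assumes X: "space_system X" and "finite K" "\<And>k. k \<in> K \<Longrightarrow> regular_partial X (F k)"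
  shows "regular_partial X (rprod F K)"
  using assms(2,3)
proof (induction K)
  case empty
  then show ?case using regular_partial_const[OF X, of 1] by (simp add: rprod_def)
next
  case (insert a K)
  show ?case
  proof (rule regular_partial_combine[OF X, where f = "F a" and g = "rprod F K" and
        k = "\<lambda>x. the (F a x) * the (rprod F K x)"])
    show "(\<lambda>x. the (F a x) * the (rprod F K x)) \<in> reg (X n) U"
      if "openin (ztop (X n)) U" "(\<lambda>x. the (F a x)) \<in> reg (X n) U" "(\<lambda>x. the (rprod F K x)) \<in> reg (X n) U"
      for n U using that X by (intro reg_mult) (auto simp: space_system_def ind_system_def)
  qed (use insert in \<open>simp_all add: dom_rprod the_rprod\<close>)
qed

lemma tensor_funs_reg_prod:
  assumes X: "function_algebras X" and Y: "function_algebras Y"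
    and U: "openin (ztop X) U" and V: "openin (ztop Y) V" and f: "f \<in> reg X U" and g: "g \<in> reg Y V"
  shows "(\<lambda>(x, y). f x * g y) \<in> reg (prod_fspace X Y) (U \<times> V)"
proof -
  have "(\<lambda>(x, y). f x * g y) \<in> tensor_funs X Y U V" by (rule tensor_funs_single[OF f g])
  moreover have "(\<lambda>(x, y). 1 * 1) \<in> tensor_funs X Y U V"
    by (rule tensor_funs_single[OF reg_const[OF X U] reg_const[OF Y V]])
  ultimately show ?thesis
    unfolding prod_fspace_def fspace.select_convs mem_Collect_eq using U V
    by (intro ballI exI[of _ U] exI[of _ V] bexI[of _ "\<lambda>(x, y). f x * g y"] bexI[of _ "\<lambda>(x, y). 1 * 1"]) auto
qed

lemma regular_partial_comp_fst:
  assumes X: "ind_system X" and Y: "ind_system Y" and f: "regular_partial X f"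
    and XY: "space_system (X \<times>\<^sub>I Y)"
  shows "regular_partial (X \<times>\<^sub>I Y) (f \<circ> fst)"
  unfolding regular_partial_def
proof (intro conjI allI)
  have dom: "dom (f \<circ> fst) = dom f \<times> UNIV" by force
  have "dom (f \<circ> fst) \<inter> ipts (X \<times>\<^sub>I Y) = (dom f \<inter> ipts X) \<times> ipts Y"
    unfolding dom ipts_iprod[OF X Y] by blast
  then show "openin (itop (X \<times>\<^sub>I Y)) (dom (f \<circ> fst) \<inter> ipts (X \<times>\<^sub>I Y))"
    using f openin_topspace[of "itop Y"]
    by (auto intro!: openin_iprod_Times[OF X Y] simp: regular_partial_def topspace_itop)
  fix n
  have F: "function_algebras (X n)" "function_algebras (Y n)" using X Y by (auto simp: ind_system_def)
  have D: "dom (f \<circ> fst) \<inter> pts ((X \<times>\<^sub>I Y) n) = (dom f \<inter> pts (X n)) \<times> pts (Y n)"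
    unfolding dom pts_iprod[OF X Y] by blast
  have "(\<lambda>(x, y). the (f x) * 1) \<in> reg ((X \<times>\<^sub>I Y) n) ((dom f \<inter> pts (X n)) \<times> pts (Y n))"
    unfolding iprod_def using f
    by (intro tensor_funs_reg_prod F regular_partial_open[OF f] reg_const) (auto simp: regular_partial_def)
  then show "(\<lambda>x. the ((f \<circ> fst) x)) \<in> reg ((X \<times>\<^sub>I Y) n) (dom (f \<circ> fst) \<inter> pts ((X \<times>\<^sub>I Y) n))"
    unfolding D by (simp add: case_prod_unfold)
qed

lemma regular_partial_comp_snd:
  assumes X: "ind_system X" and Y: "ind_system Y" and f: "regular_partial Y f"
    and XY: "space_system (X \<times>\<^sub>I Y)"
  shows "regular_partial (X \<times>\<^sub>I Y) (f \<circ> snd)"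
  unfolding regular_partial_def
proof (intro conjI allI)
  have dom: "dom (f \<circ> snd) = UNIV \<times> dom f" by force
  have "dom (f \<circ> snd) \<inter> ipts (X \<times>\<^sub>I Y) = ipts X \<times> (dom f \<inter> ipts Y)"
    unfolding dom ipts_iprod[OF X Y] by blast
  then show "openin (itop (X \<times>\<^sub>I Y)) (dom (f \<circ> snd) \<inter> ipts (X \<times>\<^sub>I Y))"
    using f openin_topspace[of "itop X"]
    by (auto intro!: openin_iprod_Times[OF X Y] simp: regular_partial_def topspace_itop)
  fix n
  have F: "function_algebras (X n)" "function_algebras (Y n)" using X Y by (auto simp: ind_system_def)
  have D: "dom (f \<circ> snd) \<inter> pts ((X \<times>\<^sub>I Y) n) = pts (X n) \<times> (dom f \<inter> pts (Y n))"
    unfolding dom pts_iprod[OF X Y] by blast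
  have "(\<lambda>(x, y). 1 * the (f y)) \<in> reg ((X \<times>\<^sub>I Y) n) (pts (X n) \<times> (dom f \<inter> pts (Y n)))"
    unfolding iprod_def using f
    by (intro tensor_funs_reg_prod F regular_partial_open[OF f] reg_const) (auto simp: regular_partial_def)
  then show "(\<lambda>x. the ((f \<circ> snd) x)) \<in> reg ((X \<times>\<^sub>I Y) n) (dom (f \<circ> snd) \<inter> pts ((X \<times>\<^sub>I Y) n))"
    unfolding D by (simp add: case_prod_unfold)
qed

lemma rational_function_nonvanishing_open:
  assumes "space_system X" "rational_function X f"
  shows "openin (itop X) {x \<in> dom f. the (f x) \<noteq> 0}"
proof -
  have f: "regular_partial X f" by (rule rational_function_regular_partial[OF assms(2)])
  have "openin (ztop (X n)) {x \<in> dom f \<inter> pts (X n). the (f x) \<noteq> 0}" for n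
    using assms f by (intro reg_nonvanishing_open regular_partial_open)
      (auto simp: space_system_def ind_system_def regular_partial_def)
  moreover have "{x \<in> dom f \<inter> pts (X n). the (f x) \<noteq> 0} = {x \<in> dom f. the (f x) \<noteq> 0} \<inter> pts (X n)" for n
    by blast
  moreover have "dom f \<subseteq> ipts X"
    using assms by (auto simp: rational_function_def dense_open_def openin_itop)
  ultimately show ?thesis unfolding openin_itop by auto
qed

text \<open>
  Zorn's lemma: the union of a chain of irreducible subsets is irreducible.
\<close>

lemma irreducible_component_exists:
  assumes "x \<in> topspace T"
  obtains Z where "irreducible_component T Z" "x \<in> Z"
proof -
  let ?A = "{S. irreducible_subset T S \<and> x \<in> S}"
  have "{x} \<in> ?A" using assms by (auto simp: irreducible_subset_def)
  moreover have "\<Union>C \<in> ?A" if C: "C \<noteq> {}" "subset.chain ?A C" for C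
  proof -
    have sub: "C \<subseteq> ?A" and chain: "\<And>S S'. S \<in> C \<Longrightarrow> S' \<in> C \<Longrightarrow> S \<subseteq> S' \<or> S' \<subseteq> S"
      using C(2) by (auto simp: subset.chain_def)
    have "U \<inter> V \<inter> \<Union>C \<noteq> {}"
      if UV: "openin T U" "openin T V" "U \<inter> \<Union>C \<noteq> {}" "V \<inter> \<Union>C \<noteq> {}" for U V
    proof -
      obtain S S' where S: "S \<in> C" "U \<inter> S \<noteq> {}" "S' \<in> C" "V \<inter> S' \<noteq> {}" using UV by blast
      define R where "R = S \<union> S'"
      have R: "R \<in> C" using chain[OF S(1,3)] S(1,3) by (auto simp: R_def Un_absorb1 Un_absorb2)
      then have "irreducible_subset T R" using sub by blast
      moreover have "U \<inter> R \<noteq> {}" "V \<inter> R \<noteq> {}" using S by (auto simp: R_def)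
      ultimately have "U \<inter> V \<inter> R \<noteq> {}" using UV unfolding irreducible_subset_def by blast
      then show ?thesis using R by blast
    qed
    moreover have "\<Union>C \<subseteq> topspace T" using sub by (auto simp: irreducible_subset_def)
    moreover have "x \<in> \<Union>C" using sub C(1) by blast
    ultimately show ?thesis unfolding irreducible_subset_def by blast
  qed
  ultimately obtain Z where Z: "Z \<in> ?A" "\<forall>S\<in>?A. Z \<subseteq> S \<longrightarrow> S = Z"
    using subset_Zorn_nonempty[of ?A] by blast
  then have "irreducible_component T Z" unfolding irreducible_component_def by blast
  then show thesis using that Z by blast
qed

text \<open>
  If the function vanished on a nonempty open set \<open>V\<close>, pick a component \<open>Z\<close> through a point of \<open>V\<close>. The
  open set where a representative is nonzero meets \<open>Z\<close>, hence it meets \<open>V\<close> by irreducibility,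
  hence also at a point where the representative agrees with the function.
\<close>

lemma nonvanishing_dense_open:
  assumes X: "space_system X" and f: "rational_function X f" and nz: "nonzero_on_components X f"
  shows "dense_open (itop X) {x \<in> dom f. the (f x) \<noteq> 0}"
  unfolding dense_open_iff
proof (intro conjI allI impI)
  show "openin (itop X) {x \<in> dom f. the (f x) \<noteq> 0}"
    by (rule rational_function_nonvanishing_open[OF X f])
  fix V assume V: "openin (itop X) V \<and> V \<noteq> {}"
  then obtain x where x: "x \<in> V" by blast
  then have "x \<in> topspace (itop X)" using V openin_subset by blast
  from irreducible_component_exists[OF this]
  obtain Z where Z: "irreducible_component (itop X) Z" "x \<in> Z" .
  from nz[unfolded nonzero_on_components_def, rule_format, OF Z(1)]
  obtain g z where g: "rational_function X g" "g \<approx>\<^bsub>X\<^esub> f" "z \<in> Z" "z \<in> dom g" "g z \<noteq> Some 0"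
    by blast
  obtain W where W: "dense_open (itop X) W" "W \<subseteq> dom g \<inter> dom f" "\<forall>x\<in>W. g x = f x"
    using g(2) unfolding rat_eq_def by (elim exE conjE)
  let ?N = "{x \<in> dom g. the (g x) \<noteq> 0}"
  have N: "openin (itop X) ?N" by (rule rational_function_nonvanishing_open[OF X g(1)])
  have "z \<in> ?N" using g by auto
  then have "V \<inter> Z \<noteq> {}" "?N \<inter> Z \<noteq> {}" using x Z(2) g(3) by blast+
  moreover have "irreducible_subset (itop X) Z" using Z(1) by (simp add: irreducible_component_def)
  then have "\<forall>U V. openin (itop X) U \<and> openin (itop X) V \<and> U \<inter> Z \<noteq> {} \<and> V \<inter> Z \<noteq> {} \<longrightarrow>
      U \<inter> V \<inter> Z \<noteq> {}"
    by (simp add: irreducible_subset_def)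
  ultimately have "V \<inter> ?N \<inter> Z \<noteq> {}" using V N by blast
  then have "V \<inter> ?N \<noteq> {}" "openin (itop X) (V \<inter> ?N)" using V N by auto
  then obtain w where "w \<in> W" "w \<in> V" "w \<in> ?N" using dense_openD(2)[OF W(1)] by blast
  then have "w \<in> {x \<in> dom f. the (f x) \<noteq> 0}" using W by force
  then show "V \<inter> {x \<in> dom f. the (f x) \<noteq> 0} \<noteq> {}" using \<open>w \<in> V\<close> by blast
qed

section \<open>Rational actions\<close>

lemma rational_map_preimage_open:
  assumes f: "rational_map X Y f" and V: "openin (itop Y) V"
  shows "openin (itop X) {x \<in> dom f. the (f x) \<in> V}"
  unfolding openin_itop
proof (intro conjI allI)
  have O: "openin (itop X) (dom f)" using f by (simp add: rational_map_def dense_open_def)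
  then show "{x \<in> dom f. the (f x) \<in> V} \<subseteq> ipts X" by (auto simp: openin_itop)
  fix n
  obtain m where m: "morphism (sub_fspace (X n) (dom f \<inter> pts (X n))) (Y m) (\<lambda>x. the (f x))"
    using f unfolding rational_map_def by blast
  have On: "openin (ztop (X n)) (dom f \<inter> pts (X n))" using O by (simp add: openin_itop)
  have pts: "pts (sub_fspace (X n) (dom f \<inter> pts (X n))) = dom f \<inter> pts (X n)"
    by (auto simp: sub_fspace_def)
  have Vm: "openin (ztop (Y m)) (V \<inter> pts (Y m))" using V by (simp add: openin_itop)
  have "openin (ztop (sub_fspace (X n) (dom f \<inter> pts (X n))))
     {x \<in> dom f \<inter> pts (X n). the (f x) \<in> V \<inter> pts (Y m)}"
    using m Vm unfolding morphism_def pts by blast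
  then have "openin (ztop (X n)) {x \<in> dom f \<inter> pts (X n). the (f x) \<in> V \<inter> pts (Y m)}"
    unfolding sub_fspace_def fspace.select_convs openin_open_subtopology[OF On] by simp
  moreover have "{x \<in> dom f \<inter> pts (X n). the (f x) \<in> V \<inter> pts (Y m)} =
      {x \<in> dom f. the (f x) \<in> V} \<inter> pts (X n)"
    using m unfolding morphism_def pts by blast
  ultimately show "openin (ztop (X n)) ({x \<in> dom f. the (f x) \<in> V} \<inter> pts (X n))" by simp
qed

text \<open>
  An action is dominant. Given a nonempty open set \<open>Q\<close>, choose \<open>z \<in> W\<close> whose fibre meets \<open>Q\<close> and at which the
  extended action is the identity for \<open>c = 1\<close>. A representative \<open>g\<close> defined at \<open>(1, z)\<close> sends an
  open neighbourhood of \<open>(1, z)\<close> into \<open>W\<close>. In the fibre over \<open>z\<close> this neighbourhood and \<open>Q\<close> are both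
  cofinite, so they meet; on a dense open subset of the intersection \<open>g\<close> is the action itself.
\<close>

lemma action_preimage_dense_open:
  assumes Z: "ind_system Z" and e: "rational_action Z e" and W: "dense_open (itop Z) W"
  shows "dense_open (itop (\<G> \<times>\<^sub>I Z)) {p \<in> dom e. the (e p) \<in> W}"
  unfolding dense_open_iff
proof (intro conjI allI impI)
  note G = ind_system_Gm
  have rm: "rational_map (\<G> \<times>\<^sub>I Z) Z e" using e by (simp add: rational_action_def)
  show "openin (itop (\<G> \<times>\<^sub>I Z)) {p \<in> dom e. the (e p) \<in> W}"
    by (rule rational_map_preimage_open[OF rm dense_openD(1)[OF W]])
  fix Q assume Q: "openin (itop (\<G> \<times>\<^sub>I Z)) Q \<and> Q \<noteq> {}"
  obtain D where D: "dense_open (itop Z) D" "\<forall>x\<in>D. max_ext (\<G> \<times>\<^sub>I Z) Z e (1, x) = Some x"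
    using e unfolding rational_action_def rat_eq_def by blast
  obtain c z where "(c, z) \<in> Q" using Q by auto
  then have "{z. (c, z) \<in> Q} \<noteq> {}" by blast
  from dense_openD(2)[OF dense_open_Int[OF W D(1)] openin_iprod_slice_snd[OF G Z] this] Q
  obtain z where z: "z \<in> W" "z \<in> D" "(c, z) \<in> Q" by blast
  let ?P = "\<lambda>g. rational_map (\<G> \<times>\<^sub>I Z) Z g \<and> g \<approx>\<^bsub>\<G> \<times>\<^sub>I Z\<^esub> e \<and> (1, z) \<in> dom g"
  have "max_ext (\<G> \<times>\<^sub>I Z) Z e (1, z) = Some z" using D z by blast
  then have "\<exists>g. ?P g" "(SOME g. ?P g) (1, z) = Some z"
    unfolding max_ext_def by (auto split: if_splits)
  then obtain g where g: "rational_map (\<G> \<times>\<^sub>I Z) Z g" "g \<approx>\<^bsub>\<G> \<times>\<^sub>I Z\<^esub> e" "g (1, z) = Some z"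
    using someI_ex[of ?P] by blast
  let ?R = "{p \<in> dom g. the (g p) \<in> W}"
  have R: "openin (itop (\<G> \<times>\<^sub>I Z)) ?R"
    by (rule rational_map_preimage_open[OF g(1) dense_openD(1)[OF W]])
  have "(1, z) \<in> ?R" using g(3) z(1) by auto
  then have "{c. (c, z) \<in> ?R} \<noteq> {}" by blast
  then have "finite (- {c. (c, z) \<in> ?R})"
    using openin_itop_Gm_cofinite[OF openin_iprod_slice_fst[OF G Z R]] by blast
  moreover have "{c. (c, z) \<in> Q} \<noteq> {}" using z by blast
  ultimately have "{c. (c, z) \<in> Q} \<inter> {c. (c, z) \<in> ?R} \<noteq> {}"
    using openin_itop_Gm_meet[OF openin_iprod_slice_fst[OF G Z]] Q by blast
  then have "Q \<inter> ?R \<noteq> {}" by blast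
  moreover have "openin (itop (\<G> \<times>\<^sub>I Z)) (Q \<inter> ?R)" using Q R by blast
  moreover obtain E where E: "dense_open (itop (\<G> \<times>\<^sub>I Z)) E" "E \<subseteq> dom g \<inter> dom e" "\<forall>x\<in>E. g x = e x"
    using g(2) unfolding rat_eq_def by blast
  ultimately obtain p where "p \<in> Q" "p \<in> ?R" "p \<in> E" using dense_openD(2)[OF E(1)] by blast
  then have "p \<in> {p \<in> dom e. the (e p) \<in> W}" using E by force
  then show "Q \<inter> {p \<in> dom e. the (e p) \<in> W} \<noteq> {}" using \<open>p \<in> Q\<close> by blast
qed

text \<open>
  A morphism pulls regular functions back to functions that extend locally to regular functions of
  the ambient product, and these are fractions.
\<close>

lemma rational_map_comp_locally_fraction:
  assumes A: "ind_system A" and B: "ind_system B" and e: "rational_map (A \<times>\<^sub>I B) Z e"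
    and f: "regular_partial Z f"
  shows "locally_fraction (A n) (B n) (dom (f \<circ>\<^sub>m e) \<inter> pts ((A \<times>\<^sub>I B) n)) (\<lambda>p. the ((f \<circ>\<^sub>m e) p))"
proof -
  let ?X = "prod_fspace (A n) (B n)"
  have Xn: "(A \<times>\<^sub>I B) n = ?X" by (simp add: iprod_def)
  let ?S = "sub_fspace ?X (dom e \<inter> pts ?X)"
  obtain m where m: "morphism ?S (Z m) (\<lambda>x. the (e x))"
    using e unfolding rational_map_def by (auto simp: iprod_def)
  have On: "openin (ztop ?X) (dom e \<inter> pts ?X)"
    using e unfolding rational_map_def dense_open_def openin_itop Xn[symmetric] by blast
  have ptsS: "pts ?S = dom e \<inter> pts ?X" by (auto simp: sub_fspace_def)
  let ?V = "{x \<in> pts ?S. the (e x) \<in> dom f \<inter> pts (Z m)}"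
  have Of: "openin (ztop (Z m)) (dom f \<inter> pts (Z m))" by (rule regular_partial_open[OF f])
  have fr: "(\<lambda>x. the (f x)) \<in> reg (Z m) (dom f \<inter> pts (Z m))" using f by (simp add: regular_partial_def)
  have V: "openin (ztop ?S) ?V" and reg: "(\<lambda>x. the (f x)) \<circ> (\<lambda>x. the (e x)) \<in> reg ?S ?V"
    using m[unfolded morphism_def, THEN conjunct2, rule_format, OF Of] fr by blast+
  have "openin (subtopology (ztop ?X) (dom e \<inter> pts ?X)) ?V"
    using V by (simp only: sub_fspace_def fspace.select_convs)
  then have VX: "openin (ztop ?X) ?V" unfolding openin_open_subtopology[OF On] by blast
  have eqV: "dom (f \<circ>\<^sub>m e) \<inter> pts ?X = ?V"
  proof -
    have "(\<lambda>x. the (e x)) ` pts ?S \<subseteq> pts (Z m)" using m by (simp add: morphism_def)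
    moreover have "dom (f \<circ>\<^sub>m e) = {x \<in> dom e. the (e x) \<in> dom f}"
      by (auto simp: map_comp_def split: option.splits)
    ultimately show ?thesis unfolding ptsS by blast
  qed
  show ?thesis unfolding Xn eqV locally_fraction_def
  proof
    fix p assume p: "p \<in> ?V"
    from reg have "\<forall>x\<in>?V. \<exists>U g. openin (ztop ?X) U \<and> x \<in> U \<and> g \<in> reg ?X U \<and>
        (\<forall>y\<in>U \<inter> ?V. ((\<lambda>x. the (f x)) \<circ> (\<lambda>x. the (e x))) y = g y)"
      by (simp only: sub_fspace_def fspace.select_convs mem_Collect_eq)
    from bspec[OF this p] obtain U g where U: "openin (ztop ?X) U" "p \<in> U" and g: "g \<in> reg ?X U"
      and eq: "\<forall>y\<in>U \<inter> ?V. ((\<lambda>x. the (f x)) \<circ> (\<lambda>x. the (e x))) y = g y" by (elim exE conjE)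
    from g have "\<forall>z\<in>U. \<exists>U' V'. \<exists>h\<in>tensor_funs (A n) (B n) U' V'. \<exists>k\<in>tensor_funs (A n) (B n) U' V'.
        openin (ztop (A n)) U' \<and> openin (ztop (B n)) V' \<and> z \<in> U' \<times> V' \<and> k z \<noteq> 0 \<and>
        (\<forall>w \<in> U \<inter> U' \<times> V'. k w \<noteq> 0 \<longrightarrow> g w = h w / k w)"
      by (simp only: prod_fspace_def fspace.select_convs mem_Collect_eq)
    from bspec[OF this U(2)] obtain U' V' h k where
      h: "h \<in> tensor_funs (A n) (B n) U' V'" "k \<in> tensor_funs (A n) (B n) U' V'"
      and U': "openin (ztop (A n)) U'" "openin (ztop (B n)) V'" and pk: "p \<in> U' \<times> V'" "k p \<noteq> 0"
      and gw: "\<forall>w \<in> U \<inter> U' \<times> V'. k w \<noteq> 0 \<longrightarrow> g w = h w / k w" by (elim exE bexE conjE)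
    let ?N = "U \<inter> ?V \<inter> {w \<in> U' \<times> V'. k w \<noteq> 0}"
    have "openin (ztop ?X) ?N"
      using U VX openin_prod_fspace_basic[OF U' h(2)] by (intro openin_Int)
    moreover have "p \<in> ?N" using U p pk by blast
    moreover have "\<forall>w\<in>?N. k w \<noteq> 0 \<and> the ((f \<circ>\<^sub>m e) w) = h w / k w"
    proof
      fix w assume w: "w \<in> ?N"
      have "the ((f \<circ>\<^sub>m e) w) = the (f (the (e w)))"
        using w unfolding ptsS by (auto simp: map_comp_def split: option.splits)
      then show "k w \<noteq> 0 \<and> the ((f \<circ>\<^sub>m e) w) = h w / k w" using w eq gw by auto
    qed
    ultimately show "\<exists>N U V. \<exists>h\<in>tensor_funs (A n) (B n) U V. \<exists>k\<in>tensor_funs (A n) (B n) U V.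
        openin (ztop ?X) N \<and> p \<in> N \<and> N \<subseteq> ?V \<and> openin (ztop (A n)) U \<and> openin (ztop (B n)) V \<and>
        N \<subseteq> U \<times> V \<and> (\<forall>w\<in>N. k w \<noteq> 0 \<and> the ((f \<circ>\<^sub>m e) w) = h w / k w)"
      using h U' by (intro exI[of _ ?N] exI[of _ U'] exI[of _ V'] bexI[of _ h] bexI[of _ k] conjI) blast+
  qed
qed

text \<open>
  Both sides are regular on dense open domains, so the set where they differ is open. It misses a
  dense set and is therefore empty. The function \<open>u\<close> stands for \<open>c\<^sup>-\<^sup>1\<close> or for \<open>1\<close>.
\<close>

lemma action_rat_eq:
  assumes Z: "ind_system Z" and e: "rational_action Z e" and f: "rational_function Z f"
    and u: "u \<in> reg Gm (pts Gm)" and B: "dense_open (itop Z) B"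
    and val: "\<And>z. z \<in> B \<Longrightarrow> finite {c. c \<noteq> 0 \<and>
        \<not> (\<exists>z'. e (c, z) = Some z' \<and> z \<in> dom f \<and> z' \<in> dom f \<and> the (f z') = u c * the (f z))}"
  shows "f \<circ>\<^sub>m e \<approx>\<^bsub>\<G> \<times>\<^sub>I Z\<^esub> (\<lambda>(c, z). map_option (\<lambda>v. u c * v) (f z))"
proof -
  note G = ind_system_Gm
  let ?F = "f \<circ>\<^sub>m e" and ?H = "\<lambda>(c, z). map_option (\<lambda>v. u c * v) (f z)"
  have fd: "dense_open (itop Z) (dom f)" using f by (simp add: rational_function_def)
  have rm: "rational_map (\<G> \<times>\<^sub>I Z) Z e" using e by (simp add: rational_action_def)
  have fr: "regular_partial Z f" by (rule rational_function_regular_partial[OF f])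
  have domF: "dom ?F = {p \<in> dom e. the (e p) \<in> dom f}"
    by (auto simp: map_comp_def split: option.splits)
  have dF: "dense_open (itop (\<G> \<times>\<^sub>I Z)) (dom ?F)"
    unfolding domF by (rule action_preimage_dense_open[OF Z e fd])
  have domH: "dom ?H = UNIV \<times> dom f" by (auto simp: dom_def)
  have dH: "dense_open (itop (\<G> \<times>\<^sub>I Z)) (ipts \<G> \<times> dom f)"
    using dense_open_topspace[of "itop \<G>"]
    by (intro dense_open_iprod_Times[OF G Z] fd) (simp add: topspace_itop)
  let ?W = "dom ?F \<inter> (ipts \<G> \<times> dom f)"
  have W: "dense_open (itop (\<G> \<times>\<^sub>I Z)) ?W" by (rule dense_open_Int[OF dF dH])
  let ?N = "{p \<in> ?W. the (?F p) \<noteq> the (?H p)}"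
  have N: "openin (itop (\<G> \<times>\<^sub>I Z)) ?N"
    unfolding openin_itop
  proof (intro conjI allI)
    show "?N \<subseteq> ipts (\<G> \<times>\<^sub>I Z)" using dense_openD(1)[OF W] by (auto simp: openin_itop)
    fix n
    have FG: "function_algebras (\<G> n)" and FZ: "function_algebras (Z n)"
      using G Z by (auto simp: ind_system_def)
    have 1: "locally_fraction (\<G> n) (Z n) (dom ?F \<inter> pts ((\<G> \<times>\<^sub>I Z) n)) (\<lambda>p. the (?F p))"
      by (rule rational_map_comp_locally_fraction[OF G Z rm fr])
    have 2: "locally_fraction (\<G> n) (Z n) (pts (\<G> n) \<times> (dom f \<inter> pts (Z n))) (\<lambda>p. the (?H p))"
    proof (rule locally_fraction_tensor[OF FG FZ openin_topspace regular_partial_open[OF fr]])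
      show "u \<in> reg (\<G> n) (pts (\<G> n))" using u by (simp add: Gm_ind_def)
      show "(\<lambda>x. the (f x)) \<in> reg (Z n) (dom f \<inter> pts (Z n))" using fr by (simp add: regular_partial_def)
    qed auto
    have "ipts \<G> = pts (\<G> n)" by (simp add: ipts_def Gm_ind_def)
    then have "?N \<inter> pts ((\<G> \<times>\<^sub>I Z) n) = {p \<in> (dom ?F \<inter> pts ((\<G> \<times>\<^sub>I Z) n)) \<inter>
        (pts (\<G> n) \<times> (dom f \<inter> pts (Z n))). the (?F p) \<noteq> the (?H p)}"
      unfolding pts_iprod[OF G Z] by blast
    then show "openin (ztop ((\<G> \<times>\<^sub>I Z) n)) (?N \<inter> pts ((\<G> \<times>\<^sub>I Z) n))"
      using locally_fraction_neq_open[OF FG FZ 1 2] by (simp only: iprod_def)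
  qed
  have "?N = {}"
  proof (rule ccontr)
    assume ne: "?N \<noteq> {}"
    obtain c z where cz: "(c, z) \<in> ?N" "z \<in> B"
      and "\<exists>z'. e (c, z) = Some z' \<and> z \<in> dom f \<and> z' \<in> dom f \<and> the (f z') = u c * the (f z)"
      using meets_fibrewise_cofinite[OF Z N ne B val] .
    then have "the (?F (c, z)) = the (?H (c, z))" by (auto simp: map_comp_def)
    then show False using cz by blast
  qed
  moreover have sub: "?W \<subseteq> dom ?F \<inter> dom ?H" unfolding domH by blast
  ultimately have "\<forall>p\<in>?W. ?F p = ?H p" by (fastforce intro: option.expand)
  then show ?thesis unfolding rat_eq_def using W sub by blast
qed

section \<open>Generic points\<close>

text \<open>
  Properties that hold at generic points are closed under finite conjunction, which keeps the many
  exceptional sets out of sight.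
\<close>

definition generic :: "'a topology \<Rightarrow> ('a \<Rightarrow> bool) \<Rightarrow> bool" where
  "generic T P \<longleftrightarrow> (\<exists>W. dense_open T W \<and> (\<forall>x\<in>W. P x))"

lemma genericI: "dense_open T W \<Longrightarrow> (\<And>x. x \<in> W \<Longrightarrow> P x) \<Longrightarrow> generic T P"
  unfolding generic_def by blast

lemma generic_True: "(\<And>x. P x) \<Longrightarrow> generic T P"
  using dense_open_topspace by (rule genericI)

lemma generic_mono: "generic T P \<Longrightarrow> (\<And>x. P x \<Longrightarrow> Q x) \<Longrightarrow> generic T Q"
  unfolding generic_def by blast

lemma generic_conj: "generic T P \<Longrightarrow> generic T Q \<Longrightarrow> generic T (\<lambda>x. P x \<and> Q x)"
  unfolding generic_def by (metis IntD1 IntD2 dense_open_Int)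

lemma generic_imp: "(A \<Longrightarrow> generic T P) \<Longrightarrow> generic T (\<lambda>x. A \<longrightarrow> P x)"
  by (cases A) (auto intro: generic_True)

lemma generic_ball:
  assumes "finite I" "\<And>i. i \<in> I \<Longrightarrow> generic T (P i)"
  shows "generic T (\<lambda>x. \<forall>i\<in>I. P i x)"
  using assms
proof (induction I)
  case empty then show ?case by (intro generic_True) simp
next
  case (insert i I)
  then have "generic T (\<lambda>x. P i x \<and> (\<forall>i\<in>I. P i x))" by (intro generic_conj) auto
  then show ?case by (rule generic_mono) simp
qed

lemma rat_eq_generic:
  assumes "f \<approx>\<^bsub>X\<^esub> g" shows "generic (itop X) (\<lambda>x. x \<in> dom f \<and> x \<in> dom g \<and> f x = g x)"
  using assms unfolding rat_eq_def generic_def by blast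

section \<open>Epsilon systems at a generic point\<close>

lemma dom_eq_Some_the: "x \<in> dom f \<Longrightarrow> f x = Some (the (f x))"
  by auto

text \<open>
  The matrix of an epsilon system at a point, the interval \<open>[a, b - 1]\<close> being written \<open>{a..<b}\<close>. The
  convention for the empty interval makes the diagonal entries 1.
\<close>

definition eps_matrix :: "(nat set \<Rightarrow> 'a \<rightharpoonup> complex) \<Rightarrow> 'a \<Rightarrow> nat \<Rightarrow> nat \<Rightarrow> complex" where
  "eps_matrix F x a b = the (with_empty F {a..<b} x)"

abbreviation gam_at :: "'a crystal \<Rightarrow> 'a \<Rightarrow> nat \<Rightarrow> complex" where
  "gam_at C x i \<equiv> the (gam C i x)"

lemma eps_matrix_diag: "eps_matrix F x a a = 1"
  by (simp add: eps_matrix_def with_empty_def)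

lemma eps_matrix_less: "a < b \<Longrightarrow> eps_matrix F x a b = the (F {a..<b} x)"
  by (simp add: eps_matrix_def with_empty_def)

lemma half_open_interval: "a < b \<Longrightarrow> {a..<b} = {a..b - 1}" for a b :: nat
  by (cases b) (auto simp: atLeastLessThanSuc_atLeastAtMost)

lemma finite_intervals: "finite (intervals n)"
proof (rule finite_subset)
  show "intervals n \<subseteq> Pow {1..n}" by (auto simp: intervals_def)
qed simp

lemma half_open_in_intervals: "1 \<le> a \<Longrightarrow> a < b \<Longrightarrow> b \<le> Suc n \<Longrightarrow> {a..<b} \<in> intervals n"
  unfolding intervals_def
  by (rule CollectI, rule exI[of _ a], rule exI[of _ "b - 1"]) (simp add: half_open_interval, arith)

text \<open>
  The points at which every function in sight is defined, the \<open>\<gamma>\<^sub>i\<close> and \<open>\<epsilon>\<^sub>i\<close> are nonzero, and the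
  identities between rational functions of an epsilon system are identities between numbers.
\<close>

definition eps_regular_point :: "nat \<Rightarrow> 'a crystal \<Rightarrow> 'a eps_system \<Rightarrow> 'a \<Rightarrow> bool" where
  "eps_regular_point n C E x \<longleftrightarrow>
     (\<forall>J\<in>intervals n. x \<in> dom (epsJ E J) \<and> x \<in> dom (epsJ_star E J)) \<and>
     (\<forall>i\<in>{1..n}. x \<in> dom (gam C i) \<and> gam_at C x i \<noteq> 0 \<and> x \<in> dom (eps C i) \<and>
        the (eps C i x) = eps_matrix (epsJ E) x i (Suc i) \<and> the (eps C i x) \<noteq> 0) \<and>
     signed_inverse 1 (Suc n) (eps_matrix (epsJ E) x) (eps_matrix (epsJ_star E) x)"

lemma eps_regular_pointD:
  assumes "eps_regular_point n C E x"
  shows "i \<in> {1..n} \<Longrightarrow> gam C i x = Some (gam_at C x i)"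
    "i \<in> {1..n} \<Longrightarrow> gam_at C x i \<noteq> 0"
    "i \<in> {1..n} \<Longrightarrow> eps C i x = Some (eps_matrix (epsJ E) x i (Suc i))"
    "i \<in> {1..n} \<Longrightarrow> eps_matrix (epsJ E) x i (Suc i) \<noteq> 0"
    "signed_inverse 1 (Suc n) (eps_matrix (epsJ E) x) (eps_matrix (epsJ_star E) x)"
proof -
  note * = assms[unfolded eps_regular_point_def, THEN conjunct2]
  show "signed_inverse 1 (Suc n) (eps_matrix (epsJ E) x) (eps_matrix (epsJ_star E) x)"
    using * by blast
  assume i: "i \<in> {1..n}"
  note ** = bspec[OF *[THEN conjunct1] i]
  show "gam C i x = Some (gam_at C x i)" using ** by (intro dom_eq_Some_the) blast
  show "gam_at C x i \<noteq> 0" using ** by blast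
  have "eps C i x = Some (the (eps C i x))" using ** by (intro dom_eq_Some_the) blast
  then show "eps C i x = Some (eps_matrix (epsJ E) x i (Suc i))" using ** by simp
  show "eps_matrix (epsJ E) x i (Suc i) \<noteq> 0" using ** by metis
qed

lemma eps_matrix_Some:
  assumes "eps_regular_point n C E x" "1 \<le> a" "a \<le> b" "b \<le> Suc n"
  shows "with_empty (epsJ E) {a..<b} x = Some (eps_matrix (epsJ E) x a b)"
    "with_empty (epsJ_star E) {a..<b} x = Some (eps_matrix (epsJ_star E) x a b)"
proof -
  have "a < b \<Longrightarrow> x \<in> dom (epsJ E {a..<b}) \<and> x \<in> dom (epsJ_star E {a..<b})"
    using assms half_open_in_intervals[of a b n] by (simp add: eps_regular_point_def)
  then show "with_empty (epsJ E) {a..<b} x = Some (eps_matrix (epsJ E) x a b)"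
    "with_empty (epsJ_star E) {a..<b} x = Some (eps_matrix (epsJ_star E) x a b)"
    using assms(3) by (auto simp: eps_matrix_def with_empty_def)
qed

abbreviation signed_partition_rsum :: "(nat set \<Rightarrow> 'a \<rightharpoonup> complex) \<Rightarrow> nat set \<Rightarrow> 'a \<rightharpoonup> complex" where
  "signed_partition_rsum F J \<equiv>
     rsum (\<lambda>P. (\<lambda>_. Some ((-1) ^ (card J - card P))) *\<^sub>r rprod F P) (interval_partitions J)"

lemma signed_partition_rsum_value:
  assumes "x \<in> dom (signed_partition_rsum F J)"
  shows "the (signed_partition_rsum F J x) = signed_partition_sum (\<lambda>K. the (F K x)) J"
proof -
  have D: "x \<in> dom ((\<lambda>_. Some ((-1) ^ (card J - card P))) *\<^sub>r rprod F P)" "x \<in> dom (rprod F P)"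
    if "P \<in> interval_partitions J" for P
    using assms that by (auto simp: dom_rsum dom_rmul)
  show ?thesis
    unfolding the_rsum[OF assms] signed_partition_sum_def
    by (intro sum.cong refl) (simp add: the_rmul[OF D(1)] the_rprod[OF D(2)])
qed

lemma signed_partition_rsum_dom:
  assumes "\<And>P K. P \<in> interval_partitions J \<Longrightarrow> K \<in> P \<Longrightarrow> x \<in> dom (F K)"
  shows "x \<in> dom (signed_partition_rsum F J)"
  using assms by (auto simp: dom_rsum dom_rmul dom_rprod)

locale eps_crystal =
  fixes n :: nat and C :: "'a crystal" and E :: "'a eps_system"
  assumes crystal: "geometric_crystal n C" and system: "is_eps_system n C E"
    and nonzero: "\<And>i. i \<in> {1..n} \<Longrightarrow> nonzero_on_components (space_of C) (eps C i) \<and>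
       nonzero_on_components (space_of C) (gam C i)"
begin

abbreviation "X \<equiv> space_of C"
abbreviation "M \<equiv> eps_matrix (epsJ E)"
abbreviation "N \<equiv> eps_matrix (epsJ_star E)"

lemma ind_variety: "ind_variety X"
  using crystal by (simp add: geometric_crystal_def Let_def)

lemma space_system: "space_system X"
  by (rule ind_variety_space_system[OF ind_variety])

lemma ind_system: "ind_system X"
  using space_system by (simp add: space_system_def)

lemma rational:
  assumes "i \<in> {1..n}"
  shows "rational_function X (gam C i)" "rational_function X (eps C i)" "rational_action X (act C i)"
  using crystal assms unfolding geometric_crystal_def Let_def by blast+

lemma rational_epsJ:
  assumes "J \<in> intervals n"
  shows "rational_function X (epsJ E J)" "rational_function X (epsJ_star E J)"
  using system assms unfolding is_eps_system_def Let_def by blast+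

lemma rational_function_generic:
  "rational_function X f \<Longrightarrow> generic (itop X) (\<lambda>x. x \<in> dom f)"
  by (rule genericI[of _ "dom f"]) (auto simp: rational_function_def)

text \<open>
  Finitely many dense open conditions. The partition identity is passed on as an inverse relation.
\<close>

lemma generic_regular_point: "generic (itop X) (eps_regular_point n C E)"
proof -
  let ?S = "{(s, t). 1 \<le> s \<and> s \<le> t \<and> t \<le> n}"
  have S: "finite ?S" by (rule finite_subset[of _ "{1..n} \<times> {1..n}"]) auto
  have 1: "generic (itop X) (\<lambda>x. \<forall>J\<in>intervals n. x \<in> dom (epsJ E J) \<and> x \<in> dom (epsJ_star E J))"
    by (intro generic_ball finite_intervals generic_conj rational_function_generic rational_epsJ)
  have 2: "generic (itop X) (\<lambda>x. \<forall>i\<in>{1..n}. (x \<in> dom (gam C i) \<and> gam_at C x i \<noteq> 0) \<and>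
       (x \<in> dom (eps C i) \<and> the (eps C i x) \<noteq> 0) \<and>
       (x \<in> dom (epsJ E {i}) \<and> x \<in> dom (eps C i) \<and> epsJ E {i} x = eps C i x))"
  proof (rule generic_ball)
    fix i assume i: "i \<in> {1..n}"
    have g: "generic (itop X) (\<lambda>x. x \<in> dom (gam C i) \<and> gam_at C x i \<noteq> 0)"
      using nonvanishing_dense_open[OF space_system rational(1)[OF i]] nonzero[OF i]
      by (intro genericI[of _ "{x \<in> dom (gam C i). gam_at C x i \<noteq> 0}"]) auto
    have e: "generic (itop X) (\<lambda>x. x \<in> dom (eps C i) \<and> the (eps C i x) \<noteq> 0)"
      using nonvanishing_dense_open[OF space_system rational(2)[OF i]] nonzero[OF i]
      by (intro genericI[of _ "{x \<in> dom (eps C i). the (eps C i x) \<noteq> 0}"]) auto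
    have "epsJ E {i} \<approx>\<^bsub>X\<^esub> eps C i"
      using system i unfolding is_eps_system_def Let_def by blast
    from generic_conj[OF g generic_conj[OF e rat_eq_generic[OF this]]]
    show "generic (itop X) (\<lambda>x. (x \<in> dom (gam C i) \<and> gam_at C x i \<noteq> 0) \<and>
       (x \<in> dom (eps C i) \<and> the (eps C i x) \<noteq> 0) \<and>
       (x \<in> dom (epsJ E {i}) \<and> x \<in> dom (eps C i) \<and> epsJ E {i} x = eps C i x))" .
  qed simp
  have 3: "generic (itop X) (\<lambda>x. \<forall>p\<in>?S. case p of (s, t) \<Rightarrow>
     x \<in> dom (epsJ_star E {s..t}) \<and> x \<in> dom (signed_partition_rsum (epsJ E) {s..t}) \<and>
     epsJ_star E {s..t} x = signed_partition_rsum (epsJ E) {s..t} x)"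
  proof (rule generic_ball[OF S])
    fix p assume "p \<in> ?S"
    then obtain s t where p: "p = (s, t)" and st: "1 \<le> s \<and> s \<le> t \<and> t \<le> n" by blast
    then have "epsJ_star E {s..t} \<approx>\<^bsub>X\<^esub> signed_partition_rsum (epsJ E) {s..t}"
      using system[unfolded is_eps_system_def Let_def, THEN conjunct2, THEN conjunct2, rule_format, OF st]
      by blast
    from rat_eq_generic[OF this]
    show "generic (itop X) (\<lambda>x. case p of (s, t) \<Rightarrow>
     x \<in> dom (epsJ_star E {s..t}) \<and> x \<in> dom (signed_partition_rsum (epsJ E) {s..t}) \<and>
     epsJ_star E {s..t} x = signed_partition_rsum (epsJ E) {s..t} x)"
      unfolding p prod.case .
  qed
  show ?thesis
  proof (rule generic_mono[OF generic_conj[OF 1 generic_conj[OF 2 3]]])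
    fix x
    assume x: "(\<forall>J\<in>intervals n. x \<in> dom (epsJ E J) \<and> x \<in> dom (epsJ_star E J)) \<and>
      (\<forall>i\<in>{1..n}. (x \<in> dom (gam C i) \<and> gam_at C x i \<noteq> 0) \<and>
       (x \<in> dom (eps C i) \<and> the (eps C i x) \<noteq> 0) \<and>
       (x \<in> dom (epsJ E {i}) \<and> x \<in> dom (eps C i) \<and> epsJ E {i} x = eps C i x)) \<and>
      (\<forall>p\<in>?S. case p of (s, t) \<Rightarrow>
       x \<in> dom (epsJ_star E {s..t}) \<and> x \<in> dom (signed_partition_rsum (epsJ E) {s..t}) \<and>
       epsJ_star E {s..t} x = signed_partition_rsum (epsJ E) {s..t} x)"
    have "signed_inverse 1 (Suc n) (M x) (N x)"
    proof (subst signed_inverse_iff_partition_sum[where w = "\<lambda>K. the (epsJ E K x)"])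
      show "\<forall>a b. 1 \<le> a \<and> a < b \<and> b \<le> Suc n \<longrightarrow>
          N x a b = signed_partition_sum (\<lambda>K. the (epsJ E K x)) {a..<b}"
      proof (intro allI impI)
        fix a b :: nat assume ab: "1 \<le> a \<and> a < b \<and> b \<le> Suc n"
        then have "(a, b - 1) \<in> ?S" by auto
        with x have "x \<in> dom (signed_partition_rsum (epsJ E) {a..b - 1})"
          "epsJ_star E {a..b - 1} x = signed_partition_rsum (epsJ E) {a..b - 1} x" by blast+
        then show "N x a b = signed_partition_sum (\<lambda>K. the (epsJ E K x)) {a..<b}"
          using ab signed_partition_rsum_value[where x = x and F = "epsJ E" and J = "{a..b - 1}"]
          by (simp add: eps_matrix_less half_open_interval)
      qed
    qed (simp_all add: eps_matrix_diag eps_matrix_less)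
    then show "eps_regular_point n C E x"
      using x unfolding eps_regular_point_def by (simp add: eps_matrix_less)
  qed
qed

definition transforms_at :: "nat \<Rightarrow> complex \<Rightarrow> 'a \<Rightarrow> 'a \<Rightarrow> bool" where
  "transforms_at i c x x' \<longleftrightarrow> eps_regular_point n C E x \<and> eps_regular_point n C E x' \<and>
     eps_transform n i c (M x) (M x') \<and> eps_star_transform n i c (N x) (N x') \<and>
     gam_transform n i c (gam_at C x) (gam_at C x')"

lemma eps_axioms:
  assumes i: "i \<in> {1..n}" and st: "1 \<le> s \<and> s \<le> t \<and> t \<le> n"
  shows "i = s \<Longrightarrow> epsJ E {s..t} \<circ>\<^sub>m act C i
        \<approx>\<^bsub>\<G> \<times>\<^sub>I X\<^esub> (\<lambda>(c, x). Option.bind (epsJ E {s..t} x) (\<lambda>v. Some (inverse c * v)))"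
    "i + 1 \<noteq> s \<and> i \<noteq> s \<and> i \<noteq> t + 1 \<Longrightarrow> epsJ E {s..t} \<circ>\<^sub>m act C i
        \<approx>\<^bsub>\<G> \<times>\<^sub>I X\<^esub> (\<lambda>(c, x). epsJ E {s..t} x)"
    "i = t \<Longrightarrow> epsJ_star E {s..t} \<circ>\<^sub>m act C i
        \<approx>\<^bsub>\<G> \<times>\<^sub>I X\<^esub> (\<lambda>(c, x). Option.bind (epsJ_star E {s..t} x) (\<lambda>v. Some (inverse c * v)))"
    "i + 1 \<noteq> s \<and> i \<noteq> t \<and> i \<noteq> t + 1 \<Longrightarrow> epsJ_star E {s..t} \<circ>\<^sub>m act C i
        \<approx>\<^bsub>\<G> \<times>\<^sub>I X\<^esub> (\<lambda>(c, x). epsJ_star E {s..t} x)"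
proof -
  note * = system[unfolded is_eps_system_def Let_def, THEN conjunct2, THEN conjunct2, rule_format, OF st,
    THEN conjunct1, rule_format, OF i]
  show "i = s \<Longrightarrow> epsJ E {s..t} \<circ>\<^sub>m act C i
        \<approx>\<^bsub>\<G> \<times>\<^sub>I X\<^esub> (\<lambda>(c, x). Option.bind (epsJ E {s..t} x) (\<lambda>v. Some (inverse c * v)))"
    using * by blast
  show "i + 1 \<noteq> s \<and> i \<noteq> s \<and> i \<noteq> t + 1 \<Longrightarrow> epsJ E {s..t} \<circ>\<^sub>m act C i
        \<approx>\<^bsub>\<G> \<times>\<^sub>I X\<^esub> (\<lambda>(c, x). epsJ E {s..t} x)" using * by blast
  show "i = t \<Longrightarrow> epsJ_star E {s..t} \<circ>\<^sub>m act C i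
        \<approx>\<^bsub>\<G> \<times>\<^sub>I X\<^esub> (\<lambda>(c, x). Option.bind (epsJ_star E {s..t} x) (\<lambda>v. Some (inverse c * v)))"
    using * by blast
  show "i + 1 \<noteq> s \<and> i \<noteq> t \<and> i \<noteq> t + 1 \<Longrightarrow> epsJ_star E {s..t} \<circ>\<^sub>m act C i
        \<approx>\<^bsub>\<G> \<times>\<^sub>I X\<^esub> (\<lambda>(c, x). epsJ_star E {s..t} x)" using * by blast
qed

lemma generic_value:
  assumes "f \<circ>\<^sub>m act C i \<approx>\<^bsub>\<G> \<times>\<^sub>I X\<^esub> (\<lambda>(c, x). h c x)"
    and "\<And>c x. x \<in> dom f \<Longrightarrow> h c x = Some (v c (the (f x)))"
  shows "generic (itop (\<G> \<times>\<^sub>I X)) (\<lambda>(c, x). \<forall>x'. act C i (c, x) = Some x' \<longrightarrow> x \<in> dom f \<longrightarrow>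
           the (f x') = v c (the (f x)))"
proof (rule generic_mono[OF rat_eq_generic[OF assms(1)]])
  fix p assume p: "p \<in> dom (f \<circ>\<^sub>m act C i) \<and> p \<in> dom (\<lambda>(c, x). h c x) \<and>
    (f \<circ>\<^sub>m act C i) p = (case p of (c, x) \<Rightarrow> h c x)"
  obtain c x where cx: "p = (c, x)" by fastforce
  have "the (f x') = v c (the (f x))" if "act C i (c, x) = Some x'" "x \<in> dom f" for x'
    using p that assms(2)[of x c] by (simp add: cx map_comp_def)
  then show "case p of (c, x) \<Rightarrow> \<forall>x'. act C i (c, x) = Some x' \<longrightarrow> x \<in> dom f \<longrightarrow>
           the (f x') = v c (the (f x))" by (simp add: cx)
qed

text \<open>
  The point \<open>x'\<close> is regular as well, because an action is dominant.
\<close>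

lemma generic_transforms:
  assumes i: "i \<in> {1..n}"
  shows "generic (itop (\<G> \<times>\<^sub>I X)) (\<lambda>(c, x). c \<noteq> 0 \<and> (\<exists>x'. act C i (c, x) = Some x' \<and> transforms_at i c x x'))"
proof -
  note G = ind_system_Gm
  let ?T = "itop (\<G> \<times>\<^sub>I X)"
  let ?S = "{(s, t). 1 \<le> s \<and> s \<le> t \<and> t \<le> n}"
  have S: "finite ?S" by (rule finite_subset[of _ "{1..n} \<times> {1..n}"]) auto
  obtain B where B: "dense_open (itop X) B" "\<And>x. x \<in> B \<Longrightarrow> eps_regular_point n C E x"
    using generic_regular_point unfolding generic_def by blast
  have 1: "generic ?T (\<lambda>(c, x). (c, x) \<in> dom (act C i) \<and> the (act C i (c, x)) \<in> B)"
    using action_preimage_dense_open[OF ind_system rational(3)[OF i] B(1)] by (rule genericI) auto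
  have "dense_open ?T (ipts \<G> \<times> B)"
    using dense_open_topspace[of "itop \<G>"] B(1)
    by (intro dense_open_iprod_Times[OF G ind_system]) (simp_all add: topspace_itop)
  then have 2: "generic ?T (\<lambda>(c, x). c \<noteq> 0 \<and> x \<in> B)" by (rule genericI) (auto simp: ipts_Gm)
  have 3: "generic ?T (\<lambda>q. \<forall>p\<in>?S. case p of (s, t) \<Rightarrow>
     (i = s \<longrightarrow> (case q of (c, x) \<Rightarrow> \<forall>x'. act C i (c, x) = Some x' \<longrightarrow> x \<in> dom (epsJ E {s..t}) \<longrightarrow>
         the (epsJ E {s..t} x') = inverse c * the (epsJ E {s..t} x))) \<and>
     (i + 1 \<noteq> s \<and> i \<noteq> s \<and> i \<noteq> t + 1 \<longrightarrow> (case q of (c, x) \<Rightarrow> \<forall>x'. act C i (c, x) = Some x' \<longrightarrow>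
         x \<in> dom (epsJ E {s..t}) \<longrightarrow> the (epsJ E {s..t} x') = the (epsJ E {s..t} x))) \<and>
     (i = t \<longrightarrow> (case q of (c, x) \<Rightarrow> \<forall>x'. act C i (c, x) = Some x' \<longrightarrow> x \<in> dom (epsJ_star E {s..t}) \<longrightarrow>
         the (epsJ_star E {s..t} x') = inverse c * the (epsJ_star E {s..t} x))) \<and>
     (i + 1 \<noteq> s \<and> i \<noteq> t \<and> i \<noteq> t + 1 \<longrightarrow> (case q of (c, x) \<Rightarrow> \<forall>x'. act C i (c, x) = Some x' \<longrightarrow>
         x \<in> dom (epsJ_star E {s..t}) \<longrightarrow> the (epsJ_star E {s..t} x') = the (epsJ_star E {s..t} x))))"
    (is "generic ?T (\<lambda>q. \<forall>p\<in>?S. ?Q q p)")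
  proof (rule generic_ball[OF S])
    fix p assume "p \<in> ?S"
    then obtain s t where p: "p = (s, t)" and st: "1 \<le> s \<and> s \<le> t \<and> t \<le> n" by blast
    note ax = eps_axioms[OF i st]
    show "generic ?T (\<lambda>q. ?Q q p)"
      unfolding p prod.case
      by (intro generic_conj generic_imp) (erule ax[THEN generic_value]; auto)+
  qed
  have 4: "generic ?T (\<lambda>q. \<forall>j\<in>{1..n}. case q of (c, x) \<Rightarrow> \<forall>x'. act C i (c, x) = Some x' \<longrightarrow>
       x \<in> dom (gam C j) \<longrightarrow> gam_at C x' j = c powi cartan i j * gam_at C x j)"
  proof (rule generic_ball)
    fix j assume j: "j \<in> {1..n}"
    have "gam C j \<circ>\<^sub>m act C i
           \<approx>\<^bsub>\<G> \<times>\<^sub>I X\<^esub> (\<lambda>(c, x). Option.bind (gam C j x) (\<lambda>v. Some (c powi cartan i j * v)))"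
      using crystal[unfolded geometric_crystal_def Let_def, THEN conjunct2, THEN conjunct2, THEN conjunct2,
        THEN conjunct1, rule_format, OF i j] .
    then show "generic ?T (\<lambda>(c, x). \<forall>x'. act C i (c, x) = Some x' \<longrightarrow>
       x \<in> dom (gam C j) \<longrightarrow> gam_at C x' j = c powi cartan i j * gam_at C x j)"
      by (rule generic_value) auto
  qed simp
  show ?thesis
  proof (rule generic_mono[OF generic_conj[OF 1 generic_conj[OF 2 generic_conj[OF 3 4]]]])
    fix q
    assume q: "(case q of (c, x) \<Rightarrow> (c, x) \<in> dom (act C i) \<and> the (act C i (c, x)) \<in> B) \<and>
      (case q of (c, x) \<Rightarrow> c \<noteq> 0 \<and> x \<in> B) \<and> (\<forall>p\<in>?S. ?Q q p) \<and>
      (\<forall>j\<in>{1..n}. case q of (c, x) \<Rightarrow> \<forall>x'. act C i (c, x) = Some x' \<longrightarrow>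
       x \<in> dom (gam C j) \<longrightarrow> gam_at C x' j = c powi cartan i j * gam_at C x j)"
    obtain c x where cx: "q = (c, x)" by fastforce
    obtain x' where x': "act C i (c, x) = Some x'" "x' \<in> B" using q cx by auto
    have c: "c \<noteq> 0" and x: "x \<in> B" using q cx by auto
    from q have "\<forall>p\<in>?S. ?Q q p" by (elim conjE)
    then have Q: "\<forall>p\<in>?S. ?Q (c, x) p" unfolding cx .
    have g: "\<forall>j\<in>{1..n}. \<forall>x'. act C i (c, x) = Some x' \<longrightarrow>
       x \<in> dom (gam C j) \<longrightarrow> gam_at C x' j = c powi cartan i j * gam_at C x j"
      using q[THEN conjunct2, THEN conjunct2, THEN conjunct2] unfolding cx prod.case .
    have r: "eps_regular_point n C E x" "eps_regular_point n C E x'" using B(2) x x' by auto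
    have M: "M x s (Suc t) = the (epsJ E {s..t} x)" "N x s (Suc t) = the (epsJ_star E {s..t} x)"
      if "s \<le> t" for x s t
      using that by (simp_all add: eps_matrix_less atLeastLessThanSuc_atLeastAtMost)
    have rules: "(i = s \<longrightarrow> M x' s (Suc t) = M x s (Suc t) / c) \<and>
        (i + 1 \<noteq> s \<and> i \<noteq> s \<and> i \<noteq> t + 1 \<longrightarrow> M x' s (Suc t) = M x s (Suc t)) \<and>
        (i = t \<longrightarrow> N x' s (Suc t) = N x s (Suc t) / c) \<and>
        (i + 1 \<noteq> s \<and> i \<noteq> t \<and> i \<noteq> t + 1 \<longrightarrow> N x' s (Suc t) = N x s (Suc t))"
      if "1 \<le> s" "s \<le> t" "t \<le> n" for s t
    proof -
      have D: "x \<in> dom (epsJ E {s..t})" "x \<in> dom (epsJ_star E {s..t})"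
        using r(1) that unfolding eps_regular_point_def intervals_def by blast+
      have "(s, t) \<in> ?S" using that by simp
      from bspec[OF Q this] show ?thesis
        unfolding prod.case M[OF that(2)] divide_inverse mult.commute[of _ "inverse c"]
        using D x'(1) by blast
    qed
    have "eps_transform n i c (M x) (M x')" "eps_star_transform n i c (N x) (N x')"
      unfolding eps_transform_def eps_star_transform_def
    proof (intro allI impI)
      fix a b assume ab: "1 \<le> a \<and> a < b \<and> b \<le> Suc n"
      then obtain t where t: "b = Suc t" "1 \<le> a" "a \<le> t" "t \<le> n" by (cases b) auto
      show "(a = i \<longrightarrow> M x' a b = M x a b / c) \<and> (a \<noteq> i \<and> a \<noteq> Suc i \<and> b \<noteq> i \<longrightarrow> M x' a b = M x a b)"
        using rules[OF t(2-4)] unfolding t(1) by auto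
    next
      show "\<forall>a b. 1 \<le> a \<and> a < b \<and> b \<le> Suc n \<longrightarrow> (b = Suc i \<longrightarrow> N x' a b = N x a b / c) \<and>
          (b \<noteq> Suc i \<and> a \<noteq> Suc i \<and> b \<noteq> i \<longrightarrow> N x' a b = N x a b)"
      proof (intro allI impI)
        fix a b assume ab: "1 \<le> a \<and> a < b \<and> b \<le> Suc n"
        then obtain t where t: "b = Suc t" "1 \<le> a" "a \<le> t" "t \<le> n" by (cases b) auto
        show "(b = Suc i \<longrightarrow> N x' a b = N x a b / c) \<and>
          (b \<noteq> Suc i \<and> a \<noteq> Suc i \<and> b \<noteq> i \<longrightarrow> N x' a b = N x a b)"
          using rules[OF t(2-4)] unfolding t(1) by auto
      qed
    qed
    moreover have "gam_transform n i c (gam_at C x) (gam_at C x')"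
      using g x'(1) r(1) by (simp add: gam_transform_def eps_regular_point_def)
    ultimately have "transforms_at i c x x'" using r unfolding transforms_at_def by blast
    then show "case q of (c, x) \<Rightarrow> c \<noteq> 0 \<and> (\<exists>x'. act C i (c, x) = Some x' \<and> transforms_at i c x x')"
      using c x'(1) by (simp add: cx)
  qed
qed

end

section \<open>The epsilon system of a product\<close>

lemma rsum_eq_Some:
  assumes "\<And>k. k \<in> K \<Longrightarrow> F k x = Some (v k)"
  shows "rsum F K x = Some (\<Sum>k\<in>K. v k)"
  using assms by (auto simp: rsum_def)

lemma rprod_eq_Some:
  assumes "\<And>k. k \<in> K \<Longrightarrow> F k x = Some (v k)"
  shows "rprod F K x = Some (\<Prod>k\<in>K. v k)"
  using assms by (auto simp: rprod_def)

locale eps_crystal_product =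
  CX: eps_crystal n C E + CY: eps_crystal n D F
  for n and C :: "'a crystal" and E :: "'a eps_system" and D :: "'b crystal" and F :: "'b eps_system" +
  assumes product: "geometric_crystal n (prod_crystal C D)"
begin

abbreviation "Z \<equiv> space_of C \<times>\<^sub>I space_of D"
abbreviation "EP \<equiv> prod_eps_system C E F"
abbreviation "MP \<equiv> \<lambda>(x, y). prod_eps_matrix (gam_at C x) (CX.M x) (CY.M y)"
abbreviation "NP \<equiv> \<lambda>(x, y). prod_star_matrix (gam_at C x) (CX.N x) (CY.N y)"

lemma space_of_product: "space_of (prod_crystal C D) = Z"
  by (simp add: prod_crystal_def)

lemma ind_variety_product: "ind_variety Z"
  using product by (simp add: geometric_crystal_def Let_def space_of_product)

lemma space_system_product: "space_system Z"
  by (rule ind_variety_space_system[OF ind_variety_product])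

lemma ind_system_product: "ind_system Z"
  using space_system_product by (simp add: space_system_def)

lemma rational_action_product: "i \<in> {1..n} \<Longrightarrow> rational_action Z (act (prod_crystal C D) i)"
  using product unfolding geometric_crystal_def Let_def space_of_product by blast

text \<open>
  At regular points the partial operations in the product formulas never fail, and the formulas
  are the twisted matrix products, with the summation index shifted by one.
\<close>

lemma prod_epsJ_value:
  assumes x: "eps_regular_point n C E x" and y: "eps_regular_point n D F y"
    and st: "1 \<le> s" "s \<le> t" "t \<le> n"
  shows "epsJ EP {s..t} (x, y) = Some (MP (x, y) s (Suc t))"
    "epsJ_star EP {s..t} (x, y) = Some (NP (x, y) s (Suc t))"
proof -
  have gx: "gam C j x = Some (gam_at C x j)" "gam_at C x j \<noteq> 0" if "1 \<le> j" "j \<le> n" for j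
    using eps_regular_pointD(1,2)[OF x] that by auto
  have mm: "Min {s..t} = s" "Max {s..t} = t" using st by (auto intro: Min_eqI Max_eqI)
  have ivl: "{s..k} = {s..<Suc k}" "{k+1..t} = {Suc k..<Suc t}" for k
    by (simp_all add: atLeastLessThanSuc_atLeastAtMost)
  have "epsJ EP {s..t} (x, y) = Some (\<Sum>k = s-1..t. CY.M y s (Suc k) * CX.M x (Suc k) (Suc t) /
      (\<Prod>j\<in>{s..<Suc k}. gam_at C x j))"
    unfolding prod_eps_system_def eps_system.select_convs Let_def mm
  proof (rule rsum_eq_Some)
    fix k assume k: "k \<in> {s-1..t}"
    have "rprod (\<lambda>j. gam C j \<circ> fst) {s..k} (x, y) = Some (\<Prod>j\<in>{s..<Suc k}. gam_at C x j)"
      unfolding ivl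
    proof (rule rprod_eq_Some)
      fix j assume "j \<in> {s..<Suc k}"
      then show "(gam C j \<circ> fst) (x, y) = Some (gam_at C x j)"
        unfolding comp_apply fst_conv using k st by (intro gx(1)) auto
    qed
    moreover have "(\<Prod>j\<in>{s..<Suc k}. gam_at C x j) \<noteq> 0" using k st gx(2) by auto
    moreover have "with_empty (epsJ F) {s..k} y = Some (CY.M y s (Suc k))"
      unfolding ivl using k st by (intro eps_matrix_Some[OF y]) auto
    moreover have "with_empty (epsJ E) {k+1..t} x = Some (CX.M x (Suc k) (Suc t))"
      unfolding ivl using k st by (intro eps_matrix_Some[OF x]) auto
    ultimately show "((with_empty (epsJ F) {s..k} \<circ> snd) *\<^sub>r (with_empty (epsJ E) {k+1..t} \<circ> fst)
         /\<^sub>r rprod (\<lambda>j. gam C j \<circ> fst) {s..k}) (x, y) =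
       Some (CY.M y s (Suc k) * CX.M x (Suc k) (Suc t) / (\<Prod>j\<in>{s..<Suc k}. gam_at C x j))"
      by (simp add: rdiv_def rmul_def pdiv_def)
  qed
  also have "(\<Sum>k = s-1..t. CY.M y s (Suc k) * CX.M x (Suc k) (Suc t) /
      (\<Prod>j\<in>{s..<Suc k}. gam_at C x j)) = MP (x, y) s (Suc t)"
    using st sum.shift_bounds_cl_Suc_ivl[of "\<lambda>k. CY.M y s k * CX.M x k (Suc t) /
      (\<Prod>j\<in>{s..<k}. gam_at C x j)" "s - 1" t] by (simp add: prod_eps_matrix_def)
  finally show "epsJ EP {s..t} (x, y) = Some (MP (x, y) s (Suc t))" .
  have "epsJ_star EP {s..t} (x, y) = Some (\<Sum>k = s-1..t. CX.N x s (Suc k) * CY.N y (Suc k) (Suc t) /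
      (\<Prod>j\<in>{Suc k..<Suc t}. gam_at C x j))"
    unfolding prod_eps_system_def eps_system.select_convs Let_def mm
  proof (rule rsum_eq_Some)
    fix k assume k: "k \<in> {s-1..t}"
    have "rprod (\<lambda>j. gam C j \<circ> fst) {k+1..t} (x, y) = Some (\<Prod>j\<in>{Suc k..<Suc t}. gam_at C x j)"
      unfolding ivl
    proof (rule rprod_eq_Some)
      fix j assume "j \<in> {Suc k..<Suc t}"
      then show "(gam C j \<circ> fst) (x, y) = Some (gam_at C x j)"
        unfolding comp_apply fst_conv using k st by (intro gx(1)) auto
    qed
    moreover have "(\<Prod>j\<in>{Suc k..<Suc t}. gam_at C x j) \<noteq> 0" using k st gx(2) by auto
    moreover have "with_empty (epsJ_star E) {s..k} x = Some (CX.N x s (Suc k))"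
      unfolding ivl using k st by (intro eps_matrix_Some[OF x]) auto
    moreover have "with_empty (epsJ_star F) {k+1..t} y = Some (CY.N y (Suc k) (Suc t))"
      unfolding ivl using k st by (intro eps_matrix_Some[OF y]) auto
    ultimately show "((with_empty (epsJ_star E) {s..k} \<circ> fst) *\<^sub>r (with_empty (epsJ_star F) {k+1..t} \<circ> snd)
         /\<^sub>r rprod (\<lambda>j. gam C j \<circ> fst) {k+1..t}) (x, y) =
       Some (CX.N x s (Suc k) * CY.N y (Suc k) (Suc t) / (\<Prod>j\<in>{Suc k..<Suc t}. gam_at C x j))"
      by (simp add: rdiv_def rmul_def pdiv_def)
  qed
  also have "(\<Sum>k = s-1..t. CX.N x s (Suc k) * CY.N y (Suc k) (Suc t) /
      (\<Prod>j\<in>{Suc k..<Suc t}. gam_at C x j)) = NP (x, y) s (Suc t)"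
    using st sum.shift_bounds_cl_Suc_ivl[of "\<lambda>k. CX.N x s k * CY.N y k (Suc t) /
      (\<Prod>j\<in>{k..<Suc t}. gam_at C x j)" "s - 1" t] by (simp add: prod_star_matrix_def)
  finally show "epsJ_star EP {s..t} (x, y) = Some (NP (x, y) s (Suc t))" .
qed

lemma generic_product:
  assumes "generic (itop (space_of C)) P" "generic (itop (space_of D)) Q"
  shows "generic (itop Z) (\<lambda>(x, y). P x \<and> Q y)"
proof -
  obtain U V where "dense_open (itop (space_of C)) U" "\<forall>x\<in>U. P x"
    "dense_open (itop (space_of D)) V" "\<forall>y\<in>V. Q y" using assms unfolding generic_def by blast
  then show ?thesis
    by (intro genericI[OF dense_open_iprod_Times[OF CX.ind_system CY.ind_system]]) auto
qed

abbreviation regular_pair :: "'a \<times> 'b \<Rightarrow> bool" where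
  "regular_pair \<equiv> \<lambda>(x, y). eps_regular_point n C E x \<and> eps_regular_point n D F y"

lemma generic_regular_pair: "generic (itop Z) regular_pair"
  by (rule generic_product[OF CX.generic_regular_point CY.generic_regular_point])

lemma regular_partial_with_empty:
  assumes "\<And>J. J \<in> intervals n \<Longrightarrow> rational_function X (f J)" "space_system X" "1 \<le> s" "t \<le> n"
  shows "regular_partial X (with_empty f {s..t})"
proof (cases "s \<le> t")
  case True
  then have "{s..t} \<in> intervals n" using assms by (auto simp: intervals_def)
  then show ?thesis using True assms by (auto simp: with_empty_def intro: rational_function_regular_partial)
next
  case False
  then show ?thesis using regular_partial_const[OF assms(2), of 1] by (simp add: with_empty_def)
qed

text \<open>
  The summands \<open>k = s - 1\<close> and \<open>k = t\<close> involve \<open>\<epsilon>\<^sub>J\<close> of the one factor and of the other, so that the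
  domain lies inside the product space although single summands are defined outside it.
\<close>

lemma rational_function_prod_epsJ:
  assumes st: "1 \<le> s" "s \<le> t" "t \<le> n"
  shows "rational_function Z (epsJ EP {s..t})" "rational_function Z (epsJ_star EP {s..t})"
proof -
  note sys = CX.ind_system CY.ind_system
  have mm: "Min {s..t} = s" "Max {s..t} = t" using st by (auto intro: Min_eqI Max_eqI)
  have J: "{s..t} \<in> intervals n" using st by (auto simp: intervals_def)
  have ne: "{s..t} \<noteq> {}" using st by auto
  obtain B where B: "dense_open (itop Z) B" "\<And>z. z \<in> B \<Longrightarrow> regular_pair z"
    using generic_regular_pair unfolding generic_def by blast
  have gam: "regular_partial Z (gam C j \<circ> fst)" if "j \<in> {1..n}" for j
    by (intro regular_partial_comp_fst[OF sys _ space_system_product] rational_function_regular_partial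
        CX.rational(1)[OF that])
  have sub: "dom (with_empty f {s..t}) \<subseteq> ipts X" if "rational_function X (f {s..t})"
    for f and X :: "'z indspace"
    using that ne by (auto simp: with_empty_def rational_function_def dense_open_def openin_itop)
  have reg: "regular_partial Z (epsJ EP {s..t})"
    unfolding prod_eps_system_def eps_system.select_convs Let_def mm
    by (intro regular_partial_rsum[OF space_system_product] regular_partial_rdiv[OF space_system_product]
        regular_partial_rmul[OF space_system_product] regular_partial_rprod[OF space_system_product]
        regular_partial_comp_fst[OF sys _ space_system_product]
        regular_partial_comp_snd[OF sys _ space_system_product] regular_partial_with_empty
        CX.rational_epsJ CY.rational_epsJ CX.space_system CY.space_system
        rational_function_regular_partial CX.rational(1)) (use st in auto)
  have "dom (epsJ EP {s..t}) \<subseteq> dom (with_empty (epsJ E) {s..t} \<circ> fst) \<inter> dom (with_empty (epsJ F) {s..t} \<circ> snd)"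
  proof
    fix z assume "z \<in> dom (epsJ EP {s..t})"
    then have "\<forall>k\<in>{s-1..t}. z \<in> dom (with_empty (epsJ F) {s..k} \<circ> snd) \<and>
        z \<in> dom (with_empty (epsJ E) {k+1..t} \<circ> fst)"
      unfolding prod_eps_system_def eps_system.select_convs Let_def mm
      by (simp add: dom_rsum dom_rdiv dom_rmul)
    from bspec[OF this, of "s - 1"] bspec[OF this, of t]
    show "z \<in> dom (with_empty (epsJ E) {s..t} \<circ> fst) \<inter> dom (with_empty (epsJ F) {s..t} \<circ> snd)"
      using st by simp
  qed
  also have "\<dots> \<subseteq> dom (with_empty (epsJ E) {s..t}) \<times> dom (with_empty (epsJ F) {s..t})" by auto
  also have "\<dots> \<subseteq> ipts Z"
    unfolding ipts_iprod[OF sys] by (intro Sigma_mono sub CX.rational_epsJ CY.rational_epsJ J)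
  finally show "rational_function Z (epsJ EP {s..t})"
    by (rule rational_functionI[OF reg _ B(1)]) (use B(2) st in \<open>fastforce simp: prod_epsJ_value\<close>)
  have reg': "regular_partial Z (epsJ_star EP {s..t})"
    unfolding prod_eps_system_def eps_system.select_convs Let_def mm
    by (intro regular_partial_rsum[OF space_system_product] regular_partial_rdiv[OF space_system_product]
        regular_partial_rmul[OF space_system_product] regular_partial_rprod[OF space_system_product]
        regular_partial_comp_fst[OF sys _ space_system_product]
        regular_partial_comp_snd[OF sys _ space_system_product] regular_partial_with_empty
        CX.rational_epsJ CY.rational_epsJ CX.space_system CY.space_system
        rational_function_regular_partial CX.rational(1)) (use st in auto)
  have "dom (epsJ_star EP {s..t}) \<subseteq>
     dom (with_empty (epsJ_star E) {s..t} \<circ> fst) \<inter> dom (with_empty (epsJ_star F) {s..t} \<circ> snd)"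
  proof
    fix z assume "z \<in> dom (epsJ_star EP {s..t})"
    then have "\<forall>k\<in>{s-1..t}. z \<in> dom (with_empty (epsJ_star E) {s..k} \<circ> fst) \<and>
        z \<in> dom (with_empty (epsJ_star F) {k+1..t} \<circ> snd)"
      unfolding prod_eps_system_def eps_system.select_convs Let_def mm
      by (simp add: dom_rsum dom_rdiv dom_rmul)
    from bspec[OF this, of "s - 1"] bspec[OF this, of t]
    show "z \<in> dom (with_empty (epsJ_star E) {s..t} \<circ> fst) \<inter> dom (with_empty (epsJ_star F) {s..t} \<circ> snd)"
      using st by simp
  qed
  also have "\<dots> \<subseteq> dom (with_empty (epsJ_star E) {s..t}) \<times> dom (with_empty (epsJ_star F) {s..t})" by auto
  also have "\<dots> \<subseteq> ipts Z"
    unfolding ipts_iprod[OF sys] by (intro Sigma_mono sub CX.rational_epsJ CY.rational_epsJ J)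
  finally show "rational_function Z (epsJ_star EP {s..t})"
    by (rule rational_functionI[OF reg' _ B(1)]) (use B(2) st in \<open>fastforce simp: prod_epsJ_value\<close>)
qed

definition pair_transforms :: "nat \<Rightarrow> complex \<Rightarrow> 'a \<times> 'b \<Rightarrow> bool" where
  "pair_transforms i c z \<longleftrightarrow> (\<exists>z'. act (prod_crystal C D) i (c, z) = Some z' \<and>
     regular_pair z \<and> regular_pair z' \<and>
     eps_transform n i c (MP z) (MP z') \<and> eps_star_transform n i c (NP z) (NP z'))"

text \<open>
  The place where the explicit \<open>c\<^sub>1\<close> and \<open>c\<^sub>2\<close> enter: with \<open>a = \<gamma>\<^sub>i \<epsilon>\<^sub>i\<close> on the first factor and \<open>b = \<epsilon>\<^sub>i\<close> on
  the second, \<open>c\<^sub>1 - 1 = (c - 1) a / (a + b)\<close> and \<open>(c\<^sub>2 - 1) c\<^sub>1 = (c - 1) b / (a + b)\<close>.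
\<close>

lemma pair_transformsI:
  assumes i: "i \<in> {1..n}" and c: "c \<noteq> 0"
    and x: "act C i (c\<^sub>1, x) = Some x'" "CX.transforms_at i c\<^sub>1 x x'"
    and y: "act D i (c\<^sub>2, y) = Some y'" "CY.transforms_at i c\<^sub>2 y y'"
    and a: "a = gam_at C x i * the (eps C i x)" and b: "b = the (eps D i y)"
    and c12: "a + b \<noteq> 0" "c * a + b \<noteq> 0" "c\<^sub>1 = (c * a + b) / (a + b)" "c\<^sub>2 = c / c\<^sub>1"
  shows "pair_transforms i c (x, y)"
proof -
  have rx: "eps_regular_point n C E x" "eps_regular_point n C E x'" and
    ry: "eps_regular_point n D F y" "eps_regular_point n D F y'"
    using x(2) y(2) by (auto simp: CX.transforms_at_def CY.transforms_at_def)
  have c1: "c\<^sub>1 \<noteq> 0" and c2: "c\<^sub>2 \<noteq> 0" using c12 c by auto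
  note px = eps_regular_pointD(1,3)[OF rx(1) i] eps_regular_pointD(3)[OF ry(1) i]
  obtain g where g: "gam C i x = Some g" "gam_at C x i = g" using px(1) by blast
  have "pdiv (c * g * CX.M x i (Suc i) + CY.M y i (Suc i)) (g * CX.M x i (Suc i) + CY.M y i (Suc i)) = Some c\<^sub>1"
    "pdiv c c\<^sub>1 = Some c\<^sub>2"
    using c12 c1 by (simp_all add: pdiv_def a b px(2,3) g(2) mult.assoc)
  then have "act (prod_crystal C D) i (c, x, y) = Some (x', y')"
    by (simp add: prod_crystal_def g(1) px(2,3) x(1) y(1))
  moreover have g: "gam_at C x j \<noteq> 0" if "1 \<le> j" "j \<le> n" for j
    using eps_regular_pointD(2)[OF rx(1)] that by auto
  have e: "the (eps C i x) = CX.M x i (Suc i)" "the (eps D i y) = CY.M y i (Suc i)"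
    "the (eps C i x) \<noteq> 0" "the (eps D i y) \<noteq> 0"
    using eps_regular_pointD(4)[OF rx(1) i] eps_regular_pointD(4)[OF ry(1) i] by (simp_all add: px(2,3))
  interpret product_change n i c\<^sub>1 "CX.M x" "CX.N x" "CX.M x'" "CX.N x'"
    c\<^sub>2 "CY.M y" "CY.N y" "CY.M y'" "CY.N y'" "gam_at C x" "gam_at C x'"
  proof unfold_locales
    show "signed_inverse 1 (Suc n) (CX.M x) (CX.N x)" "signed_inverse 1 (Suc n) (CX.M x') (CX.N x')"
      "signed_inverse 1 (Suc n) (CY.M y) (CY.N y)" "signed_inverse 1 (Suc n) (CY.M y') (CY.N y')"
      by (fact eps_regular_pointD(5)[OF rx(1)] eps_regular_pointD(5)[OF rx(2)]
          eps_regular_pointD(5)[OF ry(1)] eps_regular_pointD(5)[OF ry(2)])+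
    show "eps_transform n i c\<^sub>1 (CX.M x) (CX.M x')" "eps_star_transform n i c\<^sub>1 (CX.N x) (CX.N x')"
      "gam_transform n i c\<^sub>1 (gam_at C x) (gam_at C x')"
      using x(2) by (simp_all add: CX.transforms_at_def)
    show "eps_transform n i c\<^sub>2 (CY.M y) (CY.M y')" "eps_star_transform n i c\<^sub>2 (CY.N y) (CY.N y')"
      using y(2) by (simp_all add: CY.transforms_at_def)
    have "(c\<^sub>1 - 1) * b = (c\<^sub>2 - 1) * c\<^sub>1 * a"
      using c12 c1 by (simp add: left_diff_distrib) (simp add: field_simps)
    then show "(c\<^sub>1 - 1) * CY.M y i (Suc i) = (c\<^sub>2 - 1) * c\<^sub>1 * (gam_at C x i * CX.M x i (Suc i))"
      by (simp add: a b e)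
  qed (use i c1 c2 g e in auto)
  have cc: "c\<^sub>1 * c\<^sub>2 = c" using c12(4) c1 by simp
  have "eps_transform n i c (MP (x, y)) (MP (x', y'))"
    unfolding eps_transform_def prod.case
    using prod_eps_matrix_change i by (auto simp: cc)
  moreover have "eps_star_transform n i c (NP (x, y)) (NP (x', y'))"
    unfolding eps_star_transform_def prod.case
    using prod_star_matrix_change i by (auto simp: cc)
  ultimately show ?thesis using rx ry unfolding pair_transforms_def by auto
qed

text \<open>
  For fixed \<open>(x, y)\<close> the parameters \<open>c\<^sub>1\<close> and \<open>c\<^sub>2\<close> are injective fractional linear functions of \<open>c\<close>, since
  \<open>a\<close>, \<open>b\<close> and \<open>a + b\<close> are nonzero. The values of \<open>c\<^sub>1\<close> and \<open>c\<^sub>2\<close> that are bad for \<open>x\<close> and for \<open>y\<close> are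
  finite in number, so only finitely many \<open>c\<close> are bad for the pair.
\<close>

lemma generic_pair_transforms:
  assumes i: "i \<in> {1..n}"
  shows "generic (itop Z) (\<lambda>z. finite {c. c \<noteq> 0 \<and> \<not> pair_transforms i c z})"
proof -
  note G = ind_system_Gm
  have Gne: "ipts \<G> \<noteq> {}" using ipts_Gm by (auto intro: exI[of _ 1])
  obtain WX where WX: "dense_open (itop (\<G> \<times>\<^sub>I space_of C)) WX" "\<And>c x. (c, x) \<in> WX \<Longrightarrow>
      c \<noteq> 0 \<and> (\<exists>x'. act C i (c, x) = Some x' \<and> CX.transforms_at i c x x')"
    using CX.generic_transforms[OF i] unfolding generic_def by fastforce
  obtain WY where WY: "dense_open (itop (\<G> \<times>\<^sub>I space_of D)) WY" "\<And>c y. (c, y) \<in> WY \<Longrightarrow>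
      c \<noteq> 0 \<and> (\<exists>y'. act D i (c, y) = Some y' \<and> CY.transforms_at i c y y')"
    using CY.generic_transforms[OF i] unfolding generic_def by fastforce
  have 1: "generic (itop Z) (\<lambda>(x, y). (\<exists>c. (c, x) \<in> WX) \<and> (\<exists>c. (c, y) \<in> WY))"
    using dense_open_projection[OF G CX.ind_system WX(1) Gne]
      dense_open_projection[OF G CY.ind_system WY(1) Gne]
    by (intro generic_product) (auto intro: genericI)
  have "dense_open (itop (\<G> \<times>\<^sub>I Z)) (dom (act (prod_crystal C D) i))"
    using rational_action_product[OF i] by (simp add: rational_action_def rational_map_def)
  from dense_open_projection[OF G ind_system_product this Gne]
  have 2: "generic (itop Z) (\<lambda>z. \<exists>c. (c, z) \<in> dom (act (prod_crystal C D) i))"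
    by (auto intro: genericI)
  show ?thesis
  proof (rule generic_mono[OF generic_conj[OF 1 generic_conj[OF 2 generic_regular_pair]]], clarify)
    fix x y cx cy cz x2 y2
    assume cx: "(cx, x) \<in> WX" and cy: "(cy, y) \<in> WY"
      and cz: "act (prod_crystal C D) i (cz, x, y) = Some (x2, y2)"
      and rx: "eps_regular_point n C E x" and ry: "eps_regular_point n D F y"
    define a where "a = gam_at C x i * the (eps C i x)"
    define b where "b = the (eps D i y)"
    note px = eps_regular_pointD(1,3)[OF rx i] eps_regular_pointD(3)[OF ry i]
    have a: "a \<noteq> 0" and b: "b \<noteq> 0"
      using eps_regular_pointD(2,4)[OF rx i] eps_regular_pointD(4)[OF ry i]
      by (simp_all add: a_def b_def px(2,3))
    \<comment> \<open>The product action is defined at some \<open>(cz, x, y)\<close>, which requires this denominator.\<close>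
    have ab: "a + b \<noteq> 0"
    proof
      assume "a + b = 0"
      moreover obtain g where "gam C i x = Some g" "gam_at C x i = g" using px(1) by blast
      ultimately have "g * CX.M x i (Suc i) + CY.M y i (Suc i) = 0" "gam C i x = Some g"
        by (simp_all add: a_def b_def px(2,3))
      then show False using cz by (simp add: prod_crystal_def pdiv_def px(2,3))
    qed
    define c\<^sub>1 where "c\<^sub>1 c = (c * a + b) / (a + b)" for c
    define c\<^sub>2 where "c\<^sub>2 c = c / c\<^sub>1 c" for c
    have FX: "finite (- {c. (c, x) \<in> WX})"
      using openin_itop_Gm_cofinite[OF openin_iprod_slice_fst[OF G CX.ind_system dense_openD(1)[OF WX(1)]]] cx
      by blast
    have FY: "finite (- {c. (c, y) \<in> WY})"
      using openin_itop_Gm_cofinite[OF openin_iprod_slice_fst[OF G CY.ind_system dense_openD(1)[OF WY(1)]]] cy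
      by blast
    let ?K = "{c. c \<noteq> 0 \<and> c * a + b \<noteq> 0}"
    have "inj_on c\<^sub>1 ?K" using a ab by (auto simp: inj_on_def c\<^sub>1_def)
    then have f1: "finite (c\<^sub>1 -` (- {c. (c, x) \<in> WX}) \<inter> ?K)" by (rule finite_vimage_IntI[OF FX])
    have "inj_on c\<^sub>2 ?K"
    proof (rule inj_onI)
      fix c d assume cd: "c \<in> ?K" "d \<in> ?K" "c\<^sub>2 c = c\<^sub>2 d"
      then have "c * (a + b) / (c * a + b) = d * (a + b) / (d * a + b)"
        by (simp add: c\<^sub>2_def c\<^sub>1_def)
      then have "c * (a + b) * (d * a + b) = d * (a + b) * (c * a + b)"
        using cd(1,2) by (subst (asm) frac_eq_eq) simp_all
      then have "(a + b) * (b * (c - d)) = 0" by (simp add: algebra_simps)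
      then show "c = d" using b ab by simp
    qed
    then have f2: "finite (c\<^sub>2 -` (- {c. (c, y) \<in> WY}) \<inter> ?K)" by (rule finite_vimage_IntI[OF FY])
    have "{c. c \<noteq> 0 \<and> \<not> pair_transforms i c (x, y)} \<subseteq>
       {- b / a} \<union> (c\<^sub>1 -` (- {c. (c, x) \<in> WX}) \<inter> ?K) \<union> (c\<^sub>2 -` (- {c. (c, y) \<in> WY}) \<inter> ?K)"
    proof
      fix c assume c: "c \<in> {c. c \<noteq> 0 \<and> \<not> pair_transforms i c (x, y)}"
      show "c \<in> {- b / a} \<union> (c\<^sub>1 -` (- {c. (c, x) \<in> WX}) \<inter> ?K) \<union> (c\<^sub>2 -` (- {c. (c, y) \<in> WY}) \<inter> ?K)"
      proof (rule ccontr)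
        assume out: "\<not> ?thesis"
        then have "c \<noteq> - b / a" by simp
        moreover have "c = - b / a" if "c * a + b = 0"
        proof -
          have "c * a = - b" using that by (simp add: eq_neg_iff_add_eq_0)
          then show ?thesis using a by (simp only: nonzero_eq_divide_eq not_False_eq_True)
        qed
        ultimately have k: "c * a + b \<noteq> 0" by blast
        then have "(c\<^sub>1 c, x) \<in> WX" "(c\<^sub>2 c, y) \<in> WY" using out c by simp_all
        then obtain x' y' where "act C i (c\<^sub>1 c, x) = Some x'" "CX.transforms_at i (c\<^sub>1 c) x x'"
          "act D i (c\<^sub>2 c, y) = Some y'" "CY.transforms_at i (c\<^sub>2 c) y y'"
          using WX(2) WY(2) by blast
        then have "pair_transforms i c (x, y)"
          using i c k ab by (intro pair_transformsI[OF i _ _ _ _ _ a_def b_def]) (auto simp: c\<^sub>1_def c\<^sub>2_def)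
        then show False using c by blast
      qed
    qed
    then show "finite {c. c \<noteq> 0 \<and> \<not> pair_transforms i c (x, y)}"
      by (rule finite_subset) (use f1 f2 in simp)
  qed
qed

lemma product_value_rat_eq:
  assumes i: "i \<in> {1..n}" and f: "rational_function Z f" and u: "u \<in> reg Gm (pts Gm)"
    and val: "\<And>z. regular_pair z \<Longrightarrow> f z = Some (R z)"
    and R: "\<And>c z z'. eps_transform n i c (MP z) (MP z') \<Longrightarrow> eps_star_transform n i c (NP z) (NP z') \<Longrightarrow>
          R z' = u c * R z"
  shows "f \<circ>\<^sub>m act (prod_crystal C D) i \<approx>\<^bsub>\<G> \<times>\<^sub>I Z\<^esub> (\<lambda>(c, z). map_option (\<lambda>v. u c * v) (f z))"
proof -
  obtain B where B: "dense_open (itop Z) B" "\<And>z. z \<in> B \<Longrightarrow> finite {c. c \<noteq> 0 \<and> \<not> pair_transforms i c z}"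
    using generic_pair_transforms[OF i] unfolding generic_def by blast
  show ?thesis
  proof (rule action_rat_eq[OF ind_system_product rational_action_product[OF i] f u B(1)])
    fix z assume "z \<in> B"
    from B(2)[OF this]
    show "finite {c. c \<noteq> 0 \<and> \<not> (\<exists>z'. act (prod_crystal C D) i (c, z) = Some z' \<and>
        z \<in> dom f \<and> z' \<in> dom f \<and> the (f z') = u c * the (f z))}"
    proof (rule rev_finite_subset, intro Collect_mono conjI impI; elim conjE)
      fix c assume no: "\<not> (\<exists>z'. act (prod_crystal C D) i (c, z) = Some z' \<and>
        z \<in> dom f \<and> z' \<in> dom f \<and> the (f z') = u c * the (f z))"
      show "\<not> pair_transforms i c z"
      proof
        assume "pair_transforms i c z"
        then obtain z' where z': "act (prod_crystal C D) i (c, z) = Some z'" "regular_pair z" "regular_pair z'"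
          "eps_transform n i c (MP z) (MP z')" "eps_star_transform n i c (NP z) (NP z')"
          unfolding pair_transforms_def by blast
        have "the (f z') = u c * the (f z)" "z \<in> dom f" "z' \<in> dom f"
          using val[OF z'(2)] val[OF z'(3)] R[OF z'(4,5)] by auto
        then show False using no z'(1) by blast
      qed
    qed
  qed
qed

lemma product_transform_rules:
  assumes i: "i \<in> {1..n}" and st: "1 \<le> s" "s \<le> t" "t \<le> n"
  shows "i = s \<Longrightarrow> epsJ EP {s..t} \<circ>\<^sub>m act (prod_crystal C D) i
        \<approx>\<^bsub>\<G> \<times>\<^sub>I Z\<^esub> (\<lambda>(c, x). Option.bind (epsJ EP {s..t} x) (\<lambda>v. Some (inverse c * v)))"
    "i + 1 \<noteq> s \<and> i \<noteq> s \<and> i \<noteq> t + 1 \<Longrightarrow> epsJ EP {s..t} \<circ>\<^sub>m act (prod_crystal C D) i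
        \<approx>\<^bsub>\<G> \<times>\<^sub>I Z\<^esub> (\<lambda>(c, x). epsJ EP {s..t} x)"
    "i = t \<Longrightarrow> epsJ_star EP {s..t} \<circ>\<^sub>m act (prod_crystal C D) i
        \<approx>\<^bsub>\<G> \<times>\<^sub>I Z\<^esub> (\<lambda>(c, x). Option.bind (epsJ_star EP {s..t} x) (\<lambda>v. Some (inverse c * v)))"
    "i + 1 \<noteq> s \<and> i \<noteq> t \<and> i \<noteq> t + 1 \<Longrightarrow> epsJ_star EP {s..t} \<circ>\<^sub>m act (prod_crystal C D) i
        \<approx>\<^bsub>\<G> \<times>\<^sub>I Z\<^esub> (\<lambda>(c, x). epsJ_star EP {s..t} x)"
proof -
  have inv: "(\<lambda>(c, x). map_option (\<lambda>v. inverse c * v) (f x)) =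
      (\<lambda>(c, x). Option.bind (f x) (\<lambda>v. Some (inverse c * v)))"
    and one: "(\<lambda>(c, x). map_option (\<lambda>v. 1 * v) (f x)) = (\<lambda>(c, x). f x)" for f :: "'a \<times> 'b \<rightharpoonup> complex"
    by (auto simp: fun_eq_iff map_option_case option.map_ident split: option.splits bind_splits)
  note iu = inverse_reg_Gm
  have ou: "(\<lambda>_. 1) \<in> reg Gm (pts Gm)" by (rule reg_const[OF function_algebras_Gm openin_topspace])
  have val: "epsJ EP {s..t} z = Some (MP z s (Suc t))" "epsJ_star EP {s..t} z = Some (NP z s (Suc t))"
    if "regular_pair z" for z
    using that st by (auto simp: prod_epsJ_value)
  note rat = rational_function_prod_epsJ[OF st]
  have scale: "MP z' s (Suc t) = inverse c * MP z s (Suc t)"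
    if "eps_transform n i c (MP z) (MP z')" "i = s" for c z z'
    using that(1)[unfolded eps_transform_def, rule_format, of s "Suc t"] that(2) st
    by (simp add: divide_inverse mult.commute)
  have same: "MP z' s (Suc t) = 1 * MP z s (Suc t)"
    if "eps_transform n i c (MP z) (MP z')" "i + 1 \<noteq> s \<and> i \<noteq> s \<and> i \<noteq> t + 1" for c z z'
    using that(1)[unfolded eps_transform_def, rule_format, of s "Suc t"] that(2) st by simp
  have star_scale: "NP z' s (Suc t) = inverse c * NP z s (Suc t)"
    if "eps_star_transform n i c (NP z) (NP z')" "i = t" for c z z'
    using that(1)[unfolded eps_star_transform_def, rule_format, of s "Suc t"] that(2) st
    by (simp add: divide_inverse mult.commute)
  have star_same: "NP z' s (Suc t) = 1 * NP z s (Suc t)"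
    if "eps_star_transform n i c (NP z) (NP z')" "i + 1 \<noteq> s \<and> i \<noteq> t \<and> i \<noteq> t + 1" for c z z'
    using that(1)[unfolded eps_star_transform_def, rule_format, of s "Suc t"] that(2) st by simp
  show "epsJ EP {s..t} \<circ>\<^sub>m act (prod_crystal C D) i
        \<approx>\<^bsub>\<G> \<times>\<^sub>I Z\<^esub> (\<lambda>(c, x). Option.bind (epsJ EP {s..t} x) (\<lambda>v. Some (inverse c * v)))" if "i = s"
    unfolding inv[symmetric]
    by (rule product_value_rat_eq[where R = "\<lambda>z. MP z s (Suc t)", OF i rat(1) iu val(1)])
      (assumption, erule scale[OF _ that])
  show "epsJ EP {s..t} \<circ>\<^sub>m act (prod_crystal C D) i \<approx>\<^bsub>\<G> \<times>\<^sub>I Z\<^esub> (\<lambda>(c, x). epsJ EP {s..t} x)"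
    if "i + 1 \<noteq> s \<and> i \<noteq> s \<and> i \<noteq> t + 1"
  proof -
    have "epsJ EP {s..t} \<circ>\<^sub>m act (prod_crystal C D) i
        \<approx>\<^bsub>\<G> \<times>\<^sub>I Z\<^esub> (\<lambda>(c, z). map_option (\<lambda>v. 1 * v) (epsJ EP {s..t} z))"
      by (rule product_value_rat_eq[where R = "\<lambda>z. MP z s (Suc t)", OF i rat(1) ou val(1)])
        (assumption, erule same[OF _ that])
    then show ?thesis unfolding one .
  qed
  show "epsJ_star EP {s..t} \<circ>\<^sub>m act (prod_crystal C D) i
        \<approx>\<^bsub>\<G> \<times>\<^sub>I Z\<^esub> (\<lambda>(c, x). Option.bind (epsJ_star EP {s..t} x) (\<lambda>v. Some (inverse c * v)))" if "i = t"
    unfolding inv[symmetric]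
    by (rule product_value_rat_eq[where R = "\<lambda>z. NP z s (Suc t)", OF i rat(2) iu val(2)])
      (assumption, erule star_scale[OF _ that])
  show "epsJ_star EP {s..t} \<circ>\<^sub>m act (prod_crystal C D) i \<approx>\<^bsub>\<G> \<times>\<^sub>I Z\<^esub> (\<lambda>(c, x). epsJ_star EP {s..t} x)"
    if "i + 1 \<noteq> s \<and> i \<noteq> t \<and> i \<noteq> t + 1"
  proof -
    have "epsJ_star EP {s..t} \<circ>\<^sub>m act (prod_crystal C D) i
        \<approx>\<^bsub>\<G> \<times>\<^sub>I Z\<^esub> (\<lambda>(c, z). map_option (\<lambda>v. 1 * v) (epsJ_star EP {s..t} z))"
      by (rule product_value_rat_eq[where R = "\<lambda>z. NP z s (Suc t)", OF i rat(2) ou val(2)])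
        (assumption, erule star_same[OF _ that])
    then show ?thesis unfolding one .
  qed
qed

lemma prod_epsJ_singleton:
  assumes i: "i \<in> {1..n}"
  shows "epsJ EP {i} \<approx>\<^bsub>Z\<^esub> eps (prod_crystal C D) i"
proof -
  obtain B where B: "dense_open (itop Z) B" "\<And>z. z \<in> B \<Longrightarrow> regular_pair z"
    using generic_regular_pair unfolding generic_def by blast
  have "epsJ EP {i} z \<noteq> None \<and> epsJ EP {i} z = eps (prod_crystal C D) i z" if "z \<in> B" for z
  proof -
    obtain x y where z: "z = (x, y)" by fastforce
    have r: "eps_regular_point n C E x" "eps_regular_point n D F y" using B(2)[OF that] z by auto
    note p = eps_regular_pointD(1,2,3)[OF r(1) i] eps_regular_pointD(3)[OF r(2) i]
    have "epsJ EP {i} z = Some (MP (x, y) i (Suc i))"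
      using prod_epsJ_value(1)[OF r, of i i] i z by simp
    also have "MP (x, y) i (Suc i) = CX.M x i (Suc i) + CY.M y i (Suc i) / gam_at C x i"
      by (simp add: prod_eps_matrix_def eps_matrix_diag)
    finally have "epsJ EP {i} z = Some (CX.M x i (Suc i) + CY.M y i (Suc i) / gam_at C x i)" .
    moreover obtain g where "gam C i x = Some g" "gam_at C x i = g" using p(1) by blast
    ultimately have "gam C i x = Some g" "g \<noteq> 0"
      "epsJ EP {i} z = Some (CX.M x i (Suc i) + CY.M y i (Suc i) / g)"
      using p(2) by simp_all
    then show ?thesis by (simp add: z prod_crystal_def radd_def rdiv_def pdiv_def p(3,4))
  qed
  then have "B \<subseteq> dom (epsJ EP {i}) \<inter> dom (eps (prod_crystal C D) i)"
    "\<forall>z\<in>B. epsJ EP {i} z = eps (prod_crystal C D) i z"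
    unfolding subset_iff Int_iff domIff by metis+
  then show ?thesis unfolding rat_eq_def using B(1) by (intro exI[of _ B] conjI)
qed

text \<open>
  The inverse relation for the product, read backwards as a partition sum.
\<close>

lemma prod_star_partition:
  assumes st: "1 \<le> s" "s \<le> t" "t \<le> n"
  shows "epsJ_star EP {s..t} \<approx>\<^bsub>Z\<^esub> signed_partition_rsum (epsJ EP) {s..t}"
proof -
  obtain B where B: "dense_open (itop Z) B" "\<And>z. z \<in> B \<Longrightarrow> regular_pair z"
    using generic_regular_pair unfolding generic_def by blast
  have "z \<in> dom (epsJ_star EP {s..t}) \<and> z \<in> dom (signed_partition_rsum (epsJ EP) {s..t}) \<and>
     epsJ_star EP {s..t} z = signed_partition_rsum (epsJ EP) {s..t} z" if "z \<in> B" for z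
  proof -
    obtain x y where z: "z = (x, y)" by fastforce
    have r: "eps_regular_point n C E x" "eps_regular_point n D F y" using B(2)[OF that] z by auto
    have v: "epsJ EP {a..<b} z = Some (MP z a b)" if "1 \<le> a" "a < b" "b \<le> Suc n" for a b
      using prod_epsJ_value(1)[OF r, of a "b - 1"] that z by (simp add: half_open_interval)
    have inv: "signed_inverse 1 (Suc n) (MP z) (NP z)"
      unfolding z prod.case
      by (rule signed_inverse_product[OF eps_regular_pointD(5)[OF r(1)] eps_regular_pointD(5)[OF r(2)]])
    have star: "NP z s (Suc t) = signed_partition_sum (\<lambda>K. the (epsJ EP K z)) {s..<Suc t}"
    proof -
      have "\<forall>a b. 1 \<le> a \<and> a < b \<and> b \<le> Suc n \<longrightarrow>
          NP z a b = signed_partition_sum (\<lambda>K. the (epsJ EP K z)) {a..<b}"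
        using inv by (subst (asm) signed_inverse_iff_partition_sum[where w = "\<lambda>K. the (epsJ EP K z)"])
          (use inv v in \<open>auto simp: signed_inverse_def\<close>)
      then show ?thesis using st by simp
    qed
    have d: "z \<in> dom (signed_partition_rsum (epsJ EP) {s..t})"
    proof (rule signed_partition_rsum_dom)
      fix P K assume P: "P \<in> interval_partitions {s..t}" "K \<in> P"
      then have "\<Union>P = {s..t}" and "\<exists>a b. a \<le> b \<and> K = {a..b}"
        by (auto simp: interval_partitions_def partition_on_def)
      then obtain a b where ab: "a \<le> b" "K = {a..b}" "K \<subseteq> {s..t}" using P(2) by blast
      then have "s \<le> a" "b \<le> t" by auto
      then have "epsJ EP K z = Some (MP z a (Suc b))"
        using prod_epsJ_value(1)[OF r, of a b] ab st z by simp
      then show "z \<in> dom (epsJ EP K)" by blast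
    qed
    have "epsJ_star EP {s..t} z = Some (NP z s (Suc t))" using prod_epsJ_value(2)[OF r st] z by simp
    then show ?thesis
      using star signed_partition_rsum_value[OF d] d
      by (auto simp: atLeastLessThanSuc_atLeastAtMost)
  qed
  then show ?thesis unfolding rat_eq_def using B(1) by (intro exI[of _ B]) blast
qed

lemma prod_is_eps_system: "is_eps_system n (prod_crystal C D) EP"
  unfolding is_eps_system_def Let_def space_of_product
proof (intro conjI ballI allI impI)
  fix J assume "J \<in> intervals n"
  then obtain s t where "J = {s..t}" "1 \<le> s" "s \<le> t" "t \<le> n" unfolding intervals_def by blast
  then show "rational_function Z (epsJ EP J)" "rational_function Z (epsJ_star EP J)"
    using rational_function_prod_epsJ by auto
qed (use prod_epsJ_singleton product_transform_rules prod_star_partition in blast)+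

end

theorem theorem5p9:
  fixes n :: nat
    and \<X> :: "'a crystal" and \<Y> :: "'b crystal"
    and E\<^sub>X :: "'a eps_system" and E\<^sub>Y :: "'b eps_system"
  assumes "n \<ge> 1"
    and "eps_geometric_crystal n \<X> E\<^sub>X"
    and "eps_geometric_crystal n \<Y> E\<^sub>Y"
    and "\<And>i. i \<in> {1..n} \<Longrightarrow>
           nonzero_on_components (space_of \<X>) (eps \<X> i) \<and>
           nonzero_on_components (space_of \<Y>) (eps \<Y> i) \<and>
           nonzero_on_components (space_of \<X>) (gam \<X> i) \<and>
           nonzero_on_components (space_of \<Y>) (gam \<Y> i)"
    and "geometric_crystal n (prod_crystal \<X> \<Y>)"
  shows "is_eps_system n (prod_crystal \<X> \<Y>) (prod_eps_system \<X> E\<^sub>X E\<^sub>Y) \<and>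
         eps_geometric_crystal n (prod_crystal \<X> \<Y>) (prod_eps_system \<X> E\<^sub>X E\<^sub>Y)"
proof -
  interpret eps_crystal_product n \<X> E\<^sub>X \<Y> E\<^sub>Y
    using assms by unfold_locales (auto simp: eps_geometric_crystal_def)
  show ?thesis
    using prod_is_eps_system assms(5) by (simp add: eps_geometric_crystal_def)
qed

end
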